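(* Let $k$ be a field, let $\Delta$ be a Dynkin quiver of type $\mathbb{D}_n$ ($n\ge 4$) or $\mathbb{E}_m$ ($m=6,7,8$), and let $M$ be its maximal indecomposable representation. If $\Delta$ is of type $\mathbb{D}_4$, then $M|\Delta''=0$. If $\Delta$ is of type $\mathbb{D}_n$ with $n\ge 5$, then $M|\Delta''$ is the direct sum of an antichain pair. If $\Delta$ is of type $\mathbb{E}_m$, then $M|\Delta''$ is the direct sum of four indecomposable representations $U,V,U',V'$ with $\mathrm{Hom}(U,V)\neq 0$, $\mathrm{Hom}(U',V')\ne 0$, and $\dim_k\mathrm{End}(M|\Delta'')=6$.
   Context: Representations are finite-dimensional over $k$; the orientation of $\Delta$ is arbitrary. The exceptional vertex $y$ of $\Delta$ is: for $\mathbb{D}_n$, with vertices $1,\dots,n$ and edges $1-3$, $2-3$, $i-(i+1)$ for $3\le i\le n-1$, the vertex $y=n-1$ (so for $\mathbb D_4$ it is the center). For $\mathbb{E}_6,\mathbb{E}_7,\mathbb{E}_8$, the graph is a star consisting of a center $c$ with three branches having, not counting $c$, $(1,2,2)$, $(1,2,3)$, $(1,2,4)$ vertices respectively; $y$ is the end vertex of the branch with $1$ vertex for $\mathbb E_6$, of the branch with $2$ vertices for $\mathbb E_7$, and of the branch with $4$ vertices for $\mathbb E_8$. $\Delta''$ is the full subquiver of $\Delta$ obtained by deleting $y$ and all neighbors of $y$, and $M|\Delta''$ is the restriction of $M$ to $\Delta''$. The maximal indecomposable representation $M$ is the indecomposable representation whose dimension vector is the maximal positive root. An antichain pair is a set of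 two $\mathrm{Hom}$-orthogonal representations whose endomorphism rings are division rings. *)

theory Defs
  imports
    "Graph_Theory.Digraph_Component"
    "HOL-Library.FuncSet"
    "HOL-Library.Function_Algebras"
    "HOL-Algebra.Ring"
begin

section \<open>Dynkin quivers\<close>

text \<open>A quiver is a well-formed \<open>pre_digraph\<close>: its arcs form a set of their own, with
  head and tail functions. A full subquiver is an \<open>induce_subgraph\<close>.\<close>

definition has_underlying_graph :: "('v, 'a) pre_digraph \<Rightarrow> 'v set \<Rightarrow> 'v set set \<Rightarrow> bool" where
  "has_underlying_graph Q W E \<longleftrightarrow> wf_digraph Q \<and> verts Q = W \<and>
     bij_betw (\<lambda>a. {tail Q a, head Q a}) (arcs Q) E"

definition D_edges :: "nat \<Rightarrow> nat set set" where
  "D_edges n = {{1, 3}, {2, 3}} \<union> {{i, i + 1} | i. 3 \<le> i \<and> i < n}"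

text \<open>In the following two predicates \<open>y\<close> is the exceptional vertex; \<open>p\<close> is a labelling
  of the vertices by the numbers from 1 to n.\<close>

definition dynkin_D :: "nat \<Rightarrow> ('v, 'a) pre_digraph \<Rightarrow> 'v \<Rightarrow> bool" where
  "dynkin_D n Q y \<longleftrightarrow> n \<ge> 4 \<and>
     (\<exists>p. inj_on p {1..n} \<and>
        has_underlying_graph Q (p ` {1..n}) ((\<lambda>e. p ` e) ` D_edges n) \<and>
        y = p (n - 1))"

definition path_edges :: "'v list \<Rightarrow> 'v set set" where
  "path_edges xs = {{xs ! i, xs ! Suc i} | i. Suc i < length xs}"

text \<open>The branches are listed from the center outwards, so that \<open>last\<close> gives the end
  vertex of a branch.\<close>

definition dynkin_E :: "nat \<Rightarrow> ('v, 'a) pre_digraph \<Rightarrow> 'v \<Rightarrow> bool" where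
  "dynkin_E m Q y \<longleftrightarrow> m \<in> {6, 7, 8} \<and>
     (\<exists>c b1 b2 b3. distinct (c # b1 @ b2 @ b3) \<and>
        length b1 = 1 \<and> length b2 = 2 \<and> length b3 = m - 4 \<and>
        has_underlying_graph Q (set (c # b1 @ b2 @ b3))
          (path_edges (c # b1) \<union> path_edges (c # b2) \<union> path_edges (c # b3)) \<and>
        y = (if m = 6 then last b1 else if m = 7 then last b2 else last b3))"

definition neighbors :: "('v, 'a) pre_digraph \<Rightarrow> 'v \<Rightarrow> 'v set" where
  "neighbors Q y = {x. x \<rightarrow>\<^bsub>Q\<^esub> y \<or> y \<rightarrow>\<^bsub>Q\<^esub> x}"

definition delete_with_neighbors :: "('v, 'a) pre_digraph \<Rightarrow> 'v \<Rightarrow> ('v, 'a) pre_digraph" where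
  "delete_with_neighbors Q y = Q \<restriction> (verts Q - ({y} \<union> neighbors Q y))"


section \<open>Positive roots\<close>

definition tits_form :: "('v, 'a) pre_digraph \<Rightarrow> ('v \<Rightarrow> int) \<Rightarrow> int" where
  "tits_form Q d = (\<Sum>v\<in>verts Q. (d v)\<^sup>2) - (\<Sum>a\<in>arcs Q. d (tail Q a) * d (head Q a))"

text \<open>Roots of a Dynkin graph are the integral vectors on which the Tits form takes the
  value 1; vectors vanish outside the vertex set.\<close>

definition positive_root :: "('v, 'a) pre_digraph \<Rightarrow> ('v \<Rightarrow> int) \<Rightarrow> bool" where
  "positive_root Q d \<longleftrightarrow> (\<forall>v. v \<notin> verts Q \<longrightarrow> d v = 0) \<and> (\<forall>v. d v \<ge> 0) \<and> tits_form Q d = 1"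

definition maximal_positive_root :: "('v, 'a) pre_digraph \<Rightarrow> ('v \<Rightarrow> int) \<Rightarrow> bool" where
  "maximal_positive_root Q d \<longleftrightarrow> positive_root Q d \<and> (\<forall>e. positive_root Q e \<and> d \<le> e \<longrightarrow> e = d)"


section \<open>Representations\<close>

text \<open>The vector spaces of a representation are subspaces of one ambient vector space with
  scalar multiplication \<open>s\<close>, which need not be finite-dimensional. Everything below takes the
  quiver \<open>Q\<close> as an argument and looks at a representation only at the vertices and arcs of
  \<open>Q\<close>. Hence the restriction of \<open>M\<close> to a subquiver is \<open>M\<close> itself, with the subquiver as
  the quiver argument.\<close>

record ('v, 'a, 'b) quiver_rep =
  rep_space :: "'v \<Rightarrow> 'b set"
  rep_map :: "'a \<Rightarrow> 'b \<Rightarrow> 'b"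

definition linear_map_on ::
  "('k::field \<Rightarrow> 'b::ab_group_add \<Rightarrow> 'b) \<Rightarrow> 'b set \<Rightarrow> 'b set \<Rightarrow> ('b \<Rightarrow> 'b) \<Rightarrow> bool" where
  "linear_map_on s V W f \<longleftrightarrow> f \<in> V \<rightarrow> W \<and>
     (\<forall>x\<in>V. \<forall>y\<in>V. f (x + y) = f x + f y) \<and> (\<forall>c. \<forall>x\<in>V. f (s c x) = s c (f x))"

definition is_rep ::
  "('k::field \<Rightarrow> 'b::ab_group_add \<Rightarrow> 'b) \<Rightarrow> ('v, 'a) pre_digraph \<Rightarrow> ('v, 'a, 'b) quiver_rep \<Rightarrow> bool"
  where
  "is_rep s Q M \<longleftrightarrow> vector_space s \<and> wf_digraph Q \<and>
     (\<forall>v\<in>verts Q. \<exists>B. finite B \<and> rep_space M v = module.span s B) \<and>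
     (\<forall>a\<in>arcs Q. linear_map_on s (rep_space M (tail Q a)) (rep_space M (head Q a)) (rep_map M a))"

definition zero_rep :: "('v, 'a) pre_digraph \<Rightarrow> ('v, 'a, 'b::ab_group_add) quiver_rep \<Rightarrow> bool" where
  "zero_rep Q M \<longleftrightarrow> (\<forall>v\<in>verts Q. rep_space M v = {0})"

definition dim_vector ::
  "('k::field \<Rightarrow> 'b::ab_group_add \<Rightarrow> 'b) \<Rightarrow> ('v, 'a) pre_digraph \<Rightarrow> ('v, 'a, 'b) quiver_rep \<Rightarrow> 'v \<Rightarrow> int"
  where
  "dim_vector s Q M v = (if v \<in> verts Q then int (vector_space.dim s (rep_space M v)) else 0)"

definition subrep ::
  "('k::field \<Rightarrow> 'b::ab_group_add \<Rightarrow> 'b) \<Rightarrow> ('v, 'a) pre_digraph \<Rightarrow>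
   ('v, 'a, 'b) quiver_rep \<Rightarrow> ('v, 'a, 'b) quiver_rep \<Rightarrow> bool"
  where
  "subrep s Q N M \<longleftrightarrow> is_rep s Q N \<and> (\<forall>v\<in>verts Q. rep_space N v \<subseteq> rep_space M v) \<and>
     (\<forall>a\<in>arcs Q. \<forall>x\<in>rep_space N (tail Q a). rep_map N a x = rep_map M a x)"

text \<open>\<open>M\<close> is the internal direct sum of the subrepresentations in the list \<open>Ns\<close>.\<close>

definition is_direct_sum ::
  "('k::field \<Rightarrow> 'b::ab_group_add \<Rightarrow> 'b) \<Rightarrow> ('v, 'a) pre_digraph \<Rightarrow>
   ('v, 'a, 'b) quiver_rep \<Rightarrow> ('v, 'a, 'b) quiver_rep list \<Rightarrow> bool"
  where
  "is_direct_sum s Q M Ns \<longleftrightarrow> (\<forall>N\<in>set Ns. subrep s Q N M) \<and>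
     (\<forall>v\<in>verts Q. bij_betw (\<lambda>x. \<Sum>i<length Ns. x i)
        (\<Pi>\<^sub>E i\<in>{..<length Ns}. rep_space (Ns ! i) v) (rep_space M v))"

definition indecomposable ::
  "('k::field \<Rightarrow> 'b::ab_group_add \<Rightarrow> 'b) \<Rightarrow> ('v, 'a) pre_digraph \<Rightarrow> ('v, 'a, 'b) quiver_rep \<Rightarrow> bool"
  where
  "indecomposable s Q M \<longleftrightarrow> is_rep s Q M \<and> \<not> zero_rep Q M \<and>
     (\<forall>A B. is_direct_sum s Q M [A, B] \<longrightarrow> zero_rep Q A \<or> zero_rep Q B)"

definition maximal_indecomposable ::
  "('k::field \<Rightarrow> 'b::ab_group_add \<Rightarrow> 'b) \<Rightarrow> ('v, 'a) pre_digraph \<Rightarrow> ('v, 'a, 'b) quiver_rep \<Rightarrow> bool"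
  where
  "maximal_indecomposable s Q M \<longleftrightarrow>
     indecomposable s Q M \<and> maximal_positive_root Q (dim_vector s Q M)"


section \<open>Homomorphisms\<close>

text \<open>A homomorphism is a family of linear maps indexed by vertices. The maps are extended by
  zero outside the vector spaces (and the family by zero outside the vertex set), so that equality
  of homomorphisms is equality of functions and \<open>rep_hom s Q M N\<close> is a subspace of the function
  space with pointwise operations.\<close>

definition rep_hom ::
  "('k::field \<Rightarrow> 'b::ab_group_add \<Rightarrow> 'b) \<Rightarrow> ('v, 'a) pre_digraph \<Rightarrow>
   ('v, 'a, 'b) quiver_rep \<Rightarrow> ('v, 'a, 'b) quiver_rep \<Rightarrow> ('v \<Rightarrow> 'b \<Rightarrow> 'b) set"
  where
  "rep_hom s Q M N = {f.
     (\<forall>v x. v \<notin> verts Q \<or> x \<notin> rep_space M v \<longrightarrow> f v x = 0) \<and>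
     (\<forall>v\<in>verts Q. linear_map_on s (rep_space M v) (rep_space N v) (f v)) \<and>
     (\<forall>a\<in>arcs Q. \<forall>x\<in>rep_space M (tail Q a).
        f (head Q a) (rep_map M a x) = rep_map N a (f (tail Q a) x))}"

definition hom_dim ::
  "('k::field \<Rightarrow> 'b::ab_group_add \<Rightarrow> 'b) \<Rightarrow> ('v, 'a) pre_digraph \<Rightarrow>
   ('v, 'a, 'b) quiver_rep \<Rightarrow> ('v, 'a, 'b) quiver_rep \<Rightarrow> nat"
  where
  "hom_dim s Q M N = vector_space.dim (\<lambda>c f v x. s c (f v x)) (rep_hom s Q M N)"

definition End_ring ::
  "('k::field \<Rightarrow> 'b::ab_group_add \<Rightarrow> 'b) \<Rightarrow> ('v, 'a) pre_digraph \<Rightarrow>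
   ('v, 'a, 'b) quiver_rep \<Rightarrow> ('v \<Rightarrow> 'b \<Rightarrow> 'b) ring"
  where
  "End_ring s Q M = \<lparr>carrier = rep_hom s Q M M, monoid.mult = (\<lambda>g f v. g v \<circ> f v),
     one = (\<lambda>v x. if v \<in> verts Q \<and> x \<in> rep_space M v then x else 0),
     zero = 0, add = (+)\<rparr>"

definition division_ring :: "('r, 'm) ring_scheme \<Rightarrow> bool" where
  "division_ring R \<longleftrightarrow> ring R \<and> \<one>\<^bsub>R\<^esub> \<noteq> \<zero>\<^bsub>R\<^esub> \<and> Units R = carrier R - {\<zero>\<^bsub>R\<^esub>}"

definition antichain_pair ::
  "('k::field \<Rightarrow> 'b::ab_group_add \<Rightarrow> 'b) \<Rightarrow> ('v, 'a) pre_digraph \<Rightarrow>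
   ('v, 'a, 'b) quiver_rep \<Rightarrow> ('v, 'a, 'b) quiver_rep \<Rightarrow> bool"
  where
  "antichain_pair s Q A B \<longleftrightarrow> is_rep s Q A \<and> is_rep s Q B \<and>
     rep_hom s Q A B = {0} \<and> rep_hom s Q B A = {0} \<and>
     division_ring (End_ring s Q A) \<and> division_ring (End_ring s Q B)"

end

theory Submission
  imports Defs
begin

text \<open>Write \<open>(d, e)\<close> for the symmetrised Tits form, normalised so that \<open>(d, d)\<close> is twice the value
  of the Tits form at \<open>d\<close>, write \<open>e\<^sub>x\<close> for the unit vector at the vertex \<open>x\<close>, and let \<open>q\<close> be the
  maximal positive root.

  What the graphs contribute. In the types D and E one has \<open>(q, e\<^sub>y) = 1\<close>, \<open>(q, e\<^sub>x) = 0\<close> for every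
  other vertex \<open>x\<close>, and \<open>q y = 2\<close>. An explicit positive vector
  with these properties on a connected graph
  (\<open>root_certificate\<close>, found in \<open>dynkin_E_certificate\<close> and \<open>dynkin_D_certificate\<close>) already forces the
  Tits form to be positive definite (\<open>root_certificate_positive_definite\<close>) and forces every maximal
  positive root to be this vector (\<open>maximal_positive_root_eq\<close>).

  What the representations contribute. For representations \<open>M\<close> and \<open>N\<close> consider the map that sends a
  family of linear maps \<open>f\<^sub>v : M\<^sub>v \<rightarrow> N\<^sub>v\<close> to its defects of commutation along the arrows. Its kernel is
  \<open>Hom(M, N)\<close> and its cokernel is \<open>Ext\<^sup>1(M, N)\<close>, so the rank theorem says that \<open>dim Hom - dim Ext\<^sup>1\<close> is the
  Euler form of the dimension vectors (\<open>euler_form_le_hom_dim\<close>). If the Tits form is positive definite, then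
  every indecomposable representation has one-dimensional endomorphism ring and no self-extensions
  (\<open>indecomposable_exceptional\<close>). The description of \<open>Ext\<^sup>1\<close> as a cokernel shows at once that its
  vanishing passes to full subquivers (\<open>ext_vanishes_restrict\<close>) and to direct summands
  (\<open>ext_vanishes_retract\<close>). Hence the restriction of \<open>M\<close> to the subquiver is rigid, and the dimension of its
  endomorphism ring is the value of the Tits form at the restriction \<open>d\<close> of \<open>q\<close>.

  The count. In type E the vertex \<open>y\<close> has a single neighbor \<open>z\<close>, and \<open>q z = 3\<close>. So
  \<open>d = q - 2 e\<^sub>y - 3 e\<^sub>z\<close>, and \<open>(d, b) = 3 h(b)\<close> for all \<open>b\<close> supported on the subquiver, where
  \<open>h(b) = - (e\<^sub>z, b)\<close> is the sum of \<open>b\<close> over the neighbors of \<open>z\<close>. One finds \<open>h(d) = 4\<close>, so that the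
  Tits form takes the value 6 at \<open>d\<close>. Let \<open>b\<^sub>1, ..., b\<^sub>r\<close> be the dimension vectors of the indecomposable
  summands. By rigidity \<open>(b\<^sub>i, b\<^sub>j)\<close> is the sum of the dimensions of the two \<open>Hom\<close> spaces between the
  summands, so it is nonnegative, and \<open>(b\<^sub>i, b\<^sub>i) = 2\<close>. Therefore \<open>3 h(b\<^sub>i) = (d, b\<^sub>i) \<ge> 2\<close> and
  \<open>h(b\<^sub>i) \<ge> 1\<close>. The Tits form at \<open>d - 2 b\<^sub>i\<close> is \<open>10 - 6 h(b\<^sub>i)\<close>, and being nonnegative it gives \<open>h(b\<^sub>i) \<le> 1\<close>.
  So \<open>h(b\<^sub>i) = 1\<close> for all \<open>i\<close>, there are exactly four summands, and for each of them the products with the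
  other three add up to \<open>3 - 2 = 1\<close>: each summand has exactly one partner, with a one-dimensional space of
  homomorphisms in exactly one direction. In type D with \<open>n \<ge> 5\<close> the two neighbors of \<open>y\<close> have \<open>q\<close>-values 2 and 1,
  and the same argument with \<open>(d, b) = 2 h(b)\<close> and \<open>h(d) = 2\<close> yields two orthogonal summands
  (\<open>rigid_summands_count\<close> treats both cases). For \<open>n = 4\<close> the subquiver is empty.\<close>


section \<open>Finite-dimensional subspaces and maps that are linear on a subspace\<close>

definition findim :: "('k::field \<Rightarrow> 'b::ab_group_add \<Rightarrow> 'b) \<Rightarrow> 'b set \<Rightarrow> bool" where
  "findim s V \<longleftrightarrow> (\<exists>B. finite B \<and> V = module.span s B)"

text \<open>The maps of a representation are linear only on the spaces between which they act, and nothing is known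
  about their values elsewhere. Domain and codomain may carry different scalar multiplications, because
  evaluation maps go from function spaces to the ambient space.\<close>

definition linear_on ::
  "('k \<Rightarrow> 'b::ab_group_add \<Rightarrow> 'b) \<Rightarrow> ('k \<Rightarrow> 'c::ab_group_add \<Rightarrow> 'c) \<Rightarrow> 'b set \<Rightarrow> ('b \<Rightarrow> 'c) \<Rightarrow> bool"
  where
  "linear_on s t V f \<longleftrightarrow>
     (\<forall>x\<in>V. \<forall>y\<in>V. f (x + y) = f x + f y) \<and> (\<forall>c. \<forall>x\<in>V. f (s c x) = t c (f x))"

lemma linear_map_on_iff: "linear_map_on s V W f \<longleftrightarrow> f \<in> V \<rightarrow> W \<and> linear_on s s V f"
  by (simp add: linear_map_on_def linear_on_def)

context vector_space
begin

lemma findim_subspace: "findim scale V \<Longrightarrow> subspace V"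
  by (auto simp: findim_def)

lemma findim_basis:
  assumes "findim scale V"
  obtains B where "finite B" "independent B" "B \<subseteq> V" "span B = V" "card B = dim V"
proof -
  obtain T where T: "finite T" "V = span T" using assms by (auto simp: findim_def)
  obtain B where B: "B \<subseteq> V" "independent B" "V \<subseteq> span B" "card B = dim V"
    using basis_exists by blast
  have "finite B" using independent_span_bound[OF T(1) B(2)] B(1) T(2) by auto
  moreover have "span B = V" using B span_minimal[OF B(1)] T by auto
  ultimately show thesis using that B by auto
qed

lemma findim_subset:
  assumes V: "findim scale V" and A: "subspace A" "A \<subseteq> V"
  shows "findim scale A" and "dim A \<le> dim V" and "dim A = dim V \<Longrightarrow> A = V"
proof -
  obtain C where C: "finite C" "independent C" "C \<subseteq> V" "span C = V" "card C = dim V"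
    using findim_basis[OF V] .
  obtain B where B: "B \<subseteq> A" "independent B" "A \<subseteq> span B" "card B = dim A"
    using basis_exists by blast
  have fin: "finite B" "card B \<le> card C"
    using independent_span_bound[OF C(1) B(2)] B(1) A(2) C(4) by auto
  have spB: "span B = A" using B A(1) span_minimal by blast
  show "findim scale A" using fin spB by (auto simp: findim_def)
  show "dim A \<le> dim V" using fin B C by simp
  assume eq: "dim A = dim V"
  obtain B' where B': "B \<subseteq> B'" "B' \<subseteq> V" "independent B'" "V \<subseteq> span B'"
    using maximal_independent_subset_extend[of B V] B A by blast
  have fB': "finite B'" "card B' \<le> card C"
    using independent_span_bound[OF C(1) B'(3)] B'(2) C(4) by auto
  have "B = B'" using card_seteq[OF fB'(1) B'(1)] fB'(2) C(5) B(4) eq by simp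
  then show "A = V" using spB B' A(2) by auto
qed

lemma findim_0: "findim scale {0}" and dim_0: "dim {0} = 0"
proof -
  have sp: "span {} = {0}" by simp
  show "findim scale {0}" unfolding findim_def using sp by (intro exI[of _ "{}"]) auto
  show "dim {0} = 0" using dim_eq_card[of "{}" "{0}"] independent_empty sp by auto
qed

lemma findim_dim_0: "findim scale V \<Longrightarrow> dim V = 0 \<Longrightarrow> V = {0}"
  by (metis findim_basis card_0_eq span_empty)

lemma linear_on_0: "linear_on scale t V f \<Longrightarrow> subspace V \<Longrightarrow> f 0 = 0"
  unfolding linear_on_def by (metis add_cancel_right_left subspace_0)

end

lemma linear_on_sum:
  assumes "vector_space s" "vector_space t" "linear_on s t V f" "module.subspace s V"
    "\<And>i. i \<in> I \<Longrightarrow> x i \<in> V"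
  shows "f (\<Sum>i\<in>I. x i) = (\<Sum>i\<in>I. f (x i))"
proof -
  interpret S: vector_space s by fact
  have "(\<forall>i\<in>I. x i \<in> V) \<longrightarrow> (\<Sum>i\<in>I. x i) \<in> V \<and> f (\<Sum>i\<in>I. x i) = (\<Sum>i\<in>I. f (x i))"
  proof (induction I rule: infinite_finite_induct)
    case (insert i I)
    then show ?case using assms(3,4) by (auto simp: linear_on_def S.subspace_add)
  qed (use assms S.linear_on_0 S.subspace_0 in auto)
  then show ?thesis using assms by blast
qed

lemma linear_on_diff:
  assumes "vector_space s" "vector_space t" "linear_on s t V f" "module.subspace s V" "x \<in> V" "y \<in> V"
  shows "f (x - y) = f x - f y"
proof -
  interpret S: vector_space s by fact
  have "x - y \<in> V" using assms S.subspace_diff by blast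
  then have "f ((x - y) + y) = f (x - y) + f y" using assms unfolding linear_on_def by blast
  then show ?thesis by simp
qed

context vector_space_pair
begin

text \<open>Replaces a map that is linear on a subspace by a globally linear one, to which the library applies.\<close>

lemma linear_on_extend:
  assumes V: "vs1.subspace V" and f: "linear_on s1 s2 V f" and W: "vs2.subspace W" "f ` V \<subseteq> W"
  obtains g where "Vector_Spaces.linear s1 s2 g" "\<And>x. x \<in> V \<Longrightarrow> g x = f x" "range g \<subseteq> W"
proof -
  obtain B where B: "B \<subseteq> V" "vs1.independent B" "V \<subseteq> vs1.span B"
    using vs1.maximal_independent_subset by blast
  obtain g where g: "Vector_Spaces.linear s1 s2 g" "\<forall>x\<in>B. g x = f x" "range g = vs2.span (f ` B)"
    using linear_independent_extend_subspace[OF B(2), of f] by blast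
  interpret g: Vector_Spaces.linear s1 s2 g by fact
  have "g x = f x" if "x \<in> vs1.span B" for x
  proof -
    have "x \<in> V \<and> g x = f x" using that
    proof (induction rule: vs1.span_induct_alt)
      case base
      then show ?case using vs1.linear_on_0[OF f V] vs1.subspace_0[OF V] g.zero by simp
    next
      case (step c b y)
      then have "b \<in> V" "g b = f b" using B g by auto
      then show ?case using step f V
        by (auto simp: linear_on_def g.add g.scale vs1.subspace_add vs1.subspace_scale)
    qed
    then show ?thesis by simp
  qed
  moreover have "f ` B \<subseteq> W" using B(1) W(2) by auto
  then have "range g \<subseteq> W" unfolding g(3) by (rule vs2.span_minimal[OF _ W(1)])
  ultimately show thesis using that g(1) B(3) by blast
qed

text \<open>Finite dimension of the domain is a conclusion here, not a hypothesis, since it is also needed for the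
  function spaces below. A basis of the kernel and lifts of a basis of the image together span the domain;
  they are independent because a lift in the span of the other vectors would be mapped into the span of the
  other basis vectors of the image.\<close>

lemma rank_nullity:
  assumes V: "vs1.subspace V" and f: "linear_on s1 s2 V f"
    and K: "findim s1 {x \<in> V. f x = 0}" and I: "findim s2 (f ` V)"
  shows "findim s1 V" and "vs1.dim V = vs1.dim {x \<in> V. f x = 0} + vs2.dim (f ` V)"
proof -
  have sI: "vs2.subspace (f ` V)" using I vs2.findim_subspace by blast
  obtain g where g: "Vector_Spaces.linear s1 s2 g" "\<And>x. x \<in> V \<Longrightarrow> g x = f x"
    by (rule linear_on_extend[OF V f sI]) auto
  interpret g: Vector_Spaces.linear s1 s2 g by fact
  let ?K = "{x \<in> V. f x = 0}"
  obtain B where B: "finite B" "vs1.independent B" "B \<subseteq> ?K" "vs1.span B = ?K" "card B = vs1.dim ?K"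
    using vs1.findim_basis[OF K] .
  obtain C where C: "finite C" "vs2.independent C" "C \<subseteq> f ` V" "vs2.span C = f ` V"
      "card C = vs2.dim (f ` V)"
    using vs2.findim_basis[OF I] .
  obtain D where D: "D \<subseteq> V" "inj_on f D" "f ` D = C"
    using C(3) unfolding subset_image_inj by blast
  have gf: "g x = f x" if "x \<in> D" for x using that D(1) g(2) by auto
  have gD: "g ` D = C" using D(3) gf by auto
  have gD2: "inj_on g D" using D(2) gf by (auto simp: inj_on_def)
  have finD: "finite D" using D(2,3) C(1) finite_image_iff by blast
  have spanV: "vs1.span (B \<union> D) = V"
  proof
    show "vs1.span (B \<union> D) \<subseteq> V" using vs1.span_minimal[of "B \<union> D", OF _ V] B(3) D(1) by blast
    show "V \<subseteq> vs1.span (B \<union> D)"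
    proof
      fix x assume x: "x \<in> V"
      have "g x \<in> vs2.span (g ` D)" using x g(2) gD C by auto
      then have "g x \<in> g ` vs1.span D" using g.span_image by simp
      then obtain d where d: "d \<in> vs1.span D" "g x = g d" by blast
      have dV: "d \<in> V" using d D vs1.span_minimal[OF _ V] by blast
      have "x - d \<in> ?K" using x dV d g by (metis (mono_tags, lifting) V mem_Collect_eq
          vs1.subspace_diff g.diff right_minus_eq)
      then have "x - d \<in> vs1.span (B \<union> D)" using B vs1.span_mono[of B "B \<union> D"] by blast
      moreover have "d \<in> vs1.span (B \<union> D)" using d vs1.span_mono[of D "B \<union> D"] by blast
      ultimately show "x \<in> vs1.span (B \<union> D)" using vs1.span_add by fastforce
    qed
  qed
  show fV: "findim s1 V" unfolding findim_def using B(1) finD spanV by (intro exI[of _ "B \<union> D"]) auto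
  have ind: "vs1.independent (B \<union> D')" if "finite D'" "D' \<subseteq> D" for D'
    using that
  proof (induction D')
    case empty
    then show ?case using B by simp
  next
    case (insert d D')
    have "d \<notin> vs1.span (B \<union> D')"
    proof
      assume "d \<in> vs1.span (B \<union> D')"
      then have "g d \<in> vs2.span (g ` (B \<union> D'))" using g.span_image by blast
      moreover have "g ` (B \<union> D') \<subseteq> insert 0 (g ` D')" using B(3) g(2) by auto
      ultimately have "g d \<in> vs2.span (g ` D')"
        using vs2.span_mono vs2.span_insert_0 by blast
      moreover have "g ` D' \<subseteq> C - {g d}" using gD gD2 insert by (auto simp: inj_on_def)
      moreover have "g d \<in> C" using gD insert by auto
      ultimately show False using C(2) vs2.span_mono unfolding vs2.dependent_def by blast
    qed
    then show ?case using insert vs1.independent_insertI by simp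
  qed
  have disj: "B \<inter> D = {}"
  proof -
    have "0 \<notin> C" using C(2) vs2.dependent_zero by blast
    then show ?thesis using B(3) D(3) by auto
  qed
  have "vs1.dim V = card (B \<union> D)"
    using vs1.dim_span_eq_card_independent[OF ind[OF finD order_refl]] spanV by simp
  also have "\<dots> = card B + card C"
    using card_Un_disjoint[OF B(1) finD disj] card_image[OF D(2)] D(3) by simp
  finally show "vs1.dim V = vs1.dim {x \<in> V. f x = 0} + vs2.dim (f ` V)"
    using B C by simp
qed

end

lemma linear_on_subset: "linear_on s t V f \<Longrightarrow> U \<subseteq> V \<Longrightarrow> linear_on s t U f"
  unfolding linear_on_def by blast

context vector_space_pair
begin

lemma subspace_kernel_on: "vs1.subspace V \<Longrightarrow> linear_on s1 s2 V f \<Longrightarrow> vs1.subspace {x \<in> V. f x = 0}"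
  using vs1.linear_on_0[of s2 V f] unfolding linear_on_def vs1.subspace_def by auto

lemma subspace_image_on:
  assumes V: "vs1.subspace V" and f: "linear_on s1 s2 V f"
  shows "vs2.subspace (f ` V)"
  unfolding vs2.subspace_def
proof (intro conjI ballI allI)
  show "0 \<in> f ` V" using vs1.linear_on_0[OF f V] vs1.subspace_0[OF V] by (metis imageI)
next
  fix x y assume "x \<in> f ` V" "y \<in> f ` V"
  then obtain u v where uv: "u \<in> V" "v \<in> V" "x = f u" "y = f v" by blast
  then have "x + y = f (u + v)" using f by (simp add: linear_on_def)
  then show "x + y \<in> f ` V" using vs1.subspace_add[OF V] uv by blast
next
  fix c x assume "x \<in> f ` V"
  then obtain u where u: "u \<in> V" "x = f u" by blast
  then have "s2 c x = f (s1 c u)" using f by (simp add: linear_on_def)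
  then show "s2 c x \<in> f ` V" using vs1.subspace_scale[OF V] u by blast
qed

lemma findim_image:
  assumes V: "findim s1 V" and f: "linear_on s1 s2 V f"
  shows "findim s2 (f ` V)"
proof -
  have sV: "vs1.subspace V" using V vs1.findim_subspace by blast
  obtain g where g: "Vector_Spaces.linear s1 s2 g" "\<And>x. x \<in> V \<Longrightarrow> g x = f x"
    by (rule linear_on_extend[OF sV f vs2.subspace_UNIV]) auto
  interpret g: Vector_Spaces.linear s1 s2 g by fact
  obtain B where B: "finite B" "V = vs1.span B" using V by (auto simp: findim_def)
  have "f ` V = g ` V" using g(2) by simp
  also have "\<dots> = vs2.span (g ` B)" using B g.span_image by simp
  finally show ?thesis using B by (auto simp: findim_def)
qed

lemma rank_nullity_findim:
  assumes V: "findim s1 V" and f: "linear_on s1 s2 V f"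
  shows "vs1.dim V = vs1.dim {x \<in> V. f x = 0} + vs2.dim (f ` V)"
proof -
  have sV: "vs1.subspace V" using V vs1.findim_subspace by blast
  show ?thesis
    using rank_nullity(2)[OF sV f vs1.findim_subset(1)[OF V subspace_kernel_on[OF sV f]] findim_image[OF V f]]
    by auto
qed

lemma linear_on_inj_iff:
  assumes V: "vs1.subspace V" and f: "linear_on s1 s2 V f"
  shows "inj_on f V \<longleftrightarrow> (\<forall>x\<in>V. f x = 0 \<longrightarrow> x = 0)"
proof -
  have f0: "f 0 = 0" "0 \<in> V" using vs1.linear_on_0[OF f V] vs1.subspace_0[OF V] by auto
  show ?thesis
  proof
    assume "inj_on f V" then show "\<forall>x\<in>V. f x = 0 \<longrightarrow> x = 0" using f0 by (metis inj_onD)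
  next
    assume r: "\<forall>x\<in>V. f x = 0 \<longrightarrow> x = 0"
    show "inj_on f V"
    proof (rule inj_onI)
      fix x y assume xy: "x \<in> V" "y \<in> V" "f x = f y"
      have "f (x - y) = 0" using linear_on_diff[OF _ _ f V xy(1,2)] xy(3)
          vs1.vector_space_axioms vs2.vector_space_axioms by simp
      moreover have "x - y \<in> V" using vs1.subspace_diff[OF V] xy by blast
      ultimately have "x - y = 0" using r by blast
      then show "x = y" by simp
    qed
  qed
qed

lemma kernel_on_trivial:
  assumes V: "vs1.subspace V" and f: "linear_on s1 s2 V f" and "inj_on f V"
  shows "{x \<in> V. f x = 0} = {0}"
  using assms linear_on_inj_iff[OF V f] vs1.linear_on_0[OF f V] vs1.subspace_0[OF V] by auto

lemma dim_image_inj: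
  assumes V: "findim s1 V" and f: "linear_on s1 s2 V f" and i: "inj_on f V"
  shows "vs2.dim (f ` V) = vs1.dim V"
  using rank_nullity_findim[OF V f] kernel_on_trivial[OF vs1.findim_subspace[OF V] f i] vs1.dim_0
  by simp

lemma findim_inj:
  assumes V: "vs1.subspace V" and f: "linear_on s1 s2 V f" and i: "inj_on f V"
    and W: "findim s2 (f ` V)"
  shows "findim s1 V"
  using rank_nullity(1)[OF V f _ W] kernel_on_trivial[OF V f i] vs1.findim_0 by simp

lemma inj_on_of_dim_image:
  assumes V: "findim s1 V" and f: "linear_on s1 s2 V f" and d: "vs2.dim (f ` V) = vs1.dim V"
  shows "inj_on f V"
proof -
  have sV: "vs1.subspace V" using V vs1.findim_subspace by blast
  have "findim s1 {x \<in> V. f x = 0}"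
    using vs1.findim_subset(1)[OF V subspace_kernel_on[OF sV f]] by auto
  moreover have "vs1.dim {x \<in> V. f x = 0} = 0" using rank_nullity_findim[OF V f] d by simp
  ultimately have "{x \<in> V. f x = 0} = {0}" by (rule vs1.findim_dim_0)
  then show ?thesis using linear_on_inj_iff[OF sV f] by auto
qed

end

definition fun_scale :: "('k \<Rightarrow> 'b \<Rightarrow> 'b) \<Rightarrow> 'k \<Rightarrow> ('i \<Rightarrow> 'b) \<Rightarrow> 'i \<Rightarrow> 'b" where
  "fun_scale s c f x = s c (f x)"

lemma vector_space_fun_scale:
  assumes "vector_space s" shows "vector_space (fun_scale s)"
proof -
  interpret vector_space s by fact
  show ?thesis
    by unfold_locales (auto simp: fun_scale_def fun_eq_iff scale_right_distrib scale_left_distrib)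
qed

text \<open>The zero values outside the index set make this a subspace of the function space.\<close>

definition prod_space :: "'i set \<Rightarrow> ('i \<Rightarrow> 'b::zero set) \<Rightarrow> ('i \<Rightarrow> 'b) set" where
  "prod_space I W = {f. (\<forall>i\<in>I. f i \<in> W i) \<and> (\<forall>i. i \<notin> I \<longrightarrow> f i = 0)}"

lemma subspace_prod_space:
  assumes "vector_space s" and W: "\<And>i. i \<in> I \<Longrightarrow> module.subspace s (W i)"
  shows "module.subspace (fun_scale s) (prod_space I W)"
proof -
  interpret S: vector_space s by fact
  interpret F: vector_space "fun_scale s" by (rule vector_space_fun_scale) fact
  show ?thesis
    unfolding F.subspace_def prod_space_def
    using S.subspace_0[OF W] S.subspace_add[OF W] S.subspace_scale[OF W] by (auto simp: fun_scale_def)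
qed

text \<open>Induction on the index set: evaluation at a new index has the old product as its kernel.\<close>

lemma dim_prod_space:
  assumes "vector_space s" and "finite I" and W: "\<And>i. i \<in> I \<Longrightarrow> findim s (W i)"
  shows "findim (fun_scale s) (prod_space I W) \<and>
    vector_space.dim (fun_scale s) (prod_space I W) = (\<Sum>i\<in>I. vector_space.dim s (W i))"
  using assms(2) W
proof (induction I)
  interpret S: vector_space s by fact
  interpret F: vector_space "fun_scale s" by (rule vector_space_fun_scale) fact
  {
    case empty
    have "prod_space {} W = {0}" by (auto simp: prod_space_def)
    then show ?case using F.findim_0 F.dim_0 by simp
  next
    case (insert i I)
    interpret P: vector_space_pair "fun_scale s" s by unfold_locales
    let ?V = "prod_space (insert i I) W" let ?e = "\<lambda>f. f i"
    have lin: "linear_on (fun_scale s) s ?V ?e" by (auto simp: linear_on_def fun_scale_def)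
    have sub: "F.subspace ?V"
      by (rule subspace_prod_space[OF assms(1)]) (rule S.findim_subspace[OF insert.prems])
    have ker: "{f \<in> ?V. ?e f = 0} = prod_space I W"
      using insert(2) S.subspace_0[OF S.findim_subspace[OF insert.prems]]
      by (auto simp: prod_space_def) metis
    have im: "?e ` ?V = W i"
    proof
      show "W i \<subseteq> ?e ` ?V"
      proof
        fix w assume w: "w \<in> W i"
        have "(\<lambda>j. if j = i then w else 0) \<in> ?V"
          using w S.subspace_0[OF S.findim_subspace[OF insert.prems]] by (auto simp: prod_space_def)
        from imageI[OF this, of ?e] show "w \<in> ?e ` ?V" by simp
      qed
    qed (auto simp: prod_space_def)
    show ?case
      using P.rank_nullity[OF sub lin] insert unfolding ker im by auto
  }
qed

definition hom_space :: "('k::field \<Rightarrow> 'b::ab_group_add \<Rightarrow> 'b) \<Rightarrow> 'b set \<Rightarrow> 'b set \<Rightarrow> ('b \<Rightarrow> 'b) set" where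
  "hom_space s V W = {f. linear_map_on s V W f \<and> (\<forall>x. x \<notin> V \<longrightarrow> f x = 0)}"

lemma subspace_hom_space:
  assumes "vector_space s" and V: "module.subspace s V" and W: "module.subspace s W"
  shows "module.subspace (fun_scale s) (hom_space s V W)"
proof -
  interpret S: vector_space s by fact
  interpret F: vector_space "fun_scale s" by (rule vector_space_fun_scale) fact
  show ?thesis
    unfolding F.subspace_def hom_space_def linear_map_on_def Pi_iff
    using S.subspace_0[OF W] S.subspace_add[OF W] S.subspace_scale[OF W]
    by (auto simp: fun_scale_def S.scale_right_distrib mult.commute algebra_simps)
qed

text \<open>Restriction to a basis of \<open>V\<close> identifies the linear maps from \<open>V\<close> to \<open>W\<close> with the families of
  vectors of \<open>W\<close> indexed by that basis.\<close>

lemma dim_hom_space: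
  assumes "vector_space s" and V: "findim s V" and W: "findim s W"
  shows "findim (fun_scale s) (hom_space s V W) \<and>
    vector_space.dim (fun_scale s) (hom_space s V W) = vector_space.dim s V * vector_space.dim s W"
proof -
  interpret S: vector_space s by fact
  interpret F: vector_space "fun_scale s :: 'a \<Rightarrow> ('b \<Rightarrow> 'b) \<Rightarrow> _" by (rule vector_space_fun_scale) fact
  interpret P: vector_space_pair "fun_scale s :: 'a \<Rightarrow> ('b \<Rightarrow> 'b) \<Rightarrow> _" "fun_scale s :: 'a \<Rightarrow> ('b \<Rightarrow> 'b) \<Rightarrow> _"
    by unfold_locales
  interpret SP: vector_space_pair s s by unfold_locales
  note sV = S.findim_subspace[OF V] and sW = S.findim_subspace[OF W]
  obtain B where B: "finite B" "S.independent B" "B \<subseteq> V" "S.span B = V" "card B = S.dim V"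
    using S.findim_basis[OF V] .
  let ?r = "\<lambda>f x. if x \<in> B then f x else (0::'b)"
  let ?H = "hom_space s V W"
  have lin: "linear_on (fun_scale s) (fun_scale s) ?H ?r"
    by (auto simp: linear_on_def fun_scale_def fun_eq_iff)
  have inj: "inj_on ?r ?H"
  proof (rule inj_onI)
    fix f g assume fg: "f \<in> ?H" "g \<in> ?H" "?r f = ?r g"
    then have eq: "f x = g x" if "x \<in> B" for x using that by (metis (mono_tags, lifting))
    have "f x = g x" if "x \<in> S.span B" for x
    proof -
      have "x \<in> V \<and> f x = g x" using that
      proof (induction rule: S.span_induct_alt)
        case base
        then show ?case using fg S.linear_on_0[OF _ sV, of s f] S.linear_on_0[OF _ sV, of s g]
            S.subspace_0[OF sV]
          by (simp add: hom_space_def linear_map_on_iff)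
      next
        case (step c b y)
        then have "b \<in> V" "f b = g b" using B eq by auto
        then show ?case using step fg sV
          by (auto simp: hom_space_def linear_map_on_def S.subspace_add S.subspace_scale)
      qed
      then show ?thesis by simp
    qed
    then show "f = g" using fg B(4) by (auto simp: hom_space_def fun_eq_iff) metis
  qed
  have im: "?r ` ?H = prod_space B (\<lambda>_. W)"
  proof
    show "?r ` ?H \<subseteq> prod_space B (\<lambda>_. W)"
      using B(3) by (auto simp: prod_space_def hom_space_def linear_map_on_def)
    show "prod_space B (\<lambda>_. W) \<subseteq> ?r ` ?H"
    proof
      fix h assume h: "h \<in> prod_space B (\<lambda>_. W)"
      obtain g where g: "Vector_Spaces.linear s s g" "\<forall>x\<in>B. g x = h x" "range g = S.span (h ` B)"
        using SP.linear_independent_extend_subspace[OF B(2), of h] by blast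
      interpret g: Vector_Spaces.linear s s g by fact
      have "h ` B \<subseteq> W" using h by (auto simp: prod_space_def)
      then have ran: "range g \<subseteq> W" unfolding g(3) by (rule S.span_minimal[OF _ sW])
      let ?f = "\<lambda>x. if x \<in> V then g x else 0"
      have "?f \<in> ?H" using ran sV
        by (auto simp: hom_space_def linear_map_on_def g.add g.scale S.subspace_add S.subspace_scale)
      from imageI[OF this, of ?r] have "?r ?f \<in> ?r ` ?H" .
      moreover have "?r ?f = h" using g(2) h B(3) by (auto simp: prod_space_def fun_eq_iff)
      ultimately show "h \<in> ?r ` ?H" by argo
    qed
  qed
  have dp: "findim (fun_scale s) (?r ` ?H)" "F.dim (?r ` ?H) = S.dim V * S.dim W"
    unfolding im using dim_prod_space[OF assms(1) B(1), of "\<lambda>_. W"] W B(5) by auto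
  have sub: "F.subspace ?H" by (rule subspace_hom_space[OF assms(1) sV sW])
  have "findim (fun_scale s) ?H" using P.findim_inj[OF sub lin inj dp(1)] .
  then show ?thesis using P.dim_image_inj[OF _ lin inj] dp by simp
qed

lemma dim_direct_sum:
  assumes "vector_space s" and I: "finite I" and W: "\<And>i. i \<in> I \<Longrightarrow> findim s (W i)"
    and ind: "\<And>f. (\<And>i. i \<in> I \<Longrightarrow> f i \<in> W i) \<Longrightarrow> (\<Sum>i\<in>I. f i) = 0 \<Longrightarrow> \<forall>i\<in>I. f i = 0"
    and V: "V = {\<Sum>i\<in>I. f i | f. \<forall>i\<in>I. f i \<in> W i}"
  shows "findim s V" and "vector_space.dim s V = (\<Sum>i\<in>I. vector_space.dim s (W i))"
proof -
  interpret S: vector_space s by fact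
  interpret F: vector_space "fun_scale s :: 'a \<Rightarrow> ('c \<Rightarrow> 'b) \<Rightarrow> _" by (rule vector_space_fun_scale) fact
  interpret P: vector_space_pair "fun_scale s :: 'a \<Rightarrow> ('c \<Rightarrow> 'b) \<Rightarrow> _" s by unfold_locales
  let ?f = "\<lambda>f. \<Sum>i\<in>I. f i" and ?P = "prod_space I W"
  have lin: "linear_on (fun_scale s) s ?P ?f"
    by (auto simp: linear_on_def fun_scale_def sum.distrib S.scale_sum_right)
  have fin: "findim (fun_scale s) ?P" "F.dim ?P = (\<Sum>i\<in>I. S.dim (W i))"
    using dim_prod_space[OF assms(1) I W] by auto
  have im: "?f ` ?P = V"
  proof
    show "?f ` ?P \<subseteq> V" unfolding V by (auto simp: prod_space_def)
    show "V \<subseteq> ?f ` ?P"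
    proof
      fix x assume "x \<in> V"
      then obtain f where f: "x = (\<Sum>i\<in>I. f i)" "\<forall>i\<in>I. f i \<in> W i" unfolding V by blast
      have "(\<lambda>i. if i \<in> I then f i else 0) \<in> ?P" using f by (auto simp: prod_space_def)
      moreover have "x = ?f (\<lambda>i. if i \<in> I then f i else 0)" using f by simp
      ultimately show "x \<in> ?f ` ?P" by blast
    qed
  qed
  have inj: "inj_on ?f ?P"
    unfolding P.linear_on_inj_iff[OF F.findim_subspace[OF fin(1)] lin]
  proof (intro ballI impI)
    fix f assume f: "f \<in> ?P" "?f f = 0"
    then have "\<forall>i\<in>I. f i = 0" by (intro ind) (auto simp: prod_space_def)
    then show "f = 0" using f(1) by (auto simp: prod_space_def fun_eq_iff)
  qed
  show "findim s V" "S.dim V = (\<Sum>i\<in>I. S.dim (W i))"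
    using P.findim_image[OF fin(1) lin] P.dim_image_inj[OF fin(1) lin inj] fin(2) im by auto
qed


section \<open>Homomorphisms, extensions and the Euler form\<close>

text \<open>In contrast to \<open>rep_hom\<close>, values outside the spaces are unconstrained, which makes composites,
  restrictions and projections morphisms without any correction.\<close>

definition morphism ::
  "('k::field \<Rightarrow> 'b::ab_group_add \<Rightarrow> 'b) \<Rightarrow> ('v, 'a) pre_digraph \<Rightarrow>
   ('v, 'a, 'b) quiver_rep \<Rightarrow> ('v, 'a, 'b) quiver_rep \<Rightarrow> ('v \<Rightarrow> 'b \<Rightarrow> 'b) \<Rightarrow> bool"
  where
  "morphism s Q M N f \<longleftrightarrow>
     (\<forall>v\<in>verts Q. linear_map_on s (rep_space M v) (rep_space N v) (f v)) \<and>
     (\<forall>a\<in>arcs Q. \<forall>x\<in>rep_space M (tail Q a).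
        f (head Q a) (rep_map M a x) = rep_map N a (f (tail Q a) x))"

text \<open>The first extension group is the cokernel of the map that assigns to a family \<open>f\<close> the defects of
  commutation \<open>f\<^sub>w \<circ> M\<^sub>a - N\<^sub>a \<circ> f\<^sub>v\<close> along the arrows \<open>a : v \<rightarrow> w\<close>; it vanishes if this map is onto.\<close>

definition ext_vanishes ::
  "('k::field \<Rightarrow> 'b::ab_group_add \<Rightarrow> 'b) \<Rightarrow> ('v, 'a) pre_digraph \<Rightarrow>
   ('v, 'a, 'b) quiver_rep \<Rightarrow> ('v, 'a, 'b) quiver_rep \<Rightarrow> bool"
  where
  "ext_vanishes s Q M N \<longleftrightarrow>
     (\<forall>h. (\<forall>a\<in>arcs Q. linear_map_on s (rep_space M (tail Q a)) (rep_space N (head Q a)) (h a)) \<longrightarrow>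
       (\<exists>f. (\<forall>v\<in>verts Q. linear_map_on s (rep_space M v) (rep_space N v) (f v)) \<and>
          (\<forall>a\<in>arcs Q. \<forall>x\<in>rep_space M (tail Q a).
             f (head Q a) (rep_map M a x) - rep_map N a (f (tail Q a) x) = h a x)))"

text \<open>The homological bilinear form of the quiver; its diagonal is the Tits form.\<close>

definition euler_form :: "('v, 'a) pre_digraph \<Rightarrow> ('v \<Rightarrow> 'c::comm_ring_1) \<Rightarrow> ('v \<Rightarrow> 'c) \<Rightarrow> 'c" where
  "euler_form Q d e = (\<Sum>v\<in>verts Q. d v * e v) - (\<Sum>a\<in>arcs Q. d (tail Q a) * e (head Q a))"

lemma tits_form_eq_euler_form: "tits_form Q d = euler_form Q d d"
  by (simp add: tits_form_def euler_form_def power2_eq_square)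

context vector_space
begin

lemma linear_map_on_mem: "linear_map_on scale V W f \<Longrightarrow> x \<in> V \<Longrightarrow> f x \<in> W"
  by (auto simp: linear_map_on_def)

lemma linear_map_on_zero: "linear_map_on scale V W f \<Longrightarrow> subspace V \<Longrightarrow> f 0 = 0"
  using linear_on_0[of scale V f] by (simp add: linear_map_on_iff)

lemma linear_map_on_compose:
  "linear_map_on scale U V f \<Longrightarrow> linear_map_on scale V W g \<Longrightarrow> linear_map_on scale U W (\<lambda>x. g (f x))"
  by (auto simp: linear_map_on_def Pi_iff)

lemma linear_map_on_diff:
  "subspace W \<Longrightarrow> linear_map_on scale V W f \<Longrightarrow> linear_map_on scale V W g \<Longrightarrow>
    linear_map_on scale V W (\<lambda>x. f x - g x)"
  by (auto simp: linear_map_on_def Pi_iff scale_right_diff_distrib subspace_diff)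

lemma linear_map_on_restrict:
  assumes "linear_map_on scale V W f" "U \<subseteq> V" "\<And>x. x \<in> U \<Longrightarrow> f x \<in> X"
  shows "linear_map_on scale U X f"
proof -
  have "x \<in> V" if "x \<in> U" for x using assms(2) that by blast
  then show ?thesis using assms by (simp add: linear_map_on_def)
qed

lemma linear_map_on_cong:
  assumes "subspace V" "linear_map_on scale V W f" "\<And>x. x \<in> V \<Longrightarrow> f x = g x"
  shows "linear_map_on scale V W g"
  using assms(2) subspace_add[OF assms(1)] subspace_scale[OF assms(1)]
  by (simp add: linear_map_on_def Pi_iff flip: assms(3))

lemma linear_map_on_extend:
  assumes U: "subspace U" and f: "linear_map_on scale U W f" and W: "subspace W"
  obtains g where "linear_map_on scale UNIV W g" "\<And>x. x \<in> U \<Longrightarrow> g x = f x"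
proof -
  interpret P: vector_space_pair scale scale by unfold_locales
  obtain g where g: "Vector_Spaces.linear scale scale g" "\<And>x. x \<in> U \<Longrightarrow> g x = f x" "range g \<subseteq> W"
    using f by (elim P.linear_on_extend[OF U _ W, of f, rotated -1])
      (auto simp: linear_map_on_iff)
  interpret g: Vector_Spaces.linear scale scale g by fact
  show thesis using that[of g] g by (auto simp: linear_map_on_def g.add g.scale)
qed

end

locale finite_quiver = vector_space s + fin_digraph Q
  for s :: "'k::field \<Rightarrow> 'b::ab_group_add \<Rightarrow> 'b" and Q :: "('v, 'a) pre_digraph"
begin

lemma rep_findim: "is_rep s Q M \<Longrightarrow> v \<in> verts Q \<Longrightarrow> findim s (rep_space M v)"
  by (auto simp: is_rep_def findim_def)

lemma rep_subspace: "is_rep s Q M \<Longrightarrow> v \<in> verts Q \<Longrightarrow> subspace (rep_space M v)"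
  by (rule findim_subspace[OF rep_findim])

lemma rep_map_linear:
  "is_rep s Q M \<Longrightarrow> a \<in> arcs Q \<Longrightarrow>
    linear_map_on s (rep_space M (tail Q a)) (rep_space M (head Q a)) (rep_map M a)"
  by (auto simp: is_rep_def)

lemma rep_map_in:
  "is_rep s Q M \<Longrightarrow> a \<in> arcs Q \<Longrightarrow> x \<in> rep_space M (tail Q a) \<Longrightarrow> rep_map M a x \<in> rep_space M (head Q a)"
  using rep_map_linear[of M a] by (auto simp: linear_map_on_def)

text \<open>The commutation defect is a linear map from the product of the spaces \<open>Hom(M\<^sub>v, N\<^sub>v)\<close> to the
  product of the spaces of linear maps along the arrows. The difference of the two dimensions is the Euler form,
  the kernel is \<open>rep_hom\<close>, and surjectivity is \<open>ext_vanishes\<close>.\<close>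

lemma euler_form_le_hom_dim:
  assumes M: "is_rep s Q M" and N: "is_rep s Q N"
  shows "findim (fun_scale (fun_scale s)) (rep_hom s Q M N)"
    and "euler_form Q (dim_vector s Q M) (dim_vector s Q N) \<le> int (hom_dim s Q M N)"
    and "int (hom_dim s Q M N) = euler_form Q (dim_vector s Q M) (dim_vector s Q N) \<longleftrightarrow>
      ext_vanishes s Q M N"
proof -
  let ?s = "fun_scale s :: 'k \<Rightarrow> ('b \<Rightarrow> 'b) \<Rightarrow> _"
  interpret F: vector_space ?s by (rule vector_space_fun_scale) unfold_locales
  interpret F0: vector_space "fun_scale ?s :: 'k \<Rightarrow> ('v \<Rightarrow> 'b \<Rightarrow> 'b) \<Rightarrow> _"
    by (rule vector_space_fun_scale) unfold_locales
  interpret F1: vector_space "fun_scale ?s :: 'k \<Rightarrow> ('a \<Rightarrow> 'b \<Rightarrow> 'b) \<Rightarrow> _"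
    by (rule vector_space_fun_scale) unfold_locales
  interpret P: vector_space_pair "fun_scale ?s :: 'k \<Rightarrow> ('v \<Rightarrow> 'b \<Rightarrow> 'b) \<Rightarrow> _"
    "fun_scale ?s :: 'k \<Rightarrow> ('a \<Rightarrow> 'b \<Rightarrow> 'b) \<Rightarrow> _" by unfold_locales
  let ?m = "\<lambda>v. dim (rep_space M v)" and ?n = "\<lambda>v. dim (rep_space N v)"
  define C0 where "C0 = prod_space (verts Q) (\<lambda>v. hom_space s (rep_space M v) (rep_space N v))"
  define C1 where
    "C1 = prod_space (arcs Q) (\<lambda>a. hom_space s (rep_space M (tail Q a)) (rep_space N (head Q a)))"
  define \<Phi> where "\<Phi> = (\<lambda>(f :: 'v \<Rightarrow> 'b \<Rightarrow> 'b) a x.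
    if a \<in> arcs Q \<and> x \<in> rep_space M (tail Q a)
    then f (head Q a) (rep_map M a x) - rep_map N a (f (tail Q a) x) else 0)"
  have hs: "findim ?s (hom_space s (rep_space M v) (rep_space N w))"
      "F.dim (hom_space s (rep_space M v) (rep_space N w)) = ?m v * ?n w"
    if "v \<in> verts Q" "w \<in> verts Q" for v w
    using dim_hom_space[OF _ rep_findim[OF M that(1)] rep_findim[OF N that(2)]]
      vector_space_axioms by auto
  have C0: "findim (fun_scale ?s) C0" "F0.dim C0 = (\<Sum>v\<in>verts Q. ?m v * ?n v)"
    using dim_prod_space[OF F.vector_space_axioms finite_verts hs(1)] hs(2) by (auto simp: C0_def)
  have C1: "findim (fun_scale ?s) C1" "F1.dim C1 = (\<Sum>a\<in>arcs Q. ?m (tail Q a) * ?n (head Q a))"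
    using dim_prod_space[OF F.vector_space_axioms finite_arcs hs(1)[OF tail_in_verts head_in_verts]]
       hs(2)[OF tail_in_verts head_in_verts] by (auto simp: C1_def)
  have C0D: "linear_map_on s (rep_space M v) (rep_space N v) (f v)" if "f \<in> C0" "v \<in> verts Q" for f v
    using that by (auto simp: C0_def prod_space_def hom_space_def)
  have lin: "linear_on (fun_scale ?s) (fun_scale ?s) C0 \<Phi>"
    unfolding linear_on_def
  proof (intro conjI ballI allI)
    fix f g assume fg: "f \<in> C0" "g \<in> C0"
    show "\<Phi> (f + g) = \<Phi> f + \<Phi> g"
    proof (intro ext)
      fix a x
      show "\<Phi> (f + g) a x = (\<Phi> f + \<Phi> g) a x"
      proof (cases "a \<in> arcs Q \<and> x \<in> rep_space M (tail Q a)")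
        case True
        have "f (tail Q a) x \<in> rep_space N (tail Q a)" "g (tail Q a) x \<in> rep_space N (tail Q a)"
          using True linear_map_on_mem[OF C0D[OF fg(1) tail_in_verts]] linear_map_on_mem[OF C0D[OF fg(2) tail_in_verts]] by auto
        then show ?thesis using True rep_map_linear[OF N, of a]
          by (auto simp: \<Phi>_def linear_map_on_def)
      qed (auto simp: \<Phi>_def)
    qed
  next
    fix c f assume f: "f \<in> C0"
    show "\<Phi> (fun_scale ?s c f) = fun_scale ?s c (\<Phi> f)"
    proof (intro ext)
      fix a x
      show "\<Phi> (fun_scale ?s c f) a x = fun_scale ?s c (\<Phi> f) a x"
      proof (cases "a \<in> arcs Q \<and> x \<in> rep_space M (tail Q a)")
        case True
        have "f (tail Q a) x \<in> rep_space N (tail Q a)"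
          using True linear_map_on_mem[OF C0D[OF f tail_in_verts]] by auto
        then show ?thesis using True rep_map_linear[OF N, of a]
          by (auto simp: \<Phi>_def linear_map_on_def fun_scale_def scale_right_diff_distrib)
      qed (auto simp: \<Phi>_def fun_scale_def)
    qed
  qed
  have ker: "{f \<in> C0. \<Phi> f = 0} = rep_hom s Q M N"
    by (auto simp: C0_def \<Phi>_def rep_hom_def prod_space_def hom_space_def fun_eq_iff)
  have \<Phi>_lin: "linear_map_on s (rep_space M (tail Q a)) (rep_space N (head Q a))
      (\<lambda>x. f (head Q a) (rep_map M a x) - rep_map N a (f (tail Q a) x))"
    if "\<forall>v\<in>verts Q. linear_map_on s (rep_space M v) (rep_space N v) (f v)" "a \<in> arcs Q" for f a
    by (rule linear_map_on_diff[OF rep_subspace[OF N head_in_verts[OF that(2)]]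
          linear_map_on_compose[OF rep_map_linear[OF M that(2)] bspec[OF that(1) head_in_verts[OF that(2)]]]
          linear_map_on_compose[OF bspec[OF that(1) tail_in_verts[OF that(2)]] rep_map_linear[OF N that(2)]]])
  have im: "\<Phi> ` C0 \<subseteq> C1"
  proof
    fix h assume "h \<in> \<Phi> ` C0"
    then obtain f where f: "f \<in> C0" "h = \<Phi> f" by blast
    have "linear_map_on s (rep_space M (tail Q a)) (rep_space N (head Q a)) (h a)"
      if "a \<in> arcs Q" for a
      by (rule linear_map_on_cong[OF _ \<Phi>_lin[OF _ that]])
        (use that f C0D rep_subspace[OF M] in \<open>auto simp: \<Phi>_def\<close>)
    moreover have "h a x = 0" if "a \<notin> arcs Q \<or> x \<notin> rep_space M (tail Q a)" for a x
      using that by (auto simp: f(2) \<Phi>_def)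
    ultimately show "h \<in> C1" by (simp add: C1_def prod_space_def hom_space_def fun_eq_iff)
  qed
  have hd: "hom_dim s Q M N = F0.dim (rep_hom s Q M N)"
    by (simp add: hom_dim_def fun_scale_def[abs_def])
  have eul: "euler_form Q (dim_vector s Q M) (dim_vector s Q N) = int (F0.dim C0) - int (F1.dim C1)"
    unfolding C0(2) C1(2) by (simp add: euler_form_def dim_vector_def)
  note sub = F0.findim_subspace[OF C0(1)]
  have sim: "F1.subspace (\<Phi> ` C0)" by (rule P.subspace_image_on[OF sub lin])
  have rn: "F0.dim C0 = hom_dim s Q M N + F1.dim (\<Phi> ` C0)"
    using P.rank_nullity_findim[OF C0(1) lin] unfolding ker hd .
  show "findim (fun_scale (fun_scale s)) (rep_hom s Q M N)"
    using F0.findim_subset(1)[OF C0(1) P.subspace_kernel_on[OF sub lin]] by (auto simp: ker[symmetric])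
  show "euler_form Q (dim_vector s Q M) (dim_vector s Q N) \<le> int (hom_dim s Q M N)"
    using eul rn F1.findim_subset(2)[OF C1(1) sim im] by linarith
  have "int (hom_dim s Q M N) = euler_form Q (dim_vector s Q M) (dim_vector s Q N) \<longleftrightarrow>
    F1.dim (\<Phi> ` C0) = F1.dim C1" using eul rn by linarith
  also have "\<dots> \<longleftrightarrow> \<Phi> ` C0 = C1" using F1.findim_subset(3)[OF C1(1) sim im] by auto
  also have "\<dots> \<longleftrightarrow> ext_vanishes s Q M N"
  proof
    assume onto: "\<Phi> ` C0 = C1"
    show "ext_vanishes s Q M N"
      unfolding ext_vanishes_def
    proof (intro allI impI)
      fix h assume h: "\<forall>a\<in>arcs Q. linear_map_on s (rep_space M (tail Q a)) (rep_space N (head Q a)) (h a)"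
      let ?h = "\<lambda>a x. if a \<in> arcs Q \<and> x \<in> rep_space M (tail Q a) then h a x else 0"
      have "linear_map_on s (rep_space M (tail Q a)) (rep_space N (head Q a)) (?h a)"
        if "a \<in> arcs Q" for a
        by (rule linear_map_on_cong[OF _ h[rule_format, OF that]]) (use that rep_subspace[OF M] in auto)
      then have "?h \<in> C1" by (auto simp: C1_def prod_space_def hom_space_def fun_eq_iff)
      then have "?h \<in> \<Phi> ` C0" by (simp only: onto)
      then obtain f where f: "f \<in> C0" "\<Phi> f = ?h" by (elim imageE) simp
      have "f (head Q a) (rep_map M a x) - rep_map N a (f (tail Q a) x) = h a x"
        if "a \<in> arcs Q" "x \<in> rep_space M (tail Q a)" for a x
        using fun_cong[OF fun_cong[OF f(2), of a], of x] that by (simp add: \<Phi>_def)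
      then show "\<exists>f. (\<forall>v\<in>verts Q. linear_map_on s (rep_space M v) (rep_space N v) (f v)) \<and>
          (\<forall>a\<in>arcs Q. \<forall>x\<in>rep_space M (tail Q a).
             f (head Q a) (rep_map M a x) - rep_map N a (f (tail Q a) x) = h a x)"
        using C0D[OF f(1)] by blast
    qed
  next
    assume van: "ext_vanishes s Q M N"
    show "\<Phi> ` C0 = C1"
    proof (rule antisym[OF im], rule subsetI)
      fix h assume h: "h \<in> C1"
      then have "\<forall>a\<in>arcs Q. linear_map_on s (rep_space M (tail Q a)) (rep_space N (head Q a)) (h a)"
        by (auto simp: C1_def prod_space_def hom_space_def)
      then obtain f where f: "\<And>v. v \<in> verts Q \<Longrightarrow> linear_map_on s (rep_space M v) (rep_space N v) (f v)"
          "\<And>a x. a \<in> arcs Q \<Longrightarrow> x \<in> rep_space M (tail Q a) \<Longrightarrow>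
             f (head Q a) (rep_map M a x) - rep_map N a (f (tail Q a) x) = h a x"
        using van unfolding ext_vanishes_def by blast
      let ?f = "\<lambda>v x. if v \<in> verts Q \<and> x \<in> rep_space M v then f v x else 0"
      have "linear_map_on s (rep_space M v) (rep_space N v) (?f v)" if "v \<in> verts Q" for v
        by (rule linear_map_on_cong[OF _ f(1)[OF that]]) (use that rep_subspace[OF M] in auto)
      then have "?f \<in> C0" by (auto simp: C0_def prod_space_def hom_space_def fun_eq_iff)
      moreover have "\<Phi> ?f = h"
      proof (rule ext, rule ext)
        fix a x
        show "\<Phi> ?f a x = h a x"
          using f(2)[of a x] h rep_map_in[OF M, of a x]
          by (auto simp: \<Phi>_def C1_def prod_space_def hom_space_def)
      qed
      ultimately show "h \<in> \<Phi> ` C0" by blast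
    qed
  qed
  finally show "int (hom_dim s Q M N) = euler_form Q (dim_vector s Q M) (dim_vector s Q N) \<longleftrightarrow>
      ext_vanishes s Q M N" .
qed

lemma rep_hom_zero_iff:
  assumes "is_rep s Q M" "is_rep s Q N" shows "rep_hom s Q M N = {0} \<longleftrightarrow> hom_dim s Q M N = 0"
proof -
  interpret F: vector_space "fun_scale (fun_scale s) :: 'k \<Rightarrow> ('v \<Rightarrow> 'b \<Rightarrow> 'b) \<Rightarrow> _"
    by (intro vector_space_fun_scale) unfold_locales
  have "hom_dim s Q M N = F.dim (rep_hom s Q M N)" by (simp add: hom_dim_def fun_scale_def[abs_def])
  then show ?thesis using F.findim_dim_0[OF euler_form_le_hom_dim(1)[OF assms]] F.dim_0 by metis
qed

end


section \<open>Internal direct sums\<close>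

text \<open>The linear form of an internal direct sum: the summands span, and zero has only the trivial representation.
  It is easier to manipulate than the bijectivity required by \<open>is_direct_sum\<close>.\<close>

definition direct_sum_on :: "nat \<Rightarrow> (nat \<Rightarrow> 'b::ab_group_add set) \<Rightarrow> 'b set \<Rightarrow> bool" where
  "direct_sum_on n W V \<longleftrightarrow> V = {\<Sum>i<n. f i | f. \<forall>i<n. f i \<in> W i} \<and>
     (\<forall>f. (\<forall>i<n. f i \<in> W i) \<longrightarrow> (\<Sum>i<n. f i) = 0 \<longrightarrow> (\<forall>i<n. f i = 0))"

lemma direct_sum_on_unique:
  assumes d: "direct_sum_on n W V" and W: "\<And>i x y. i < n \<Longrightarrow> x \<in> W i \<Longrightarrow> y \<in> W i \<Longrightarrow> x - y \<in> W i"
    and f: "\<And>i. i < n \<Longrightarrow> f i \<in> W i" and g: "\<And>i. i < n \<Longrightarrow> g i \<in> W i"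
    and eq: "(\<Sum>i<n. f i) = (\<Sum>i<n. g i)" and i: "i < n"
  shows "f i = g i"
proof -
  have "(\<Sum>i<n. f i - g i) = 0" using eq by (simp add: sum_subtractf)
  moreover have "\<forall>i<n. f i - g i \<in> W i" using W f g by blast
  ultimately have "\<forall>i<n. f i - g i = 0" using d[unfolded direct_sum_on_def]
    by (elim conjE allE[where x = "\<lambda>i. f i - g i"]) blast
  then show ?thesis using i by simp
qed

lemma direct_sum_on_iff_bij_betw:
  assumes W: "\<And>i x y. i < n \<Longrightarrow> x \<in> W i \<Longrightarrow> y \<in> W i \<Longrightarrow> x - y \<in> W i"
    and W0: "\<And>i. i < n \<Longrightarrow> 0 \<in> W i"
  shows "bij_betw (\<lambda>x. \<Sum>i<n. x i) (\<Pi>\<^sub>E i\<in>{..<n}. W i) V \<longleftrightarrow> direct_sum_on n W V"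
proof -
  let ?S = "\<lambda>x. \<Sum>i<n. x i" and ?P = "\<Pi>\<^sub>E i\<in>{..<n}. W i"
  have rs: "restrict f {..<n} \<in> ?P" "?S (restrict f {..<n}) = ?S f" if "\<forall>i<n. f i \<in> W i" for f
    using that by auto
  have im: "?S ` ?P = {\<Sum>i<n. f i | f. \<forall>i<n. f i \<in> W i}"
  proof
    show "{\<Sum>i<n. f i | f. \<forall>i<n. f i \<in> W i} \<subseteq> ?S ` ?P"
    proof
      fix x assume "x \<in> {\<Sum>i<n. f i | f. \<forall>i<n. f i \<in> W i}"
      then obtain f where "x = ?S f" "\<forall>i<n. f i \<in> W i" by blast
      then show "x \<in> ?S ` ?P" using imageI[OF rs(1), of f ?S] rs(2)[of f] by simp
    qed
  qed (auto simp: PiE_iff)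
  show ?thesis
  proof
    assume b: "bij_betw ?S ?P V"
    then have V: "V = {\<Sum>i<n. f i | f. \<forall>i<n. f i \<in> W i}" and inj: "inj_on ?S ?P"
      unfolding bij_betw_def im by auto
    have "\<forall>i<n. f i = 0" if f: "\<forall>i<n. f i \<in> W i" "?S f = 0" for f
    proof -
      have "restrict f {..<n} = restrict (\<lambda>_. 0) {..<n}"
        by (rule inj_onD[OF inj _ rs(1)[OF f(1)] rs(1)]) (use f W0 rs(2)[OF f(1)] in auto)
      then show ?thesis by (metis lessThan_iff restrict_apply')
    qed
    then show "direct_sum_on n W V" unfolding direct_sum_on_def V by blast
  next
    assume d: "direct_sum_on n W V"
    have "inj_on ?S ?P"
    proof (rule inj_onI)
      fix f g assume fg: "f \<in> ?P" "g \<in> ?P" "?S f = ?S g"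
      have "f i = g i" if "i < n" for i
        by (rule direct_sum_on_unique[OF d W _ _ fg(3) that]) (use fg in auto)
      then show "f = g" using fg by (intro PiE_ext) auto
    qed
    moreover have "?S ` ?P = V" using d unfolding im direct_sum_on_def by blast
    ultimately show "bij_betw ?S ?P V" unfolding bij_betw_def by blast
  qed
qed

lemma direct_sum_on_cong:
  assumes "\<And>i. i < n \<Longrightarrow> W i = W' i"
  shows "direct_sum_on n W V = direct_sum_on n W' V"
proof -
  have "(\<forall>i<n. f i \<in> W i) \<longleftrightarrow> (\<forall>i<n. f i \<in> W' i)" for f using assms by auto
  then show ?thesis unfolding direct_sum_on_def by simp
qed

lemma direct_sum_on_append:
  assumes V: "V = {x + y | x y. x \<in> A \<and> y \<in> B}" "\<And>x y. x \<in> A \<Longrightarrow> y \<in> B \<Longrightarrow> x + y = 0 \<Longrightarrow> x = 0 \<and> y = 0"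
    and A: "direct_sum_on n W A" and B: "direct_sum_on m W' B"
  shows "direct_sum_on (n + m) (\<lambda>i. if i < n then W i else W' (i - n)) V"
proof -
  have sp: "(\<Sum>i<n+m. f i) = (\<Sum>i<n. f i) + (\<Sum>i<m. f (n + i))" for f :: "nat \<Rightarrow> 'a"
    by (induction m) (auto simp: add.assoc)
  let ?W = "\<lambda>i. if i < n then W i else W' (i - n)"
  have mem: "(\<Sum>i<n. f i) \<in> A" "(\<Sum>i<m. f (n + i)) \<in> B" if "\<forall>i<n+m. f i \<in> ?W i" for f
  proof -
    have "\<forall>i<n. f i \<in> W i" using that by (metis add.commute trans_less_add2)
    then show "(\<Sum>i<n. f i) \<in> A" using A unfolding direct_sum_on_def by blast
    have "\<forall>i<m. f (n + i) \<in> W' i"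
      using that by (metis add_diff_cancel_left' add_less_cancel_left not_add_less1)
    then show "(\<Sum>i<m. f (n + i)) \<in> B" using B unfolding direct_sum_on_def by blast
  qed
  show ?thesis
    unfolding direct_sum_on_def
  proof (intro conjI allI impI)
    show "V = {\<Sum>i<n+m. f i | f. \<forall>i<n+m. f i \<in> ?W i}"
    proof (intro equalityI subsetI)
      fix x assume "x \<in> V"
      then obtain a b where ab: "x = a + b" "a \<in> A" "b \<in> B" using V(1) by blast
      obtain f g where fg: "a = (\<Sum>i<n. f i)" "\<forall>i<n. f i \<in> W i" "b = (\<Sum>i<m. g i)" "\<forall>i<m. g i \<in> W' i"
        using ab(2,3) A B unfolding direct_sum_on_def by blast
      let ?h = "\<lambda>i. if i < n then f i else g (i - n)"
      have "x = (\<Sum>i<n+m. ?h i)" unfolding sp using ab fg by simp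
      moreover have "\<forall>i<n+m. ?h i \<in> ?W i" using fg by auto
      ultimately show "x \<in> {\<Sum>i<n+m. f i | f. \<forall>i<n+m. f i \<in> ?W i}" by blast
    next
      fix x assume "x \<in> {\<Sum>i<n+m. f i | f. \<forall>i<n+m. f i \<in> ?W i}"
      then obtain f where f: "x = (\<Sum>i<n+m. f i)" "\<forall>i<n+m. f i \<in> ?W i" by blast
      show "x \<in> V" unfolding V f(1) sp using mem[OF f(2)] by blast
    qed
  next
    fix f i assume f: "\<forall>i<n+m. f i \<in> ?W i" "(\<Sum>i<n+m. f i) = 0" and i: "i < n + m"
    have z: "(\<Sum>i<n. f i) = 0" "(\<Sum>i<m. f (n + i)) = 0"
      using V(2)[OF mem[OF f(1)]] f(2) unfolding sp by auto
    have "\<forall>i<n. f i \<in> W i" using f(1) by (metis add.commute trans_less_add2)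
    then have 1: "\<forall>i<n. f i = 0" using A z(1) unfolding direct_sum_on_def by blast
    have "\<forall>i<m. f (n + i) \<in> W' i"
      using f(1) by (metis add_diff_cancel_left' add_less_cancel_left not_add_less1)
    then have 2: "\<forall>i<m. f (n + i) = 0" using B z(2) unfolding direct_sum_on_def
      by (elim conjE allE[where x = "\<lambda>i. f (n + i)"]) blast
    show "f i = 0"
    proof (cases "i < n")
      case False
      then have "f (n + (i - n)) = 0" using 2 i by (metis less_diff_conv2 add.commute not_less)
      then show ?thesis using False by simp
    qed (use 1 in blast)
  qed
qed

lemma direct_sum_on_permute:
  assumes \<pi>: "bij_betw \<pi> {..<n} {..<n}" and d: "direct_sum_on n W V"
  shows "direct_sum_on n (\<lambda>i. W (\<pi> i)) V"
proof -
  let ?\<sigma> = "inv_into {..<n} \<pi>"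
  have \<sigma>: "bij_betw ?\<sigma> {..<n} {..<n}" by (rule bij_betw_inv_into[OF \<pi>])
  have inv: "\<pi> (?\<sigma> i) = i" "?\<sigma> (\<pi> i) = i" if "i < n" for i
    using that \<pi> by (auto simp: bij_betw_inv_into_right bij_betw_inv_into_left)
  have lt: "\<pi> i < n" "?\<sigma> i < n" if "i < n" for i
    using that bij_betwE[OF \<pi>] bij_betwE[OF \<sigma>] by auto
  have s: "(\<Sum>i<n. f (?\<sigma> i)) = (\<Sum>i<n. f i)" "(\<Sum>i<n. f (\<pi> i)) = (\<Sum>i<n. f i)" for f :: "nat \<Rightarrow> 'a"
    by (rule sum.reindex_bij_betw[OF \<sigma>], rule sum.reindex_bij_betw[OF \<pi>])
  show ?thesis
    unfolding direct_sum_on_def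
  proof (intro conjI allI impI)
    show "V = {\<Sum>i<n. f i | f. \<forall>i<n. f i \<in> W (\<pi> i)}"
    proof (intro equalityI subsetI)
      fix x assume "x \<in> V"
      then obtain f where f: "x = (\<Sum>i<n. f i)" "\<forall>i<n. f i \<in> W i"
        using d unfolding direct_sum_on_def by blast
      have "x = (\<Sum>i<n. f (\<pi> i))" "\<forall>i<n. f (\<pi> i) \<in> W (\<pi> i)" using f s(2) lt by auto
      then show "x \<in> {\<Sum>i<n. f i | f. \<forall>i<n. f i \<in> W (\<pi> i)}" by blast
    next
      fix x assume "x \<in> {\<Sum>i<n. f i | f. \<forall>i<n. f i \<in> W (\<pi> i)}"
      then obtain f where f: "x = (\<Sum>i<n. f i)" "\<forall>i<n. f i \<in> W (\<pi> i)" by blast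
      have "x = (\<Sum>i<n. f (?\<sigma> i))" "\<forall>i<n. f (?\<sigma> i) \<in> W i" using f s(1) lt inv by (metis)+
      then show "x \<in> V" using d unfolding direct_sum_on_def by blast
    qed
  next
    fix f i assume f: "\<forall>i<n. f i \<in> W (\<pi> i)" "(\<Sum>i<n. f i) = 0" and i: "i < n"
    have "\<forall>i<n. f (?\<sigma> i) \<in> W i" using f lt inv by metis
    moreover have "(\<Sum>i<n. f (?\<sigma> i)) = 0" using f s(1) by simp
    ultimately have "\<forall>i<n. f (?\<sigma> i) = 0" using d unfolding direct_sum_on_def
      by (elim conjE allE[where x = "\<lambda>i. f (?\<sigma> i)"]) blast
    then show "f i = 0" using inv lt i by metis
  qed
qed

lemma direct_sum_on_singleton: "direct_sum_on (Suc 0) (\<lambda>i. [A] ! i) A"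
proof -
  have "\<exists>f. x = f 0 \<and> f 0 \<in> A" if "x \<in> A" for x
    using that by (intro exI[of _ "\<lambda>_. x"]) simp
  then show ?thesis unfolding direct_sum_on_def by auto
qed

lemma direct_sum_on_pair:
  "direct_sum_on 2 (\<lambda>i. [A, B] ! i) V \<longleftrightarrow> V = {x + y | x y. x \<in> A \<and> y \<in> B} \<and>
    (\<forall>x\<in>A. \<forall>y\<in>B. x + y = 0 \<longrightarrow> x = 0 \<and> y = 0)"
proof -
  have all2: "(\<forall>i<2. P i) \<longleftrightarrow> P 0 \<and> P (Suc 0)" for P :: "nat \<Rightarrow> bool"
    by (auto simp: numeral_2_eq_2 less_Suc_eq)
  have s2: "(\<Sum>i<2. f i) = f 0 + f (Suc 0)" for f :: "nat \<Rightarrow> 'a" by (simp add: numeral_2_eq_2)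
  have fn: "\<exists>f. f 0 = x \<and> f (Suc 0) = y" for x y :: 'a
    by (rule exI[of _ "\<lambda>i. if i = 0 then x else y"]) simp
  have im: "{f 0 + f (Suc 0) | f. f 0 \<in> A \<and> f (Suc 0) \<in> B} = {x + y | x y. x \<in> A \<and> y \<in> B}"
    (is "?L = ?R")
  proof
    show "?R \<subseteq> ?L"
    proof
      fix z assume "z \<in> ?R"
      then obtain x y where "z = x + y" "x \<in> A" "y \<in> B" by blast
      moreover obtain f where "f 0 = x" "f (Suc 0) = y" using fn by blast
      ultimately show "z \<in> ?L" by blast
    qed
  qed blast
  have "(\<forall>f. f 0 \<in> A \<and> f (Suc 0) \<in> B \<longrightarrow> f 0 + f (Suc 0) = 0 \<longrightarrow> f 0 = 0 \<and> f (Suc 0) = 0) \<longleftrightarrow>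
    (\<forall>x\<in>A. \<forall>y\<in>B. x + y = 0 \<longrightarrow> x = 0 \<and> y = 0)" (is "?L \<longleftrightarrow> ?R")
  proof
    assume l: ?L
    show ?R
    proof (intro ballI impI)
      fix x y assume "x \<in> A" "y \<in> B" "x + y = 0"
      then show "x = 0 \<and> y = 0" using spec[OF l, of "\<lambda>i. if i = 0 then x else y"] by simp
    qed
  qed blast
  then show ?thesis unfolding direct_sum_on_def all2 s2 by (simp add: im)
qed

text \<open>Subrepresentations such as kernels and images keep the maps and change only the spaces.\<close>

definition with_spaces :: "('v, 'a, 'b) quiver_rep \<Rightarrow> ('v \<Rightarrow> 'b set) \<Rightarrow> ('v, 'a, 'b) quiver_rep" where
  "with_spaces M W = \<lparr>rep_space = W, rep_map = rep_map M\<rparr>"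

lemma with_spaces_simps [simp]:
  "rep_space (with_spaces M W) = W" "rep_map (with_spaces M W) = rep_map M"
  by (simp_all add: with_spaces_def)

definition total_dim ::
  "('k::field \<Rightarrow> 'b::ab_group_add \<Rightarrow> 'b) \<Rightarrow> ('v, 'a) pre_digraph \<Rightarrow> ('v, 'a, 'b) quiver_rep \<Rightarrow> nat" where
  "total_dim s Q M = (\<Sum>v\<in>verts Q. vector_space.dim s (rep_space M v))"

context finite_quiver
begin

lemma subrep_with_spaces:
  assumes M: "is_rep s Q M" and W: "\<And>v. v \<in> verts Q \<Longrightarrow> subspace (W v)"
    "\<And>v. v \<in> verts Q \<Longrightarrow> W v \<subseteq> rep_space M v"
    and map: "\<And>a x. a \<in> arcs Q \<Longrightarrow> x \<in> W (tail Q a) \<Longrightarrow> rep_map M a x \<in> W (head Q a)"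
  shows "subrep s Q (with_spaces M W) M"
proof -
  have "\<exists>B. finite B \<and> W v = span B" if "v \<in> verts Q" for v
    using findim_subset(1)[OF rep_findim[OF M that] W(1)[OF that] W(2)[OF that]] by (simp add: findim_def)
  moreover have "linear_map_on s (W (tail Q a)) (W (head Q a)) (rep_map M a)" if "a \<in> arcs Q" for a
    by (rule linear_map_on_restrict[OF rep_map_linear[OF M that] W(2)])
      (use that map tail_in_verts in auto)
  ultimately show ?thesis using M W(2) unfolding subrep_def is_rep_def by auto
qed

lemma subrepD:
  assumes "subrep s Q N M"
  shows "is_rep s Q N" "v \<in> verts Q \<Longrightarrow> x \<in> rep_space N v \<Longrightarrow> x \<in> rep_space M v"
    "a \<in> arcs Q \<Longrightarrow> x \<in> rep_space N (tail Q a) \<Longrightarrow> rep_map N a x = rep_map M a x"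
    "a \<in> arcs Q \<Longrightarrow> x \<in> rep_space N (tail Q a) \<Longrightarrow> rep_map M a x \<in> rep_space N (head Q a)"
proof -
  show N: "is_rep s Q N" using assms by (simp add: subrep_def)
  show "v \<in> verts Q \<Longrightarrow> x \<in> rep_space N v \<Longrightarrow> x \<in> rep_space M v"
    "a \<in> arcs Q \<Longrightarrow> x \<in> rep_space N (tail Q a) \<Longrightarrow> rep_map N a x = rep_map M a x"
    using assms by (auto simp: subrep_def)
  then show "a \<in> arcs Q \<Longrightarrow> x \<in> rep_space N (tail Q a) \<Longrightarrow> rep_map M a x \<in> rep_space N (head Q a)"
    using rep_map_in[OF N] by metis
qed

lemma subrep_trans:
  assumes NL: "subrep s Q N L" and LM: "subrep s Q L M"
  shows "subrep s Q N M"
  unfolding subrep_def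
proof (intro conjI ballI)
  show "is_rep s Q N" by (rule subrepD(1)[OF NL])
  show "rep_space N v \<subseteq> rep_space M v" if "v \<in> verts Q" for v
    using NL LM that unfolding subrep_def by blast
  show "rep_map N a x = rep_map M a x" if "a \<in> arcs Q" "x \<in> rep_space N (tail Q a)" for a x
    using subrepD(3)[OF NL that] subrepD(3)[OF LM that(1) subrepD(2)[OF NL tail_in_verts[OF that(1)] that(2)]]
    by simp
qed

lemma subrep_refl: "is_rep s Q M \<Longrightarrow> subrep s Q M M"
  by (simp add: subrep_def)

lemma morphismD:
  assumes "morphism s Q M N f"
  shows "v \<in> verts Q \<Longrightarrow> linear_map_on s (rep_space M v) (rep_space N v) (f v)"
    "v \<in> verts Q \<Longrightarrow> x \<in> rep_space M v \<Longrightarrow> f v x \<in> rep_space N v"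
    "a \<in> arcs Q \<Longrightarrow> x \<in> rep_space M (tail Q a) \<Longrightarrow>
      f (head Q a) (rep_map M a x) = rep_map N a (f (tail Q a) x)"
  using assms linear_map_on_mem by (auto simp: morphism_def)

lemma morphism_compose:
  assumes f: "morphism s Q L M f" and g: "morphism s Q M N g"
  shows "morphism s Q L N (\<lambda>v x. g v (f v x))"
  unfolding morphism_def
  using linear_map_on_compose[OF morphismD(1)[OF f] morphismD(1)[OF g]]
    morphismD(2)[OF f tail_in_verts] morphismD(3)[OF f] morphismD(3)[OF g] by auto

lemma subrep_inclusion: "subrep s Q N M \<Longrightarrow> morphism s Q N M (\<lambda>v x. x)"
  by (auto simp: morphism_def linear_map_on_def subrep_def)

lemma morphism_0:
  "is_rep s Q M \<Longrightarrow> morphism s Q M N f \<Longrightarrow> v \<in> verts Q \<Longrightarrow> f v 0 = 0"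
  using linear_map_on_zero[OF morphismD(1) rep_subspace] by blast

lemma kernel_subrep:
  assumes M: "is_rep s Q M" and N: "is_rep s Q N" and f: "morphism s Q M N f"
  shows "subrep s Q (with_spaces M (\<lambda>v. {x \<in> rep_space M v. f v x = 0})) M"
proof -
  interpret P: vector_space_pair s s by unfold_locales
  show ?thesis
  proof (rule subrep_with_spaces[OF M])
    fix v assume v: "v \<in> verts Q"
    show "subspace {x \<in> rep_space M v. f v x = 0}"
      using P.subspace_kernel_on[OF rep_subspace[OF M v]] morphismD(1)[OF f v] by (simp add: linear_map_on_iff)
  next
    fix a x assume a: "a \<in> arcs Q" "x \<in> {x \<in> rep_space M (tail Q a). f (tail Q a) x = 0}"
    then have "f (head Q a) (rep_map M a x) = rep_map N a 0" using morphismD(3)[OF f] by simp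
    also have "\<dots> = 0"
      using linear_map_on_zero[OF rep_map_linear[OF N a(1)] rep_subspace[OF N tail_in_verts[OF a(1)]]] .
    finally show "rep_map M a x \<in> {x \<in> rep_space M (head Q a). f (head Q a) x = 0}"
      using rep_map_in[OF M] a by simp
  qed auto
qed

lemma image_subrep:
  assumes M: "is_rep s Q M" and N: "is_rep s Q N" and f: "morphism s Q M N f"
  shows "subrep s Q (with_spaces N (\<lambda>v. f v ` rep_space M v)) N"
proof -
  interpret P: vector_space_pair s s by unfold_locales
  show ?thesis
  proof (rule subrep_with_spaces[OF N])
    fix v assume v: "v \<in> verts Q"
    show "subspace (f v ` rep_space M v)"
      using P.subspace_image_on[OF rep_subspace[OF M v]] morphismD(1)[OF f v] by (simp add: linear_map_on_iff)
    show "f v ` rep_space M v \<subseteq> rep_space N v" using morphismD(2)[OF f v] by auto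
  next
    fix a y assume a: "a \<in> arcs Q" "y \<in> f (tail Q a) ` rep_space M (tail Q a)"
    then obtain x where "x \<in> rep_space M (tail Q a)" "y = f (tail Q a) x" by blast
    then show "rep_map N a y \<in> f (head Q a) ` rep_space M (head Q a)"
      using morphismD(3)[OF f a(1)] rep_map_in[OF M a(1)] by (metis imageI)
  qed
qed

lemma total_dim_mono:
  assumes M: "is_rep s Q M" and N: "subrep s Q N M"
  shows "total_dim s Q N \<le> total_dim s Q M"
    and "total_dim s Q N = total_dim s Q M \<Longrightarrow> \<forall>v\<in>verts Q. rep_space N v = rep_space M v"
proof -
  have sub: "rep_space N v \<subseteq> rep_space M v" "subspace (rep_space N v)" if "v \<in> verts Q" for v
    using N that rep_subspace[OF subrepD(1)[OF N]] by (auto simp: subrep_def)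
  have le: "dim (rep_space N v) \<le> dim (rep_space M v)" if "v \<in> verts Q" for v
    using findim_subset(2)[OF rep_findim[OF M that] sub(2)[OF that] sub(1)[OF that]] .
  show "total_dim s Q N \<le> total_dim s Q M" unfolding total_dim_def by (rule sum_mono[OF le])
  assume eq: "total_dim s Q N = total_dim s Q M"
  have "dim (rep_space N v) = dim (rep_space M v)" if "v \<in> verts Q" for v
    by (rule sum_mono_inv[OF eq[unfolded total_dim_def]]) (use that le finite_verts in auto)
  then show "\<forall>v\<in>verts Q. rep_space N v = rep_space M v"
    using findim_subset(3)[OF rep_findim[OF M] sub(2) sub(1)] by blast
qed

lemma zero_rep_iff_total_dim: "is_rep s Q M \<Longrightarrow> zero_rep Q M \<longleftrightarrow> total_dim s Q M = 0"
proof -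
  assume M: "is_rep s Q M"
  have "rep_space M v = {0} \<longleftrightarrow> dim (rep_space M v) = 0" if "v \<in> verts Q" for v
    using findim_dim_0[OF rep_findim[OF M that]] dim_0 by metis
  then show ?thesis unfolding zero_rep_def total_dim_def using sum_eq_0_iff[OF finite_verts] by simp
qed

lemma is_direct_sum_iff:
  "is_direct_sum s Q M Ns \<longleftrightarrow> (\<forall>N\<in>set Ns. subrep s Q N M) \<and>
     (\<forall>v\<in>verts Q. direct_sum_on (length Ns) (\<lambda>i. rep_space (Ns ! i) v) (rep_space M v))"
proof -
  have "bij_betw (\<lambda>x. \<Sum>i<length Ns. x i)
        (\<Pi>\<^sub>E i\<in>{..<length Ns}. rep_space (Ns ! i) v) (rep_space M v) \<longleftrightarrow>
      direct_sum_on (length Ns) (\<lambda>i. rep_space (Ns ! i) v) (rep_space M v)"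
    if sub: "\<forall>N\<in>set Ns. subrep s Q N M" and v: "v \<in> verts Q" for v
  proof -
    have "subspace (rep_space (Ns ! i) v)" if i: "i < length Ns" for i
      by (rule rep_subspace[OF subrepD(1)[of _ M]]) (use i sub v in auto)
    then show ?thesis using subspace_diff subspace_0 by (intro direct_sum_on_iff_bij_betw) blast+
  qed
  then show ?thesis unfolding is_direct_sum_def by auto
qed

lemma is_direct_sum_pair_iff:
  "is_direct_sum s Q M [A, B] \<longleftrightarrow> subrep s Q A M \<and> subrep s Q B M \<and>
     (\<forall>v\<in>verts Q. rep_space M v = {x + y | x y. x \<in> rep_space A v \<and> y \<in> rep_space B v} \<and>
       (\<forall>x\<in>rep_space A v. \<forall>y\<in>rep_space B v. x + y = 0 \<longrightarrow> x = 0 \<and> y = 0))"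
proof -
  have "direct_sum_on (length [A, B]) (\<lambda>i. rep_space ([A, B] ! i) v) V \<longleftrightarrow>
    direct_sum_on 2 (\<lambda>i. [rep_space A v, rep_space B v] ! i) V" for v V
    unfolding length_Cons list.size numeral_2_eq_2
    by (intro direct_sum_on_cong) (auto simp: less_Suc_eq)
  then show ?thesis unfolding is_direct_sum_iff direct_sum_on_pair by auto
qed

lemma is_direct_sum_append:
  assumes M: "is_direct_sum s Q M [A, B]" and As: "is_direct_sum s Q A As" and Bs: "is_direct_sum s Q B Bs"
  shows "is_direct_sum s Q M (As @ Bs)"
  unfolding is_direct_sum_iff
proof (intro conjI ballI)
  fix N assume "N \<in> set (As @ Bs)"
  then have "subrep s Q N A \<or> subrep s Q N B" using As Bs by (auto simp: is_direct_sum_def)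
  moreover have "subrep s Q A M" "subrep s Q B M" using M by (auto simp: is_direct_sum_def)
  ultimately show "subrep s Q N M" using subrep_trans by blast
next
  fix v assume v: "v \<in> verts Q"
  have "direct_sum_on (length As + length Bs)
     (\<lambda>i. if i < length As then rep_space (As ! i) v else rep_space (Bs ! (i - length As)) v) (rep_space M v)"
    using M[unfolded is_direct_sum_pair_iff] As[unfolded is_direct_sum_iff] Bs[unfolded is_direct_sum_iff] v
    by (intro direct_sum_on_append[where A = "rep_space A v" and B = "rep_space B v"]) auto
  then show "direct_sum_on (length (As @ Bs)) (\<lambda>i. rep_space ((As @ Bs) ! i) v) (rep_space M v)"
    by (simp add: nth_append if_distrib if_distribR cong: if_cong)
qed

lemma is_direct_sum_permute:
  assumes d: "is_direct_sum s Q M Ns" and \<pi>: "bij_betw \<pi> {..<length Ns} {..<length Ns}"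
  shows "is_direct_sum s Q M (map (\<lambda>i. Ns ! \<pi> i) [0..<length Ns])"
  unfolding is_direct_sum_iff
proof (intro conjI ballI)
  fix N assume "N \<in> set (map (\<lambda>i. Ns ! \<pi> i) [0..<length Ns])"
  then show "subrep s Q N M" using d bij_betwE[OF \<pi>] by (auto simp: is_direct_sum_def)
next
  fix v assume "v \<in> verts Q"
  then have "direct_sum_on (length Ns) (\<lambda>i. rep_space (Ns ! \<pi> i) v) (rep_space M v)"
    using direct_sum_on_permute[OF \<pi>, of "\<lambda>i. rep_space (Ns ! i) v"] d unfolding is_direct_sum_iff by blast
  then show "direct_sum_on (length (map (\<lambda>i. Ns ! \<pi> i) [0..<length Ns]))
      (\<lambda>i. rep_space (map (\<lambda>i. Ns ! \<pi> i) [0..<length Ns] ! i) v) (rep_space M v)"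
    by (subst direct_sum_on_cong[of _ _ "\<lambda>i. rep_space (Ns ! \<pi> i) v"]) auto
qed

lemma dim_rep_space_direct_sum:
  assumes d: "is_direct_sum s Q M Ns" and v: "v \<in> verts Q"
  shows "dim (rep_space M v) = (\<Sum>i<length Ns. dim (rep_space (Ns ! i) v))"
proof (rule dim_direct_sum(2)[OF vector_space_axioms])
  have dv: "direct_sum_on (length Ns) (\<lambda>i. rep_space (Ns ! i) v) (rep_space M v)"
    using d v unfolding is_direct_sum_iff by blast
  show "rep_space M v = {\<Sum>i<length Ns. f i | f. \<forall>i\<in>{..<length Ns}. f i \<in> rep_space (Ns ! i) v}"
    using conjunct1[OF dv[unfolded direct_sum_on_def]] by (simp only: Ball_def lessThan_iff)
  show "\<forall>i\<in>{..<length Ns}. f i = 0"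
    if "\<And>i. i \<in> {..<length Ns} \<Longrightarrow> f i \<in> rep_space (Ns ! i) v" "(\<Sum>i<length Ns. f i) = 0" for f
    using that dv unfolding direct_sum_on_def by simp
  show "findim s (rep_space (Ns ! i) v)" if "i \<in> {..<length Ns}" for i
    by (rule rep_findim[OF subrepD(1)[of _ M] v]) (use that d in \<open>auto simp: is_direct_sum_iff\<close>)
qed simp

lemma dim_vector_direct_sum:
  assumes d: "is_direct_sum s Q M Ns"
  shows "dim_vector s Q M v = (\<Sum>i<length Ns. dim_vector s Q (Ns ! i) v)"
  using dim_rep_space_direct_sum[OF d] by (simp add: dim_vector_def)

lemma total_dim_direct_sum:
  assumes d: "is_direct_sum s Q M Ns"
  shows "total_dim s Q M = (\<Sum>i<length Ns. total_dim s Q (Ns ! i))"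
  unfolding total_dim_def by (subst sum.swap) (simp add: dim_rep_space_direct_sum[OF d])

text \<open>A nonzero decomposable representation splits into two of smaller total dimension.\<close>

lemma exists_indecomposable_decomposition:
  assumes "is_rep s Q M"
  shows "\<exists>Ns. is_direct_sum s Q M Ns \<and> (\<forall>N\<in>set Ns. indecomposable s Q N)"
  using assms
proof (induction "total_dim s Q M" arbitrary: M rule: less_induct)
  case less
  show ?case
  proof (cases "zero_rep Q M")
    case True
    then have "is_direct_sum s Q M []"
      by (auto simp: is_direct_sum_iff direct_sum_on_def zero_rep_def)
    then show ?thesis by (intro exI[of _ "[]"]) simp
  next
    case nz: False
    show ?thesis
    proof (cases "indecomposable s Q M")
      case True
      have "direct_sum_on (Suc 0) (\<lambda>i. rep_space ([M] ! i) v) (rep_space M v)" for v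
        using direct_sum_on_singleton[of "rep_space M v"] by (subst direct_sum_on_cong) auto
      then have "is_direct_sum s Q M [M]"
        using subrep_refl[OF less.prems] by (auto simp: is_direct_sum_iff)
      then show ?thesis using True by (intro exI[of _ "[M]"]) simp
    next
      case False
      then obtain A B where AB: "is_direct_sum s Q M [A, B]" "\<not> zero_rep Q A" "\<not> zero_rep Q B"
        using less.prems nz unfolding indecomposable_def by blast
      then have sub: "subrep s Q A M" "subrep s Q B M" by (auto simp: is_direct_sum_pair_iff)
      have "total_dim s Q A > 0" "total_dim s Q B > 0"
        using AB(2,3) zero_rep_iff_total_dim subrepD(1)[OF sub(1)] subrepD(1)[OF sub(2)] by auto
      moreover have "total_dim s Q M = total_dim s Q A + total_dim s Q B"
        using total_dim_direct_sum[OF AB(1)] by (simp add: numeral_2_eq_2)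
      ultimately have lA: "total_dim s Q A < total_dim s Q M" and lB: "total_dim s Q B < total_dim s Q M"
        by auto
      obtain As where "is_direct_sum s Q A As" "\<forall>N\<in>set As. indecomposable s Q N"
        using less.hyps[OF lA subrepD(1)[OF sub(1)]] by blast
      moreover obtain Bs where "is_direct_sum s Q B Bs" "\<forall>N\<in>set Bs. indecomposable s Q N"
        using less.hyps[OF lB subrepD(1)[OF sub(2)]] by blast
      ultimately have "is_direct_sum s Q M (As @ Bs)" "\<forall>N\<in>set (As @ Bs). indecomposable s Q N"
        using is_direct_sum_append[OF AB(1)] by auto
      then show ?thesis by blast
    qed
  qed
qed

text \<open>The components of a vector are determined uniquely, so they depend linearly on the vector and are
  compatible with the arrows.\<close>

lemma direct_sum_projections:
  assumes M: "is_rep s Q M" and d: "is_direct_sum s Q M Ns"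
  obtains p where "\<And>i. i < length Ns \<Longrightarrow> morphism s Q M (Ns ! i) (p i)"
    "\<And>v x. v \<in> verts Q \<Longrightarrow> x \<in> rep_space M v \<Longrightarrow> x = (\<Sum>i<length Ns. p i v x)"
    "\<And>i v x. i < length Ns \<Longrightarrow> v \<in> verts Q \<Longrightarrow> x \<in> rep_space (Ns ! i) v \<Longrightarrow> p i v x = x"
proof -
  let ?n = "length Ns" let ?W = "\<lambda>v i. rep_space (Ns ! i) v"
  have sub: "subrep s Q (Ns ! i) M" if "i < ?n" for i using d that unfolding is_direct_sum_def by auto
  have sW: "subspace (?W v i)" if "v \<in> verts Q" "i < ?n" for v i
    using rep_subspace[OF subrepD(1)[OF sub[OF that(2)]] that(1)] .
  have dv: "direct_sum_on ?n (?W v) (rep_space M v)" if "v \<in> verts Q" for v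
    using d that unfolding is_direct_sum_iff by blast
  have uni: "f i = g i" if "v \<in> verts Q" "i < ?n" "\<And>i. i < ?n \<Longrightarrow> f i \<in> ?W v i" "\<And>i. i < ?n \<Longrightarrow> g i \<in> ?W v i"
      "(\<Sum>i<?n. f i) = (\<Sum>i<?n. g i)" for v f g i
    by (rule direct_sum_on_unique[OF dv[OF that(1)] _ that(3,4,5,2)]) (use that sW subspace_diff in auto)
  define q where "q = (\<lambda>v x. SOME f. (\<forall>i<?n. f i \<in> ?W v i) \<and> x = (\<Sum>i<?n. f i))"
  have q: "(\<forall>i<?n. q v x i \<in> ?W v i) \<and> x = (\<Sum>i<?n. q v x i)" if "v \<in> verts Q" "x \<in> rep_space M v" for v x
  proof -
    have "\<exists>f. (\<forall>i<?n. f i \<in> ?W v i) \<and> x = (\<Sum>i<?n. f i)"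
      using dv[OF that(1)] that(2) unfolding direct_sum_on_def by blast
    then show ?thesis unfolding q_def by (rule someI_ex)
  qed
  have quni: "q v x i = f i" if "v \<in> verts Q" "x \<in> rep_space M v" "i < ?n" "\<And>i. i < ?n \<Longrightarrow> f i \<in> ?W v i"
      "x = (\<Sum>i<?n. f i)" for v x f i
    by (rule uni[OF that(1,3) _ that(4)]) (use q[OF that(1,2)] that(5) in auto)
  have mor: "morphism s Q M (Ns ! i) (\<lambda>v x. q v x i)" if i: "i < ?n" for i
    unfolding morphism_def linear_map_on_def
  proof (intro conjI ballI allI funcsetI)
    fix v x y c assume v: "v \<in> verts Q" and x: "x \<in> rep_space M v"
    note qx = q[OF v x]
    show "q v x i \<in> rep_space (Ns ! i) v" using qx i by blast
    have sM: "subspace (rep_space M v)" by (rule rep_subspace[OF M v])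
    show "q v (s c x) i = s c (q v x i)"
      using qx by (intro quni[OF v subspace_scale[OF sM x] i])
        (auto simp: scale_sum_right[symmetric] intro: subspace_scale[OF sW[OF v]])
    assume y: "y \<in> rep_space M v"
    show "q v (x + y) i = q v x i + q v y i"
      using qx q[OF v y] by (intro quni[OF v subspace_add[OF sM x y] i])
        (auto simp: sum.distrib intro: subspace_add[OF sW[OF v]])
  next
    fix a x assume a: "a \<in> arcs Q" and x: "x \<in> rep_space M (tail Q a)"
    note qx = q[OF tail_in_verts[OF a] x]
    have eq: "rep_map (Ns ! j) a (q (tail Q a) x j) = rep_map M a (q (tail Q a) x j)"
      "rep_map M a (q (tail Q a) x j) \<in> rep_space (Ns ! j) (head Q a)"
      "q (tail Q a) x j \<in> rep_space M (tail Q a)" if "j < ?n" for j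
      using subrepD[OF sub[OF that]] qx that a tail_in_verts by blast+
    have "rep_map M a x = rep_map M a (\<Sum>j<?n. q (tail Q a) x j)" using qx by simp
    also have "\<dots> = (\<Sum>j<?n. rep_map M a (q (tail Q a) x j))"
      by (rule linear_on_sum[OF vector_space_axioms vector_space_axioms _
            rep_subspace[OF M tail_in_verts[OF a]]])
        (use rep_map_linear[OF M a] eq(3) in \<open>auto simp: linear_map_on_iff\<close>)
    finally have "q (head Q a) (rep_map M a x) i = rep_map M a (q (tail Q a) x i)"
      by (intro quni[OF head_in_verts[OF a] rep_map_in[OF M a x] i eq(2)])
    then show "q (head Q a) (rep_map M a x) i = rep_map (Ns ! i) a (q (tail Q a) x i)"
      using eq(1)[OF i] by simp
  qed
  have id: "q v x i = x" if "i < ?n" "v \<in> verts Q" "x \<in> rep_space (Ns ! i) v" for i v x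
    using quni[OF that(2) subrepD(2)[OF sub[OF that(1)] that(2,3)] that(1),
        of "\<lambda>j. if j = i then x else 0"] that subspace_0[OF sW[OF that(2)]] by auto
  show thesis
    by (rule that[of "\<lambda>i v x. q v x i"]) (use mor q id in auto)
qed

end


section \<open>Vanishing of extensions\<close>

context vector_space
begin

text \<open>A map that vanishes on the kernel of \<open>f\<close> factors through \<open>f\<close>, and the factor extends from the image
  to the whole space.\<close>

lemma linear_map_on_factor:
  assumes V: "subspace V" and W: "subspace W" and f: "linear_on scale scale V f"
    and h: "linear_map_on scale V W h" and ker: "\<And>x. x \<in> V \<Longrightarrow> f x = 0 \<Longrightarrow> h x = 0"
  obtains g where "linear_map_on scale UNIV W g" "\<And>x. x \<in> V \<Longrightarrow> g (f x) = h x"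
proof -
  interpret P: vector_space_pair scale scale by unfold_locales
  have hl: "linear_on scale scale V h" using h by (simp add: linear_map_on_iff)
  have wd: "h x = h y" if "x \<in> V" "y \<in> V" "f x = f y" for x y
  proof -
    have "f (x - y) = 0" "h (x - y) = h x - h y"
      using linear_on_diff[OF vector_space_axioms vector_space_axioms f V that(1,2)]
        linear_on_diff[OF vector_space_axioms vector_space_axioms hl V that(1,2)] that(3) by auto
    then show ?thesis using ker[of "x - y"] subspace_diff[OF V that(1,2)] by simp
  qed
  let ?g = "\<lambda>y. h (inv_into V f y)"
  have inv: "inv_into V f y \<in> V" "f (inv_into V f y) = y" if "y \<in> f ` V" for y
    using that by (auto simp: inv_into_into f_inv_into_f)
  have gf: "?g (f x) = h x" if "x \<in> V" for x
    by (rule wd) (use that inv[of "f x"] in auto)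
  have "linear_map_on scale (f ` V) W ?g"
    unfolding linear_map_on_def
  proof (intro conjI ballI allI funcsetI)
    fix y assume "y \<in> f ` V"
    then show "?g y \<in> W" using inv linear_map_on_mem[OF h] by blast
  next
    fix y z assume "y \<in> f ` V" "z \<in> f ` V"
    then obtain u v where uv: "u \<in> V" "v \<in> V" "y = f u" "z = f v" by blast
    have "y + z = f (u + v)" "h (u + v) = h u + h v" using f hl uv by (auto simp: linear_on_def)
    then show "?g (y + z) = ?g y + ?g z" using gf uv subspace_add[OF V] by metis
  next
    fix c y assume "y \<in> f ` V"
    then obtain u where u: "u \<in> V" "y = f u" by blast
    have "scale c y = f (scale c u)" "h (scale c u) = scale c (h u)" using f hl u by (auto simp: linear_on_def)
    then show "?g (scale c y) = scale c (?g y)" using gf u subspace_scale[OF V] by metis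
  qed
  then obtain g where "linear_map_on scale UNIV W g" "\<And>y. y \<in> f ` V \<Longrightarrow> g y = ?g y"
    by (elim linear_map_on_extend[OF P.subspace_image_on[OF V f] _ W]) auto
  then show thesis using that[of g] gf by auto
qed

end

definition retraction ::
  "('k::field \<Rightarrow> 'b::ab_group_add \<Rightarrow> 'b) \<Rightarrow> ('v, 'a) pre_digraph \<Rightarrow>
   ('v, 'a, 'b) quiver_rep \<Rightarrow> ('v, 'a, 'b) quiver_rep \<Rightarrow> ('v \<Rightarrow> 'b \<Rightarrow> 'b) \<Rightarrow> bool"
  where
  "retraction s Q M N p \<longleftrightarrow> subrep s Q N M \<and> morphism s Q M N p \<and>
     (\<forall>v\<in>verts Q. \<forall>x\<in>rep_space N v. p v x = x)"

context finite_quiver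
begin

lemma morphism_linear_on:
  "morphism s Q M N f \<Longrightarrow> v \<in> verts Q \<Longrightarrow> linear_on s s (rep_space M v) (f v)"
  using morphismD(1)[of M N f v] by (simp add: linear_map_on_iff)

lemma rep_map_linear_on: "is_rep s Q M \<Longrightarrow> a \<in> arcs Q \<Longrightarrow> linear_on s s (rep_space M (tail Q a)) (rep_map M a)"
  using rep_map_linear[of M a] by (simp add: linear_map_on_iff)

lemma linear_on_rep_diff:
  assumes M: "is_rep s Q M" and v: "v \<in> verts Q" and f: "linear_on s s (rep_space M v) f"
    and x: "x \<in> rep_space M v" "y \<in> rep_space M v"
  shows "f (x - y) = f x - f y"
  by (rule linear_on_diff[OF vector_space_axioms vector_space_axioms f rep_subspace[OF M v] x])

text \<open>Path algebras are hereditary: \<open>Ext\<^sup>1(_, N)\<close> turns injections into surjections. A family of maps along the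
  arrows on the subobject extends to the larger representation, and a solution there restricts to a solution.\<close>

lemma ext_vanishes_embedded:
  assumes reps: "is_rep s Q I" "is_rep s Q K" "is_rep s Q N"
    and \<alpha>: "morphism s Q I K \<alpha>" and inj: "\<And>v. v \<in> verts Q \<Longrightarrow> inj_on (\<alpha> v) (rep_space I v)"
    and van: "ext_vanishes s Q K N"
  shows "ext_vanishes s Q I N"
  unfolding ext_vanishes_def
proof (intro allI impI)
  interpret P: vector_space_pair s s by unfold_locales
  fix h assume h: "\<forall>a\<in>arcs Q. linear_map_on s (rep_space I (tail Q a)) (rep_space N (head Q a)) (h a)"
  have "\<exists>g. linear_map_on s (rep_space K (tail Q a)) (rep_space N (head Q a)) g \<and>
      (\<forall>x\<in>rep_space I (tail Q a). g (\<alpha> (tail Q a) x) = h a x)" if a: "a \<in> arcs Q" for a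
  proof -
    note t = tail_in_verts[OF a] and lin = morphism_linear_on[OF \<alpha> tail_in_verts[OF a]]
    note sub = rep_subspace[OF reps(1) t]
    have h0: "h a 0 = 0" using linear_map_on_zero[OF h[rule_format, OF a] sub] .
    obtain g where g: "linear_map_on s UNIV (rep_space N (head Q a)) g"
      "\<And>x. x \<in> rep_space I (tail Q a) \<Longrightarrow> g (\<alpha> (tail Q a) x) = h a x"
      by (rule linear_map_on_factor[OF sub rep_subspace[OF reps(3) head_in_verts[OF a]] lin h[rule_format, OF a]])
        (use P.linear_on_inj_iff[OF sub lin] inj[OF t] h0 in auto)
    have "linear_map_on s (rep_space K (tail Q a)) (rep_space N (head Q a)) g"
      by (rule linear_map_on_restrict[OF g(1)]) (use linear_map_on_mem[OF g(1)] in auto)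
    then show ?thesis using g(2) by blast
  qed
  then obtain h' where h': "\<forall>a\<in>arcs Q. linear_map_on s (rep_space K (tail Q a)) (rep_space N (head Q a)) (h' a)"
    "\<And>a x. a \<in> arcs Q \<Longrightarrow> x \<in> rep_space I (tail Q a) \<Longrightarrow> h' a (\<alpha> (tail Q a) x) = h a x"
    by metis
  obtain f where f: "\<And>v. v \<in> verts Q \<Longrightarrow> linear_map_on s (rep_space K v) (rep_space N v) (f v)"
    "\<And>a x. a \<in> arcs Q \<Longrightarrow> x \<in> rep_space K (tail Q a) \<Longrightarrow>
       f (head Q a) (rep_map K a x) - rep_map N a (f (tail Q a) x) = h' a x"
    using van h'(1) unfolding ext_vanishes_def by blast
  show "\<exists>f. (\<forall>v\<in>verts Q. linear_map_on s (rep_space I v) (rep_space N v) (f v)) \<and>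
    (\<forall>a\<in>arcs Q. \<forall>x\<in>rep_space I (tail Q a). f (head Q a) (rep_map I a x) - rep_map N a (f (tail Q a) x) = h a x)"
  proof (intro exI[of _ "\<lambda>v x. f v (\<alpha> v x)"] conjI ballI)
    show "linear_map_on s (rep_space I v) (rep_space N v) (\<lambda>x. f v (\<alpha> v x))" if "v \<in> verts Q" for v
      using linear_map_on_compose[OF morphismD(1)[OF \<alpha> that] f(1)[OF that]] .
  next
    fix a x assume a: "a \<in> arcs Q" "x \<in> rep_space I (tail Q a)"
    show "f (head Q a) (\<alpha> (head Q a) (rep_map I a x)) - rep_map N a (f (tail Q a) (\<alpha> (tail Q a) x)) = h a x"
      using f(2)[OF a(1) morphismD(2)[OF \<alpha> tail_in_verts[OF a(1)] a(2)]] morphismD(3)[OF \<alpha> a] h'(2)[OF a]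
      by simp
  qed
qed

text \<open>A family along the arrows for the summands is carried to the big representations by the projection of one
  and the inclusion of the other; a solution there is carried back in the same way.\<close>

lemma ext_vanishes_retract:
  assumes reps: "is_rep s Q M" "is_rep s Q M'"
    and p: "retraction s Q M N p" and p': "retraction s Q M' N' p'"
    and van: "ext_vanishes s Q M M'"
  shows "ext_vanishes s Q N N'"
  unfolding ext_vanishes_def
proof (intro allI impI)
  have r: "subrep s Q N M" "morphism s Q M N p" "\<And>v x. v \<in> verts Q \<Longrightarrow> x \<in> rep_space N v \<Longrightarrow> p v x = x"
    using p by (auto simp: retraction_def)
  have r': "subrep s Q N' M'" "morphism s Q M' N' p'" "\<And>v x. v \<in> verts Q \<Longrightarrow> x \<in> rep_space N' v \<Longrightarrow> p' v x = x"
    using p' by (auto simp: retraction_def)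
  fix h assume h: "\<forall>a\<in>arcs Q. linear_map_on s (rep_space N (tail Q a)) (rep_space N' (head Q a)) (h a)"
  have "linear_map_on s (rep_space M (tail Q a)) (rep_space M' (head Q a)) (\<lambda>x. h a (p (tail Q a) x))"
    if a: "a \<in> arcs Q" for a
    by (rule linear_map_on_compose[OF linear_map_on_compose[OF morphismD(1)[OF r(2) tail_in_verts[OF a]] h[rule_format, OF a]]
         morphismD(1)[OF subrep_inclusion[OF r'(1)] head_in_verts[OF a]]])
  then obtain f where f: "\<And>v. v \<in> verts Q \<Longrightarrow> linear_map_on s (rep_space M v) (rep_space M' v) (f v)"
    "\<And>a x. a \<in> arcs Q \<Longrightarrow> x \<in> rep_space M (tail Q a) \<Longrightarrow>
       f (head Q a) (rep_map M a x) - rep_map M' a (f (tail Q a) x) = h a (p (tail Q a) x)"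
    using van[unfolded ext_vanishes_def, rule_format, of "\<lambda>a x. h a (p (tail Q a) x)"] by blast
  show "\<exists>f. (\<forall>v\<in>verts Q. linear_map_on s (rep_space N v) (rep_space N' v) (f v)) \<and>
    (\<forall>a\<in>arcs Q. \<forall>x\<in>rep_space N (tail Q a). f (head Q a) (rep_map N a x) - rep_map N' a (f (tail Q a) x) = h a x)"
  proof (intro exI[of _ "\<lambda>v x. p' v (f v x)"] conjI ballI)
    show "linear_map_on s (rep_space N v) (rep_space N' v) (\<lambda>x. p' v (f v x))" if v: "v \<in> verts Q" for v
      by (rule linear_map_on_compose[OF linear_map_on_compose[OF morphismD(1)[OF subrep_inclusion[OF r(1)] v] f(1)[OF v]]
            morphismD(1)[OF r'(2) v]])
  next
    fix a x assume a: "a \<in> arcs Q" and x: "x \<in> rep_space N (tail Q a)"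
    note t = tail_in_verts[OF a] and hd = head_in_verts[OF a]
    have xM: "x \<in> rep_space M (tail Q a)" by (rule subrepD(2)[OF r(1) t x])
    have fx: "f (tail Q a) x \<in> rep_space M' (tail Q a)" using linear_map_on_mem[OF f(1)[OF t] xM] .
    have hx: "h a x \<in> rep_space N' (head Q a)" using linear_map_on_mem[OF h[rule_format, OF a] x] .
    have fMx: "f (head Q a) (rep_map M a x) \<in> rep_space M' (head Q a)"
      using linear_map_on_mem[OF f(1)[OF hd] rep_map_in[OF reps(1) a xM]] .
    have "p' (head Q a) (f (head Q a) (rep_map N a x)) - rep_map N' a (p' (tail Q a) (f (tail Q a) x))
      = p' (head Q a) (f (head Q a) (rep_map M a x)) - p' (head Q a) (rep_map M' a (f (tail Q a) x))"
      using subrepD(3)[OF r(1) a x] morphismD(3)[OF r'(2) a fx] by simp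
    also have "\<dots> = p' (head Q a) (f (head Q a) (rep_map M a x) - rep_map M' a (f (tail Q a) x))"
      using linear_on_rep_diff[OF reps(2) hd morphism_linear_on[OF r'(2) hd] fMx rep_map_in[OF reps(2) a fx]] by simp
    also have "\<dots> = h a x" using f(2)[OF a xM] r(3)[OF t x] r'(3)[OF hd hx] by simp
    finally show "p' (head Q a) (f (head Q a) (rep_map N a x)) - rep_map N' a (p' (tail Q a) (f (tail Q a) x)) = h a x" .
  qed
qed

text \<open>A family along the arrows of the subquiver, extended by zero to the other arrows, has a solution on the
  whole quiver, whose components at the remaining vertices can be forgotten.\<close>

lemma ext_vanishes_restrict:
  assumes M: "is_rep s Q M" and N: "is_rep s Q N" and S: "S \<subseteq> verts Q" and van: "ext_vanishes s Q M N"
  shows "ext_vanishes s (Q \<restriction> S) M N"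
  unfolding ext_vanishes_def
proof (intro allI impI)
  let ?Q = "Q \<restriction> S"
  fix h assume h: "\<forall>a\<in>arcs ?Q. linear_map_on s (rep_space M (tail ?Q a)) (rep_space N (head ?Q a)) (h a)"
  let ?h = "\<lambda>a. if a \<in> arcs ?Q then h a else (\<lambda>_. 0)"
  have "linear_map_on s (rep_space M (tail Q a)) (rep_space N (head Q a)) (?h a)" if "a \<in> arcs Q" for a
    using h that subspace_0[OF rep_subspace[OF N head_in_verts[OF that]]] by (auto simp: linear_map_on_def)
  then obtain f where f: "\<And>v. v \<in> verts Q \<Longrightarrow> linear_map_on s (rep_space M v) (rep_space N v) (f v)"
    "\<And>a x. a \<in> arcs Q \<Longrightarrow> x \<in> rep_space M (tail Q a) \<Longrightarrow>
       f (head Q a) (rep_map M a x) - rep_map N a (f (tail Q a) x) = ?h a x"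
    using van[unfolded ext_vanishes_def, rule_format, of ?h] by blast
  show "\<exists>f. (\<forall>v\<in>verts ?Q. linear_map_on s (rep_space M v) (rep_space N v) (f v)) \<and>
    (\<forall>a\<in>arcs ?Q. \<forall>x\<in>rep_space M (tail ?Q a). f (head ?Q a) (rep_map M a x) - rep_map N a (f (tail ?Q a) x) = h a x)"
    by (rule exI[of _ f]) (use f S in auto)
qed

text \<open>The long exact sequence for \<open>0 \<rightarrow> ker \<theta> \<rightarrow> M \<rightarrow> im \<theta> \<rightarrow> 0\<close>: the obstruction to extending \<open>p\<close> lies
  in \<open>Ext\<^sup>1(im \<theta>, K)\<close>. A linear extension of \<open>p\<close> at each vertex has a defect of commutation that
  vanishes on the kernel; it factors through \<open>\<theta>\<close>, and a solution on the image corrects the extension.\<close>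

lemma extend_morphism_from_kernel:
  assumes reps: "is_rep s Q M" "is_rep s Q N" "is_rep s Q K" and \<theta>: "morphism s Q M N \<theta>"
    and p: "morphism s Q (with_spaces M (\<lambda>v. {x \<in> rep_space M v. \<theta> v x = 0})) K p"
    and van: "ext_vanishes s Q (with_spaces N (\<lambda>v. \<theta> v ` rep_space M v)) K"
  obtains P where "morphism s Q M K P"
    "\<And>v x. v \<in> verts Q \<Longrightarrow> x \<in> rep_space M v \<Longrightarrow> \<theta> v x = 0 \<Longrightarrow> P v x = p v x"
proof -
  interpret P: vector_space_pair s s by unfold_locales
  note kerrep = subrepD(1)[OF kernel_subrep[OF reps(1,2) \<theta>]]
  have "\<exists>g. linear_map_on s (rep_space M v) (rep_space K v) g \<and> (\<forall>x\<in>rep_space M v. \<theta> v x = 0 \<longrightarrow> g x = p v x)"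
    if v: "v \<in> verts Q" for v
  proof -
    obtain g where g: "linear_map_on s UNIV (rep_space K v) g"
      "\<And>x. x \<in> rep_space (with_spaces M (\<lambda>v. {x \<in> rep_space M v. \<theta> v x = 0})) v \<Longrightarrow> g x = p v x"
      by (rule linear_map_on_extend[OF rep_subspace[OF kerrep v] morphismD(1)[OF p v] rep_subspace[OF reps(3) v]])
        (rule that, assumption, blast)
    have "linear_map_on s (rep_space M v) (rep_space K v) g"
      by (rule linear_map_on_restrict[OF g(1)]) (use linear_map_on_mem[OF g(1)] in auto)
    then show ?thesis using g(2) by auto
  qed
  then obtain p' where p': "\<And>v. v \<in> verts Q \<Longrightarrow> linear_map_on s (rep_space M v) (rep_space K v) (p' v)"
     "\<And>v x. v \<in> verts Q \<Longrightarrow> x \<in> rep_space M v \<Longrightarrow> \<theta> v x = 0 \<Longrightarrow> p' v x = p v x" by metis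
  define \<delta> where "\<delta> = (\<lambda>a x. p' (head Q a) (rep_map M a x) - rep_map K a (p' (tail Q a) x))"
  have "\<exists>g. linear_map_on s (\<theta> (tail Q a) ` rep_space M (tail Q a)) (rep_space K (head Q a)) g \<and>
      (\<forall>x\<in>rep_space M (tail Q a). g (\<theta> (tail Q a) x) = \<delta> a x)" if a: "a \<in> arcs Q" for a
  proof -
    note t = tail_in_verts[OF a] and hd = head_in_verts[OF a]
    have lin: "linear_map_on s (rep_space M (tail Q a)) (rep_space K (head Q a)) (\<delta> a)"
      unfolding \<delta>_def
      by (rule linear_map_on_diff[OF rep_subspace[OF reps(3) hd]
            linear_map_on_compose[OF rep_map_linear[OF reps(1) a] p'(1)[OF hd]]
            linear_map_on_compose[OF p'(1)[OF t] rep_map_linear[OF reps(3) a]]])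
    have ker: "\<delta> a x = 0" if x: "x \<in> rep_space M (tail Q a)" "\<theta> (tail Q a) x = 0" for x
    proof -
      have "\<theta> (head Q a) (rep_map M a x) = rep_map N a (\<theta> (tail Q a) x)" by (rule morphismD(3)[OF \<theta> a x(1)])
      then have "\<theta> (head Q a) (rep_map M a x) = 0"
        using x(2) linear_map_on_zero[OF rep_map_linear[OF reps(2) a] rep_subspace[OF reps(2) t]] by simp
      then have "p' (head Q a) (rep_map M a x) = p (head Q a) (rep_map M a x)"
        by (rule p'(2)[OF hd rep_map_in[OF reps(1) a x(1)]])
      then show ?thesis using morphismD(3)[OF p a] x p'(2)[OF t x] by (simp add: \<delta>_def)
    qed
    obtain g where g: "linear_map_on s UNIV (rep_space K (head Q a)) g"
      "\<And>x. x \<in> rep_space M (tail Q a) \<Longrightarrow> g (\<theta> (tail Q a) x) = \<delta> a x"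
      by (rule linear_map_on_factor[OF rep_subspace[OF reps(1) t] rep_subspace[OF reps(3) hd] morphism_linear_on[OF \<theta> t] lin])
        (use ker in auto)
    have "linear_map_on s (\<theta> (tail Q a) ` rep_space M (tail Q a)) (rep_space K (head Q a)) g"
      by (rule linear_map_on_restrict[OF g(1)]) (use linear_map_on_mem[OF g(1)] in auto)
    then show ?thesis using g(2) by blast
  qed
  then obtain h where h: "\<forall>a\<in>arcs Q. linear_map_on s (\<theta> (tail Q a) ` rep_space M (tail Q a)) (rep_space K (head Q a)) (h a)"
     "\<And>a x. a \<in> arcs Q \<Longrightarrow> x \<in> rep_space M (tail Q a) \<Longrightarrow> h a (\<theta> (tail Q a) x) = \<delta> a x" by metis
  let ?I = "with_spaces N (\<lambda>v. \<theta> v ` rep_space M v)"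
  have "\<exists>f. (\<forall>v\<in>verts Q. linear_map_on s (rep_space ?I v) (rep_space K v) (f v)) \<and>
      (\<forall>a\<in>arcs Q. \<forall>x\<in>rep_space ?I (tail Q a).
         f (head Q a) (rep_map ?I a x) - rep_map K a (f (tail Q a) x) = h a x)"
    by (rule van[unfolded ext_vanishes_def, rule_format]) (use h(1) in auto)
  then obtain f where f: "\<And>v. v \<in> verts Q \<Longrightarrow> linear_map_on s (rep_space ?I v) (rep_space K v) (f v)"
    "\<And>a x. a \<in> arcs Q \<Longrightarrow> x \<in> rep_space ?I (tail Q a) \<Longrightarrow>
       f (head Q a) (rep_map ?I a x) - rep_map K a (f (tail Q a) x) = h a x"
    by blast
  have lin\<theta>: "linear_map_on s (rep_space M v) (rep_space ?I v) (\<theta> v)" if "v \<in> verts Q" for v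
    using morphism_linear_on[OF \<theta> that] by (auto simp: linear_map_on_iff)
  have f\<theta>: "linear_map_on s (rep_space M v) (rep_space K v) (\<lambda>x. f v (\<theta> v x))" if "v \<in> verts Q" for v
    by (rule linear_map_on_compose[OF lin\<theta>[OF that] f(1)[OF that]])
  show thesis
  proof (rule that[of "\<lambda>v x. p' v x - f v (\<theta> v x)"])
    show "morphism s Q M K (\<lambda>v x. p' v x - f v (\<theta> v x))"
      unfolding morphism_def
    proof (intro conjI ballI)
      show "linear_map_on s (rep_space M v) (rep_space K v) (\<lambda>x. p' v x - f v (\<theta> v x))"
        if v: "v \<in> verts Q" for v
        by (rule linear_map_on_diff[OF rep_subspace[OF reps(3) v] p'(1)[OF v] f\<theta>[OF v]])
      fix a x assume a: "a \<in> arcs Q" and x: "x \<in> rep_space M (tail Q a)"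
      note t = tail_in_verts[OF a] and hd = head_in_verts[OF a]
      have 1: "\<theta> (head Q a) (rep_map M a x) = rep_map N a (\<theta> (tail Q a) x)" by (rule morphismD(3)[OF \<theta> a x])
      have 2: "f (head Q a) (rep_map N a (\<theta> (tail Q a) x)) =
          \<delta> a x + rep_map K a (f (tail Q a) (\<theta> (tail Q a) x))"
        using f(2)[OF a, of "\<theta> (tail Q a) x"] x h(2)[OF a x] by (simp add: diff_eq_eq)
      have 3: "rep_map K a (p' (tail Q a) x - f (tail Q a) (\<theta> (tail Q a) x)) =
          rep_map K a (p' (tail Q a) x) - rep_map K a (f (tail Q a) (\<theta> (tail Q a) x))"
        by (rule linear_on_rep_diff[OF reps(3) t rep_map_linear_on[OF reps(3) a]
              linear_map_on_mem[OF p'(1)[OF t] x] linear_map_on_mem[OF f\<theta>[OF t] x]])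
      show "p' (head Q a) (rep_map M a x) - f (head Q a) (\<theta> (head Q a) (rep_map M a x)) =
         rep_map K a (p' (tail Q a) x - f (tail Q a) (\<theta> (tail Q a) x))"
        unfolding 1 2 3 \<delta>_def by (simp add: algebra_simps)
    qed
  next
    fix v x assume v: "v \<in> verts Q" "x \<in> rep_space M v" "\<theta> v x = 0"
    have "f v 0 = 0"
      using linear_map_on_zero[OF f(1)[OF v(1)] rep_subspace[OF subrepD(1)[OF image_subrep[OF reps(1,2) \<theta>]] v(1)]] .
    then show "p' v x - f v (\<theta> v x) = p v x" using p'(2)[OF v] v(3) by simp
  qed
qed

text \<open>A retraction splits the representation into its image and its kernel.\<close>

lemma indecomposable_retract:
  assumes M: "indecomposable s Q M" and p: "retraction s Q M N p"
  shows "zero_rep Q N \<or> (\<forall>v\<in>verts Q. rep_space N v = rep_space M v)"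
proof -
  have rM: "is_rep s Q M" using M by (simp add: indecomposable_def)
  have r: "subrep s Q N M" "morphism s Q M N p" "\<And>v x. v \<in> verts Q \<Longrightarrow> x \<in> rep_space N v \<Longrightarrow> p v x = x"
    using p by (auto simp: retraction_def)
  note rN = subrepD(1)[OF r(1)]
  let ?K = "with_spaces M (\<lambda>v. {x \<in> rep_space M v. p v x = 0})"
  have pdiff: "x - p v x \<in> rep_space ?K v" if "v \<in> verts Q" "x \<in> rep_space M v" for v x
  proof -
    have px: "p v x \<in> rep_space N v" "p v x \<in> rep_space M v"
      using morphismD(2)[OF r(2) that] subrepD(2)[OF r(1) that(1)] by auto
    then show ?thesis
      using linear_on_rep_diff[OF rM that(1) morphism_linear_on[OF r(2) that(1)] that(2) px(2)]
        r(3)[OF that(1) px(1)] subspace_diff[OF rep_subspace[OF rM that(1)] that(2) px(2)] by simp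
  qed
  have "is_direct_sum s Q M [N, ?K]"
    unfolding is_direct_sum_pair_iff
  proof (intro conjI ballI impI)
    show "subrep s Q N M" "subrep s Q ?K M" using r kernel_subrep[OF rM rN r(2)] by auto
    fix v assume v: "v \<in> verts Q"
    show "rep_space M v = {x + y | x y. x \<in> rep_space N v \<and> y \<in> rep_space ?K v}"
    proof (intro equalityI subsetI)
      fix x assume x: "x \<in> rep_space M v"
      have "x = p v x + (x - p v x)" by simp
      then show "x \<in> {x + y | x y. x \<in> rep_space N v \<and> y \<in> rep_space ?K v}"
        using pdiff[OF v x] morphismD(2)[OF r(2) v x] by blast
    next
      fix z assume "z \<in> {x + y | x y. x \<in> rep_space N v \<and> y \<in> rep_space ?K v}"
      then show "z \<in> rep_space M v" using subrepD(2)[OF r(1) v] subspace_add[OF rep_subspace[OF rM v]] by auto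
    qed
    fix x y assume x: "x \<in> rep_space N v" and y: "y \<in> rep_space ?K v" and xy: "x + y = 0"
    have "p v (x + y) = p v x + p v y"
      using morphism_linear_on[OF r(2) v] subrepD(2)[OF r(1) v x] y by (simp add: linear_on_def)
    then have "x = 0" using xy y r(3)[OF v x] morphism_0[OF rM r(2) v] by simp
    then show "x = 0" "y = 0" using xy by auto
  qed
  then have "zero_rep Q N \<or> zero_rep Q ?K" using M unfolding indecomposable_def by blast
  moreover have "rep_space N v = rep_space M v" if z: "zero_rep Q ?K" and v: "v \<in> verts Q" for v
  proof
    show "rep_space N v \<subseteq> rep_space M v" using subrepD(2)[OF r(1) v] by blast
    show "rep_space M v \<subseteq> rep_space N v"
    proof
      fix x assume x: "x \<in> rep_space M v"
      have "rep_space ?K v = {0}" using z v by (simp only: zero_rep_def)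
      then have "x - p v x = 0" using pdiff[OF v x] by blast
      then have "p v x = x" by simp
      then show "x \<in> rep_space N v" using morphismD(2)[OF r(2) v x] by simp
    qed
  qed
  ultimately show ?thesis by blast
qed

lemma direct_sum_retraction:
  assumes M: "is_rep s Q M" and d: "is_direct_sum s Q M Ns" and N: "N \<in> set Ns"
  obtains p where "retraction s Q M N p"
proof -
  obtain i where i: "i < length Ns" "N = Ns ! i" using N by (metis in_set_conv_nth)
  obtain p where "\<And>i. i < length Ns \<Longrightarrow> morphism s Q M (Ns ! i) (p i)"
    "\<And>i v x. i < length Ns \<Longrightarrow> v \<in> verts Q \<Longrightarrow> x \<in> rep_space (Ns ! i) v \<Longrightarrow> p i v x = x"
    by (rule direct_sum_projections[OF M d]) (rule that, blast, blast)
  then have "retraction s Q M N (p i)" using i d by (auto simp: retraction_def is_direct_sum_def)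
  then show thesis using that by blast
qed

end


section \<open>Indecomposable representations are exceptional\<close>

definition positive_definite :: "('v, 'a) pre_digraph \<Rightarrow> bool" where
  "positive_definite Q \<longleftrightarrow> (\<forall>d. (\<exists>v\<in>verts Q. d v \<noteq> 0) \<longrightarrow> tits_form Q d > 0)"

context finite_quiver
begin

text \<open>Endomorphisms are compared by the total dimension of their images: rank zero means zero, full rank means
  bijective.\<close>

definition rank_of :: "('v, 'a, 'b) quiver_rep \<Rightarrow> ('v \<Rightarrow> 'b \<Rightarrow> 'b) \<Rightarrow> nat" where
  "rank_of M f = total_dim s Q (with_spaces M (\<lambda>v. f v ` rep_space M v))"

lemma rank_of_eq_0:
  assumes M: "is_rep s Q M" and N: "is_rep s Q N" and f: "morphism s Q M N f"
  shows "rank_of M f = 0 \<longleftrightarrow> (\<forall>v\<in>verts Q. \<forall>x\<in>rep_space M v. f v x = 0)"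
proof -
  let ?I = "with_spaces N (\<lambda>v. f v ` rep_space M v)"
  have "rank_of M f = total_dim s Q ?I" by (simp add: rank_of_def total_dim_def)
  moreover have "total_dim s Q ?I = 0 \<longleftrightarrow> zero_rep Q ?I"
    using zero_rep_iff_total_dim[OF subrepD(1)[OF image_subrep[OF M N f]]] by simp
  moreover have "zero_rep Q ?I \<longleftrightarrow> (\<forall>v\<in>verts Q. \<forall>x\<in>rep_space M v. f v x = 0)"
  proof -
    have "f v ` rep_space M v = {0} \<longleftrightarrow> (\<forall>x\<in>rep_space M v. f v x = 0)" if "v \<in> verts Q" for v
      using subspace_0[OF rep_subspace[OF M that]] morphism_0[OF M f that] by auto
    then show ?thesis by (simp add: zero_rep_def)
  qed
  ultimately show ?thesis by simp
qed

lemma rank_of_eq_total_dim: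
  assumes M: "is_rep s Q M" and f: "morphism s Q M N f"
  shows "rank_of M f \<le> total_dim s Q M"
    and "rank_of M f = total_dim s Q M \<longleftrightarrow> (\<forall>v\<in>verts Q. inj_on (f v) (rep_space M v))"
proof -
  interpret P: vector_space_pair s s by unfold_locales
  have r: "rank_of M f = (\<Sum>v\<in>verts Q. dim (f v ` rep_space M v))" by (simp add: rank_of_def total_dim_def)
  have le: "dim (f v ` rep_space M v) \<le> dim (rep_space M v)" if "v \<in> verts Q" for v
    using P.rank_nullity_findim[OF rep_findim[OF M that] morphism_linear_on[OF f that]] by simp
  have iff: "dim (f v ` rep_space M v) = dim (rep_space M v) \<longleftrightarrow> inj_on (f v) (rep_space M v)" if "v \<in> verts Q" for v
    using P.dim_image_inj[OF rep_findim[OF M that] morphism_linear_on[OF f that]]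
      P.inj_on_of_dim_image[OF rep_findim[OF M that] morphism_linear_on[OF f that]] by blast
  show "rank_of M f \<le> total_dim s Q M" unfolding r total_dim_def by (rule sum_mono[OF le])
  show "rank_of M f = total_dim s Q M \<longleftrightarrow> (\<forall>v\<in>verts Q. inj_on (f v) (rep_space M v))"
  proof
    assume eq: "rank_of M f = total_dim s Q M"
    have "dim (f v ` rep_space M v) = dim (rep_space M v)" if "v \<in> verts Q" for v
      by (rule sum_mono_inv[OF eq[unfolded r total_dim_def]]) (use that le finite_verts in auto)
    then show "\<forall>v\<in>verts Q. inj_on (f v) (rep_space M v)" using iff by blast
  next
    assume "\<forall>v\<in>verts Q. inj_on (f v) (rep_space M v)"
    then show "rank_of M f = total_dim s Q M"
      unfolding r total_dim_def using iff by (intro sum.cong) auto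
  qed
qed

text \<open>If \<open>\<theta>\<close> and its square have the same image, the representation is the direct sum of kernel and image
  of \<open>\<theta>\<close>.\<close>

lemma fitting_lemma:
  assumes M: "indecomposable s Q M" and \<theta>: "morphism s Q M M \<theta>"
    and st: "\<And>v. v \<in> verts Q \<Longrightarrow> \<theta> v ` \<theta> v ` rep_space M v = \<theta> v ` rep_space M v"
  shows "rank_of M \<theta> = 0 \<or> rank_of M \<theta> = total_dim s Q M"
proof -
  interpret P: vector_space_pair s s by unfold_locales
  have rM: "is_rep s Q M" using M by (simp add: indecomposable_def)
  let ?K = "with_spaces M (\<lambda>v. {x \<in> rep_space M v. \<theta> v x = 0})"
  let ?I = "with_spaces M (\<lambda>v. \<theta> v ` rep_space M v)"
  note subK = kernel_subrep[OF rM rM \<theta>] and subI = image_subrep[OF rM rM \<theta>]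
  have injI: "inj_on (\<theta> v) (\<theta> v ` rep_space M v)" if v: "v \<in> verts Q" for v
  proof (rule P.inj_on_of_dim_image)
    show "findim s (\<theta> v ` rep_space M v)" using rep_findim[OF subrepD(1)[OF subI] v] by simp
    show "linear_on s s (\<theta> v ` rep_space M v) (\<theta> v)"
      by (rule linear_on_subset[OF morphism_linear_on[OF \<theta> v]]) (use morphismD(2)[OF \<theta> v] in auto)
    show "dim (\<theta> v ` \<theta> v ` rep_space M v) = dim (\<theta> v ` rep_space M v)" using st[OF v] by simp
  qed
  have "is_direct_sum s Q M [?K, ?I]"
    unfolding is_direct_sum_pair_iff
  proof (intro conjI ballI impI subK subI)
    fix v assume v: "v \<in> verts Q"
    note sM = rep_subspace[OF rM v]
    show "rep_space M v = {x + y | x y. x \<in> rep_space ?K v \<and> y \<in> rep_space ?I v}"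
    proof (intro equalityI subsetI)
      fix x assume x: "x \<in> rep_space M v"
      then have "\<theta> v x \<in> \<theta> v ` \<theta> v ` rep_space M v" using st[OF v] by blast
      then obtain y where y: "y \<in> rep_space M v" "\<theta> v x = \<theta> v (\<theta> v y)" by blast
      have ty: "\<theta> v y \<in> rep_space M v" using morphismD(2)[OF \<theta> v y(1)] .
      have "\<theta> v (x - \<theta> v y) = 0"
        using linear_on_rep_diff[OF rM v morphism_linear_on[OF \<theta> v] x ty] y(2) by simp
      then have "x - \<theta> v y \<in> rep_space ?K v" using subspace_diff[OF sM x ty] by simp
      moreover have "\<theta> v y \<in> rep_space ?I v" using y by simp
      moreover have "x = (x - \<theta> v y) + \<theta> v y" by simp
      ultimately show "x \<in> {x + y | x y. x \<in> rep_space ?K v \<and> y \<in> rep_space ?I v}" by blast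
    next
      fix z assume "z \<in> {x + y | x y. x \<in> rep_space ?K v \<and> y \<in> rep_space ?I v}"
      then show "z \<in> rep_space M v" using subrepD(2)[OF subI v] subspace_add[OF sM] by auto
    qed
    fix x y assume x: "x \<in> rep_space ?K v" and y: "y \<in> rep_space ?I v" and xy: "x + y = 0"
    have yM: "y \<in> rep_space M v" using subrepD(2)[OF subI v y] .
    have "\<theta> v (x + y) = \<theta> v x + \<theta> v y"
      using morphism_linear_on[OF \<theta> v] yM x by (simp add: linear_on_def)
    then have "\<theta> v y = \<theta> v 0" using xy x morphism_0[OF rM \<theta> v] by simp
    moreover have "0 \<in> \<theta> v ` rep_space M v"
      using morphism_0[OF rM \<theta> v] subspace_0[OF sM] by (metis imageI)
    ultimately have "y = 0" using inj_onD[OF injI[OF v]] y by simp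
    then show "x = 0" "y = 0" using xy by auto
  qed
  then have "zero_rep Q ?K \<or> zero_rep Q ?I" using M unfolding indecomposable_def by blast
  then show ?thesis
  proof
    assume "zero_rep Q ?I"
    then show ?thesis using zero_rep_iff_total_dim[OF subrepD(1)[OF subI]] by (simp add: rank_of_def)
  next
    assume z: "zero_rep Q ?K"
    have "inj_on (\<theta> v) (rep_space M v)" if v: "v \<in> verts Q" for v
      using z v P.linear_on_inj_iff[OF rep_subspace[OF rM v] morphism_linear_on[OF \<theta> v]]
      by (auto simp: zero_rep_def)
    then show ?thesis using rank_of_eq_total_dim(2)[OF rM \<theta>] by blast
  qed
qed

text \<open>Ringel's argument. Let \<open>f\<close> be an endomorphism of least rank among those that are neither zero nor
  injective. By Fitting's lemma and minimality \<open>f\<close> squares to zero, so its image lies in its kernel. Decompose the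
  kernel into indecomposables and pick a summand \<open>N\<close> on which the projection of the image is not zero. By
  minimality again this projection is injective on the image. As \<open>N\<close> is smaller than \<open>M\<close>, it has no
  self-extensions, so there are none of the image by \<open>N\<close> either. Then the projection of the kernel onto \<open>N\<close>
  extends to all of \<open>M\<close>, and \<open>N\<close> is a proper direct summand of \<open>M\<close>, which is absurd.\<close>

lemma endomorphism_injective_or_zero:
  assumes M: "indecomposable s Q M"
    and small: "\<And>K. indecomposable s Q K \<Longrightarrow> total_dim s Q K < total_dim s Q M \<Longrightarrow> ext_vanishes s Q K K"
    and \<theta>: "morphism s Q M M \<theta>"
  shows "rank_of M \<theta> = 0 \<or> rank_of M \<theta> = total_dim s Q M"
proof (rule ccontr)
  interpret P: vector_space_pair s s by unfold_locales
  have rM: "is_rep s Q M" using M by (simp add: indecomposable_def)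
  define bad where "bad f \<longleftrightarrow> morphism s Q M M f \<and> 0 < rank_of M f \<and> rank_of M f < total_dim s Q M" for f
  assume "\<not> ?thesis"
  then have "bad \<theta>" using \<theta> rank_of_eq_total_dim(1)[OF rM \<theta>] by (simp add: bad_def)
  then obtain f where bf: "bad f" and min: "\<And>g. bad g \<Longrightarrow> rank_of M f \<le> rank_of M g"
    using ex_has_least_nat[of bad \<theta> "rank_of M"] by blast
  have f: "morphism s Q M M f" "0 < rank_of M f" "rank_of M f < total_dim s Q M"
    using bf by (auto simp: bad_def)
  let ?I = "with_spaces M (\<lambda>v. f v ` rep_space M v)"
  let ?K = "with_spaces M (\<lambda>v. {x \<in> rep_space M v. f v x = 0})"
  note subI = image_subrep[OF rM rM f(1)] and subK = kernel_subrep[OF rM rM f(1)]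
  note rI = subrepD(1)[OF subI] and rK = subrepD(1)[OF subK]
  have ff: "morphism s Q M M (\<lambda>v x. f v (f v x))" by (rule morphism_compose[OF f(1) f(1)])
  let ?I2 = "with_spaces M (\<lambda>v. f v ` f v ` rep_space M v)"
  have im2: "(\<lambda>x. f v (f v x)) ` A = f v ` f v ` A" for v A by auto
  have sub2: "subrep s Q ?I2 M"
    using image_subrep[OF rM rM ff] by (simp add: im2)
  have r2: "rank_of M (\<lambda>v x. f v (f v x)) = total_dim s Q ?I2" by (simp add: rank_of_def im2)
  have sub2I: "subrep s Q ?I2 ?I"
    unfolding subrep_def using subrepD(1)[OF sub2] morphismD(2)[OF f(1)] by auto
  have sq: "rank_of M (\<lambda>v x. f v (f v x)) = 0"
  proof (rule ccontr)
    assume nz: "rank_of M (\<lambda>v x. f v (f v x)) \<noteq> 0"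
    have le: "total_dim s Q ?I2 \<le> rank_of M f"
      using total_dim_mono(1)[OF rI sub2I] by (simp add: rank_of_def)
    have "bad (\<lambda>v x. f v (f v x))" unfolding bad_def r2 using ff nz le f(3) r2 by auto
    then have "rank_of M f \<le> total_dim s Q ?I2" using min r2 by metis
    then have "total_dim s Q ?I2 = total_dim s Q ?I" using le by (simp add: rank_of_def)
    from total_dim_mono(2)[OF rI sub2I this] have "rank_of M f = 0 \<or> rank_of M f = total_dim s Q M"
      by (intro fitting_lemma[OF M f(1)]) auto
    then show False using f by simp
  qed
  have ff0: "f v (f v x) = 0" if "v \<in> verts Q" "x \<in> rep_space M v" for v x
    using sq rank_of_eq_0[OF rM rM ff] that by simp
  have fK: "f v x \<in> rep_space ?K v" if "v \<in> verts Q" "x \<in> rep_space M v" for v x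
    using ff0[OF that] morphismD(2)[OF f(1) that] by simp
  have KM: "total_dim s Q ?K < total_dim s Q M"
  proof -
    have "total_dim s Q ?K \<noteq> total_dim s Q M"
    proof
      assume "total_dim s Q ?K = total_dim s Q M"
      from total_dim_mono(2)[OF rM subK this] have "\<forall>v\<in>verts Q. \<forall>x\<in>rep_space M v. f v x = 0" by auto
      then show False using rank_of_eq_0[OF rM rM f(1)] f(2) by simp
    qed
    then show ?thesis using total_dim_mono(1)[OF rM subK] by simp
  qed
  obtain Ns where Ns: "is_direct_sum s Q ?K Ns" "\<forall>N\<in>set Ns. indecomposable s Q N"
    using exists_indecomposable_decomposition[OF rK] by blast
  obtain p where p: "\<And>i. i < length Ns \<Longrightarrow> morphism s Q ?K (Ns ! i) (p i)"
    "\<And>v x. v \<in> verts Q \<Longrightarrow> x \<in> rep_space ?K v \<Longrightarrow> x = (\<Sum>i<length Ns. p i v x)"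
    "\<And>i v x. i < length Ns \<Longrightarrow> v \<in> verts Q \<Longrightarrow> x \<in> rep_space (Ns ! i) v \<Longrightarrow> p i v x = x"
    by (rule direct_sum_projections[OF rK Ns(1)]) (rule that, assumption+)
  have fMK: "morphism s Q M ?K f"
    unfolding morphism_def
    using morphism_linear_on[OF f(1)] fK morphismD(3)[OF f(1)] by (auto simp: linear_map_on_iff)
  have "\<exists>j<length Ns. rank_of M (\<lambda>v x. p j v (f v x)) \<noteq> 0"
  proof (rule ccontr)
    assume "\<not> ?thesis"
    then have z: "p j v (f v x) = 0" if "j < length Ns" "v \<in> verts Q" "x \<in> rep_space M v" for j v x
    proof -
      have "is_rep s Q (Ns ! j)" using Ns(2) that(1) by (simp add: indecomposable_def)
      then show ?thesis
        using rank_of_eq_0[OF rM _ morphism_compose[OF fMK p(1)[OF that(1)]]] that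
          \<open>\<not> (\<exists>j<length Ns. rank_of M (\<lambda>v x. p j v (f v x)) \<noteq> 0)\<close> by simp
    qed
    have "f v x = 0" if "v \<in> verts Q" "x \<in> rep_space M v" for v x
      using p(2)[OF that(1) fK[OF that]] z[OF _ that] by simp
    then show False using rank_of_eq_0[OF rM rM f(1)] f(2) by simp
  qed
  then obtain j where j: "j < length Ns" "rank_of M (\<lambda>v x. p j v (f v x)) \<noteq> 0" by blast
  let ?N = "Ns ! j" let ?g = "\<lambda>v x. p j v (f v x)"
  have "indecomposable s Q ?N" using Ns(2) j(1) by simp
  then have N: "indecomposable s Q ?N" "is_rep s Q ?N" by (simp_all add: indecomposable_def)
  have subNK: "subrep s Q ?N ?K" using Ns(1) j(1) by (auto simp: is_direct_sum_def)
  have subNM: "subrep s Q ?N M" by (rule subrep_trans[OF subNK subK])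
  have NM: "total_dim s Q ?N < total_dim s Q M" using total_dim_mono(1)[OF rK subNK] KM by simp
  have gN: "morphism s Q M ?N ?g" by (rule morphism_compose[OF fMK p(1)[OF j(1)]])
  have gM: "morphism s Q M M ?g" using morphism_compose[OF gN subrep_inclusion[OF subNM]] .
  have dimI: "dim (?g v ` rep_space M v) \<le> dim (f v ` rep_space M v)"
    and linI: "linear_on s s (f v ` rep_space M v) (p j v)"
    and finI: "findim s (f v ` rep_space M v)"
    and img: "?g v ` rep_space M v = p j v ` f v ` rep_space M v" if v: "v \<in> verts Q" for v
  proof -
    show lin: "linear_on s s (f v ` rep_space M v) (p j v)"
      by (rule linear_on_subset[OF morphism_linear_on[OF p(1)[OF j(1)] v]]) (use fK[OF v] in auto)
    show fin: "findim s (f v ` rep_space M v)" using rep_findim[OF rI v] by simp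
    show im: "?g v ` rep_space M v = p j v ` f v ` rep_space M v" by auto
    show "dim (?g v ` rep_space M v) \<le> dim (f v ` rep_space M v)"
      unfolding im using P.rank_nullity_findim[OF fin lin] by simp
  qed
  have le: "rank_of M ?g \<le> rank_of M f"
    unfolding rank_of_def total_dim_def with_spaces_simps by (rule sum_mono[OF dimI])
  have "bad ?g" unfolding bad_def using gM j(2) le f(3) by simp
  then have eq: "rank_of M ?g = rank_of M f" using min le by (simp add: antisym)
  have inj: "inj_on (p j v) (f v ` rep_space M v)" if v: "v \<in> verts Q" for v
  proof (rule P.inj_on_of_dim_image[OF finI[OF v] linI[OF v]])
    have "dim (?g v ` rep_space M v) = dim (f v ` rep_space M v)"
      by (rule sum_mono_inv[OF eq[unfolded rank_of_def total_dim_def with_spaces_simps]])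
        (use v dimI finite_verts in auto)
    then show "dim (p j v ` f v ` rep_space M v) = dim (f v ` rep_space M v)" unfolding img[OF v] .
  qed
  have "subrep s Q ?I ?K" unfolding subrep_def using rI fK by auto
  then have pI: "morphism s Q ?I ?N (p j)"
    using morphism_compose[OF subrep_inclusion p(1)[OF j(1)]] by blast
  have vanI: "ext_vanishes s Q ?I ?N"
    by (rule ext_vanishes_embedded[OF rI N(2) N(2) pI _ small[OF N(1) NM]]) (use inj in simp)
  obtain R where R: "morphism s Q M ?N R"
    "\<And>v x. v \<in> verts Q \<Longrightarrow> x \<in> rep_space M v \<Longrightarrow> f v x = 0 \<Longrightarrow> R v x = p j v x"
    by (rule extend_morphism_from_kernel[OF rM rM N(2) f(1) p(1)[OF j(1)] vanI]) (rule that, assumption, blast)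
  have "retraction s Q M ?N R"
    unfolding retraction_def
  proof (intro conjI ballI subNM R(1))
    fix v x assume v: "v \<in> verts Q" and x: "x \<in> rep_space ?N v"
    then show "R v x = x" using subrepD(2)[OF subNK v x] R(2)[OF v] p(3)[OF j(1) v x] by simp
  qed
  then have "zero_rep Q ?N \<or> (\<forall>v\<in>verts Q. rep_space ?N v = rep_space M v)"
    by (rule indecomposable_retract[OF M])
  moreover have "\<not> zero_rep Q ?N" using N(1) by (simp add: indecomposable_def)
  ultimately have "total_dim s Q ?N = total_dim s Q M" by (simp add: total_dim_def)
  then show False using NM by simp
qed

lemma endomorphism_inverse:
  assumes M: "is_rep s Q M" and f: "f \<in> rep_hom s Q M M"
    and inj: "\<And>v. v \<in> verts Q \<Longrightarrow> inj_on (f v) (rep_space M v)"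
  obtains g where "g \<in> rep_hom s Q M M"
    "\<And>v x. v \<in> verts Q \<Longrightarrow> x \<in> rep_space M v \<Longrightarrow> g v (f v x) = x"
    "\<And>v x. v \<in> verts Q \<Longrightarrow> x \<in> rep_space M v \<Longrightarrow> f v (g v x) = x"
proof -
  interpret P: vector_space_pair s s by unfold_locales
  have mf: "morphism s Q M M f" using f by (simp add: rep_hom_def morphism_def)
  have surj: "f v ` rep_space M v = rep_space M v" if v: "v \<in> verts Q" for v
  proof (rule findim_subset(3)[OF rep_findim[OF M v]])
    show "subspace (f v ` rep_space M v)"
      by (rule P.subspace_image_on[OF rep_subspace[OF M v] morphism_linear_on[OF mf v]])
    show "f v ` rep_space M v \<subseteq> rep_space M v" using morphismD(2)[OF mf v] by auto
    show "dim (f v ` rep_space M v) = dim (rep_space M v)"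
      by (rule P.dim_image_inj[OF rep_findim[OF M v] morphism_linear_on[OF mf v] inj[OF v]])
  qed
  define g where "g = (\<lambda>v y. if v \<in> verts Q \<and> y \<in> rep_space M v then inv_into (rep_space M v) (f v) y else 0)"
  have gin: "g v y \<in> rep_space M v" and fg: "f v (g v y) = y" if "v \<in> verts Q" "y \<in> rep_space M v" for v y
    using that surj[OF that(1)] inv_into_into[of y "f v" "rep_space M v"] f_inv_into_f[of y "f v" "rep_space M v"]
    by (auto simp: g_def)
  have geq: "g v y = x" if "v \<in> verts Q" "x \<in> rep_space M v" "f v x = y" for v x y
    using inv_into_f_f[OF inj[OF that(1)] that(2)] that morphismD(2)[OF mf that(1,2)] by (simp add: g_def)
  have "linear_map_on s (rep_space M v) (rep_space M v) (g v)" if v: "v \<in> verts Q" for v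
    unfolding linear_map_on_def
  proof (intro conjI ballI allI funcsetI)
    show "g v x \<in> rep_space M v" if "x \<in> rep_space M v" for x using gin[OF v that] .
    show "g v (x + y) = g v x + g v y" if x: "x \<in> rep_space M v" and y: "y \<in> rep_space M v" for x y
      using morphism_linear_on[OF mf v] gin[OF v x] gin[OF v y] fg[OF v x] fg[OF v y]
      by (intro geq[OF v subspace_add[OF rep_subspace[OF M v] gin[OF v x] gin[OF v y]]])
        (simp add: linear_on_def)
    show "g v (s c x) = s c (g v x)" if x: "x \<in> rep_space M v" for c x
      using morphism_linear_on[OF mf v] gin[OF v x] fg[OF v x]
      by (intro geq[OF v subspace_scale[OF rep_subspace[OF M v] gin[OF v x]]])
        (simp add: linear_on_def)
  qed
  moreover have "g (head Q a) (rep_map M a x) = rep_map M a (g (tail Q a) x)"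
    if a: "a \<in> arcs Q" and x: "x \<in> rep_space M (tail Q a)" for a x
    using morphismD(3)[OF mf a gin[OF tail_in_verts[OF a] x]] fg[OF tail_in_verts[OF a] x]
    by (intro geq[OF head_in_verts[OF a] rep_map_in[OF M a gin[OF tail_in_verts[OF a] x]]]) simp
  ultimately have "g \<in> rep_hom s Q M M" by (auto simp: rep_hom_def g_def)
  then show thesis using that fg geq by blast
qed

definition brick :: "('v, 'a, 'b) quiver_rep \<Rightarrow> bool" where
  "brick M \<longleftrightarrow> is_rep s Q M \<and> \<not> zero_rep Q M \<and>
     (\<forall>f\<in>rep_hom s Q M M. f \<noteq> 0 \<longrightarrow> (\<forall>v\<in>verts Q. inj_on (f v) (rep_space M v)))"

definition unit_hom :: "('v, 'a, 'b) quiver_rep \<Rightarrow> 'v \<Rightarrow> 'b \<Rightarrow> 'b" where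
  "unit_hom M = (\<lambda>v x. if v \<in> verts Q \<and> x \<in> rep_space M v then x else 0)"

lemma unit_hom_in:
  assumes M: "is_rep s Q M" shows "unit_hom M \<in> rep_hom s Q M M"
  using subspace_add[OF rep_subspace[OF M]] subspace_scale[OF rep_subspace[OF M]] rep_map_in[OF M]
  by (auto simp: rep_hom_def unit_hom_def linear_map_on_def)

lemma rep_hom_compose:
  assumes "f \<in> rep_hom s Q L M" "g \<in> rep_hom s Q M N" "is_rep s Q M"
  shows "(\<lambda>v. g v \<circ> f v) \<in> rep_hom s Q L N"
proof -
  have f: "morphism s Q L M f" and g: "morphism s Q M N g" using assms by (auto simp: rep_hom_def morphism_def)
  have "g v 0 = 0" for v
    using assms(2) morphism_0[OF assms(3) g, of v] by (cases "v \<in> verts Q") (auto simp: rep_hom_def)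
  then show ?thesis using morphism_compose[OF f g] assms(1) by (auto simp: rep_hom_def morphism_def o_def)
qed

text \<open>The endomorphism ring is a division ring over which each space of the representation is a vector space.
  Starting from zero, a stable subspace \<open>W\<close> grows by the orbit of a vector outside \<open>W\<close>: the orbit meets \<open>W\<close>
  only in zero, since endomorphisms are invertible, and has the dimension of the endomorphism ring.\<close>

lemma brick_dim_dvd:
  assumes br: "brick M" and v: "v \<in> verts Q"
  shows "hom_dim s Q M M dvd dim (rep_space M v)"
proof -
  let ?s = "fun_scale (fun_scale s) :: 'k \<Rightarrow> ('v \<Rightarrow> 'b \<Rightarrow> 'b) \<Rightarrow> _"
  interpret F: vector_space ?s by (intro vector_space_fun_scale) unfold_locales
  interpret P: vector_space_pair ?s s by unfold_locales
  have M: "is_rep s Q M" using br by (simp add: brick_def)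
  let ?E = "rep_hom s Q M M" and ?V = "rep_space M v"
  have E: "findim ?s ?E" by (rule euler_form_le_hom_dim(1)[OF M M])
  have hd: "hom_dim s Q M M = F.dim ?E" by (simp add: hom_dim_def fun_scale_def[abs_def])
  have lin: "linear_on ?s s ?E (\<lambda>f. f v x)" for x by (simp add: linear_on_def fun_scale_def)
  have E0: "f v 0 = 0" if "f \<in> ?E" for f
    using that morphism_0[OF M _ v, of M f] by (simp add: rep_hom_def morphism_def)
  have Ein: "f v x \<in> ?V" if "f \<in> ?E" "x \<in> ?V" for f x
    using that v by (auto simp: rep_hom_def linear_map_on_def)
  have Einj: "inj_on (f v) ?V" if "f \<in> ?E" "f \<noteq> 0" for f using br that v by (simp add: brick_def)
  have orbit: "dim ((\<lambda>f. f v x) ` ?E) = F.dim ?E" "findim s ((\<lambda>f. f v x) ` ?E)"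
    if x: "x \<in> ?V" "x \<noteq> 0" for x
  proof -
    have "inj_on (\<lambda>f. f v x) ?E"
      unfolding P.linear_on_inj_iff[OF F.findim_subspace[OF E] lin]
    proof (intro ballI impI)
      fix f assume f: "f \<in> ?E" "f v x = 0"
      show "f = 0"
      proof (rule ccontr)
        assume "f \<noteq> 0"
        then have "x = 0"
          using inj_onD[OF Einj[OF f(1)], of x 0] f E0[OF f(1)] x subspace_0[OF rep_subspace[OF M v]] by simp
        then show False using x by simp
      qed
    qed
    then show "dim ((\<lambda>f. f v x) ` ?E) = F.dim ?E" by (rule P.dim_image_inj[OF E lin])
    show "findim s ((\<lambda>f. f v x) ` ?E)" by (rule P.findim_image[OF E lin])
  qed
  have "F.dim ?E dvd dim ?V - dim W"
    if "subspace W" "W \<subseteq> ?V" "\<And>f x. f \<in> ?E \<Longrightarrow> x \<in> W \<Longrightarrow> f v x \<in> W" for W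
    using that
  proof (induction "dim ?V - dim W" arbitrary: W rule: less_induct)
    case less
    note W = less.prems
    note fW = findim_subset[OF rep_findim[OF M v] W(1,2)]
    show ?case
    proof (cases "W = ?V")
      case False
      then obtain x where x: "x \<in> ?V" "x \<notin> W" using W(2) by blast
      have xn0: "x \<noteq> 0" using x(2) subspace_0[OF W(1)] by auto
      let ?D = "(\<lambda>f. f v x) ` ?E"
      let ?U = "{a + b | a b. a \<in> W \<and> b \<in> ?D}"
      have disj: "a = 0 \<and> b = 0" if ab: "a \<in> W" "b \<in> ?D" "a + b = 0" for a b
      proof -
        obtain f where f: "f \<in> ?E" "b = f v x" using ab by blast
        have bW: "b \<in> W" using ab subspace_neg[OF W(1)] by (metis add.inverse_unique)
        have "f = 0"
        proof (rule ccontr)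
          assume "f \<noteq> 0"
          then obtain g where "g \<in> ?E" "\<And>v x. v \<in> verts Q \<Longrightarrow> x \<in> rep_space M v \<Longrightarrow> g v (f v x) = x"
            using endomorphism_inverse[OF M f(1)] br f(1) unfolding brick_def by metis
          then have "x \<in> W" using W(3)[of g b] bW f(2) v x(1) by auto
          then show False using x(2) by simp
        qed
        then show ?thesis using f ab by simp
      qed
      have ds: "direct_sum_on 2 (\<lambda>i. [W, ?D] ! i) ?U"
        unfolding direct_sum_on_pair using disj by blast
      have dU: "dim ?U = (\<Sum>i\<in>{..<2::nat}. dim ([W, ?D] ! i))"
      proof (rule dim_direct_sum(2)[OF vector_space_axioms])
        show "findim s ([W, ?D] ! i)" if "i \<in> {..<2}" for i
          using that fW(1) orbit(2)[OF x(1) xn0] by (auto simp: numeral_2_eq_2 less_Suc_eq)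
        show "\<forall>i\<in>{..<2}. f i = 0" if "\<And>i. i \<in> {..<2} \<Longrightarrow> f i \<in> [W, ?D] ! i" "(\<Sum>i\<in>{..<2}. f i) = 0" for f
          using that ds unfolding direct_sum_on_def by simp
        show "?U = {\<Sum>i\<in>{..<2}. f i | f. \<forall>i\<in>{..<2}. f i \<in> [W, ?D] ! i}"
          using conjunct1[OF ds[unfolded direct_sum_on_def]] by (simp only: Ball_def lessThan_iff)
      qed simp
      then have dU: "dim ?U = dim W + F.dim ?E" using orbit(1)[OF x(1) xn0] by (simp add: numeral_2_eq_2)
      have sU: "subspace ?U" by (rule subspace_sums[OF W(1) findim_subspace[OF orbit(2)[OF x(1) xn0]]])
      have UV: "?U \<subseteq> ?V" using W(2) Ein x(1) subspace_add[OF rep_subspace[OF M v]] by auto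
      have stab: "f v u \<in> ?U" if f: "f \<in> ?E" and u: "u \<in> ?U" for f u
      proof -
        obtain a g where ag: "a \<in> W" "g \<in> ?E" "u = a + g v x" using u by blast
        have "f v u = f v a + f v (g v x)"
          using f v W(2) ag Ein[OF ag(2) x(1)] by (auto simp: rep_hom_def linear_map_on_def)
        moreover have "f v (g v x) \<in> ?D"
          using imageI[OF rep_hom_compose[OF ag(2) f M], of "\<lambda>f. f v x"] by simp
        ultimately show ?thesis using W(3)[OF f ag(1)] by blast
      qed
      have "unit_hom M v x = x" using x v by (simp add: unit_hom_def)
      then have "unit_hom M \<noteq> 0" using xn0 by (metis zero_fun_apply)
      then have "\<exists>f\<in>?E. f \<noteq> 0" using unit_hom_in[OF M] by blast
      then have pos: "F.dim ?E > 0" using F.findim_dim_0[OF E] by auto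
      have le: "dim ?U \<le> dim ?V" by (rule findim_subset(2)[OF rep_findim[OF M v] sU UV])
      have "F.dim ?E dvd dim ?V - dim ?U"
      proof (rule less.hyps[OF _ sU UV])
        have "dim ?U \<noteq> 0" "dim W < dim ?U" using dU pos by auto
        then show "dim ?V - dim ?U < dim ?V - dim W" using le by linarith
        show "f v u \<in> ?U" if "f \<in> ?E" "u \<in> ?U" for f u by (rule stab[OF that])
      qed
      moreover have "dim ?V - dim W = (dim ?V - dim ?U) + F.dim ?E" using dU le by simp
      ultimately show ?thesis by simp
    qed simp
  qed
  from this[of "{0}"] show ?thesis
    using subspace_0[OF rep_subspace[OF M v]] E0 dim_0 hd by (simp add: subspace_single_0)
qed

text \<open>Let \<open>e\<close> be the dimension of the endomorphism ring of an indecomposable representation. Since it divides every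
  entry of the dimension vector, the Tits form there is \<open>e\<^sup>2\<close> times a positive integer. It is also at most
  \<open>e\<close>, being \<open>e\<close> minus the dimension of the space of self-extensions. So \<open>e = 1\<close> and there are no
  self-extensions.\<close>

theorem indecomposable_exceptional:
  assumes pos: "positive_definite Q" and M: "indecomposable s Q M"
  shows "brick M" and "hom_dim s Q M M = 1" and "ext_vanishes s Q M M"
    and "tits_form Q (dim_vector s Q M) = 1"
proof -
  have "brick M \<and> hom_dim s Q M M = 1 \<and> ext_vanishes s Q M M \<and> tits_form Q (dim_vector s Q M) = 1"
    using M
  proof (induction "total_dim s Q M" arbitrary: M rule: less_induct)
    case less
    have rM: "is_rep s Q M" "\<not> zero_rep Q M" using less.prems by (auto simp: indecomposable_def)
    have br: "brick M"
      unfolding brick_def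
    proof (intro conjI rM ballI impI)
      fix f v assume f: "f \<in> rep_hom s Q M M" "f \<noteq> 0" and v: "v \<in> verts Q"
      have mf: "morphism s Q M M f" using f by (simp add: rep_hom_def morphism_def)
      have "rank_of M f = 0 \<or> rank_of M f = total_dim s Q M"
        by (rule endomorphism_injective_or_zero[OF less.prems _ mf]) (use less.hyps in blast)
      moreover have "rank_of M f \<noteq> 0"
      proof
        assume "rank_of M f = 0"
        then have "f = 0" using rank_of_eq_0[OF rM(1) rM(1) mf] f(1) by (auto simp: rep_hom_def fun_eq_iff)
        then show False using f(2) by simp
      qed
      ultimately show "inj_on (f v) (rep_space M v)" using rank_of_eq_total_dim(2)[OF rM(1) mf] v by blast
    qed
    let ?e = "hom_dim s Q M M" and ?d = "dim_vector s Q M"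
    define b where "b v = ?d v div int ?e" for v
    have d: "?d v = int ?e * b v" if "v \<in> verts Q" for v
      using brick_dim_dvd[OF br that] that by (simp add: b_def dim_vector_def)
    have t: "tits_form Q ?d = (int ?e)\<^sup>2 * tits_form Q b"
      unfolding tits_form_def right_diff_distrib sum_distrib_left
      by (intro arg_cong2[where f = "(-)"] sum.cong)
        (auto simp: d power_mult_distrib power2_eq_square)
    have "\<exists>v\<in>verts Q. ?d v \<noteq> 0"
      using rM zero_rep_iff_total_dim[OF rM(1)] finite_verts by (auto simp: total_dim_def dim_vector_def)
    then have tpos: "tits_form Q ?d > 0" using pos by (auto simp: positive_definite_def)
    have tle: "tits_form Q ?d \<le> int ?e"
      using euler_form_le_hom_dim(2)[OF rM(1) rM(1)] by (simp add: tits_form_eq_euler_form)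
    have e1: "int ?e \<ge> 1" using tpos tle by linarith
    have b1: "tits_form Q b \<ge> 1" using tpos t e1 by (simp add: zero_less_mult_iff)
    have "int ?e * int ?e \<le> (int ?e)\<^sup>2 * tits_form Q b"
      using mult_left_mono[OF b1, of "(int ?e)\<^sup>2"] by (simp add: power2_eq_square)
    then have "int ?e * int ?e \<le> int ?e * 1" using t tle by simp
    then have "int ?e \<le> 1" using e1 by (metis mult_le_cancel_left_pos zero_less_one order_less_le_trans)
    then have e: "?e = 1" using e1 by simp
    then have "tits_form Q ?d = 1" using tpos tle by simp
    moreover from this have "ext_vanishes s Q M M"
      using euler_form_le_hom_dim(3)[OF rM(1) rM(1)] e by (simp add: tits_form_eq_euler_form)
    ultimately show ?case using br e by simp
  qed
  then show "brick M" "hom_dim s Q M M = 1" "ext_vanishes s Q M M"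
    "tits_form Q (dim_vector s Q M) = 1" by auto
qed

lemma brick_End_division_ring:
  assumes br: "brick M"
  shows "division_ring (End_ring s Q M)"
proof -
  have M: "is_rep s Q M" "\<not> zero_rep Q M" using br by (auto simp: brick_def)
  let ?E = "rep_hom s Q M M" and ?R = "End_ring s Q M"
  interpret F: vector_space "fun_scale (fun_scale s) :: 'k \<Rightarrow> ('v \<Rightarrow> 'b \<Rightarrow> 'b) \<Rightarrow> _"
    by (intro vector_space_fun_scale) unfold_locales
  have sub: "F.subspace ?E" by (rule F.findim_subspace[OF euler_form_le_hom_dim(1)[OF M(1) M(1)]])
  have R: "carrier ?R = ?E" "\<And>f g. f \<otimes>\<^bsub>?R\<^esub> g = (\<lambda>v. f v \<circ> g v)" "\<one>\<^bsub>?R\<^esub> = unit_hom M"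
    "\<zero>\<^bsub>?R\<^esub> = 0" "\<And>f g. f \<oplus>\<^bsub>?R\<^esub> g = f + g"
    by (simp_all add: End_ring_def unit_hom_def)
  have out: "f v x = 0" if "f \<in> ?E" "v \<notin> verts Q \<or> x \<notin> rep_space M v" for f v x
    using that by (simp add: rep_hom_def)
  have mem: "f v x \<in> rep_space M v" if "f \<in> ?E" "v \<in> verts Q" "x \<in> rep_space M v" for f v x
    using that by (auto simp: rep_hom_def linear_map_on_def)
  have f0: "f v 0 = 0" if "f \<in> ?E" for f v
    using that morphism_0[OF M(1), of M f v] by (cases "v \<in> verts Q") (auto simp: rep_hom_def morphism_def)
  have fadd: "f v (x + y) = f v x + f v y" if "f \<in> ?E" "v \<in> verts Q" "x \<in> rep_space M v" "y \<in> rep_space M v" for f v x y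
    using that by (auto simp: rep_hom_def linear_map_on_def)
  have unitl: "(\<lambda>v. unit_hom M v \<circ> f v) = f" if f: "f \<in> ?E" for f
    using out[OF f] mem[OF f] by (force simp: unit_hom_def fun_eq_iff)
  have unitr: "(\<lambda>v. f v \<circ> unit_hom M v) = f" if f: "f \<in> ?E" for f
    using out[OF f] f0[OF f] by (force simp: unit_hom_def fun_eq_iff)
  have ring: "ring ?R"
  proof (rule ringI)
    show "abelian_group ?R"
    proof (rule abelian_groupI)
      fix f assume "f \<in> carrier ?R"
      then show "\<exists>g\<in>carrier ?R. g \<oplus>\<^bsub>?R\<^esub> f = \<zero>\<^bsub>?R\<^esub>"
        using F.subspace_neg[OF sub] unfolding R by (intro bexI[of _ "- f"]) auto
    qed (auto simp: R add.assoc add.commute F.subspace_add[OF sub] F.subspace_0[OF sub])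
    show "monoid ?R"
      by (rule monoidI) (auto simp: R unit_hom_in[OF M(1)] unitl unitr o_assoc intro: rep_hom_compose[OF _ _ M(1)])
    fix f g h assume fgh: "f \<in> carrier ?R" "g \<in> carrier ?R" "h \<in> carrier ?R"
    show "(f \<oplus>\<^bsub>?R\<^esub> g) \<otimes>\<^bsub>?R\<^esub> h = f \<otimes>\<^bsub>?R\<^esub> h \<oplus>\<^bsub>?R\<^esub> g \<otimes>\<^bsub>?R\<^esub> h"
      by (simp add: R fun_eq_iff)
    have "h v ((f + g) v x) = h v (f v x) + h v (g v x)" for v x
    proof (cases "v \<in> verts Q \<and> x \<in> rep_space M v")
      case True
      then show ?thesis using fadd mem fgh by (simp add: R)
    next
      case False
      then show ?thesis using out[of f v x] out[of g v x] f0[of h v] fgh by (auto simp: R)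
    qed
    then show "h \<otimes>\<^bsub>?R\<^esub> (f \<oplus>\<^bsub>?R\<^esub> g) = h \<otimes>\<^bsub>?R\<^esub> f \<oplus>\<^bsub>?R\<^esub> h \<otimes>\<^bsub>?R\<^esub> g"
      by (simp add: R fun_eq_iff)
  qed
  have one: "unit_hom M \<noteq> 0"
  proof
    assume z: "unit_hom M = 0"
    have "x = 0" if "v \<in> verts Q" "x \<in> rep_space M v" for v x
      using fun_cong[OF fun_cong[OF z, of v], of x] that by (simp add: unit_hom_def)
    then have "zero_rep Q M" using subspace_0[OF rep_subspace[OF M(1)]] by (auto simp: zero_rep_def)
    then show False using M by simp
  qed
  have "Units ?R = carrier ?R - {\<zero>\<^bsub>?R\<^esub>}"
  proof (intro equalityI subsetI)
    fix f assume "f \<in> Units ?R"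
    then obtain g where g: "f \<in> ?E" "g \<in> ?E" "(\<lambda>v. g v \<circ> f v) = unit_hom M" by (auto simp: Units_def R)
    have "f \<noteq> 0"
    proof
      assume "f = 0"
      then have "unit_hom M = 0" using g(3) f0[OF g(2)] by (auto simp: fun_eq_iff)
      then show False using one by simp
    qed
    then show "f \<in> carrier ?R - {\<zero>\<^bsub>?R\<^esub>}" using g by (simp add: R)
  next
    fix f assume "f \<in> carrier ?R - {\<zero>\<^bsub>?R\<^esub>}"
    then have f: "f \<in> ?E" "f \<noteq> 0" by (auto simp: R)
    obtain g where g: "g \<in> ?E" "\<And>v x. v \<in> verts Q \<Longrightarrow> x \<in> rep_space M v \<Longrightarrow> g v (f v x) = x"
      "\<And>v x. v \<in> verts Q \<Longrightarrow> x \<in> rep_space M v \<Longrightarrow> f v (g v x) = x"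
      by (rule endomorphism_inverse[OF M(1) f(1)]) (use br f in \<open>auto simp: brick_def\<close>)
    have "(\<lambda>v. g v \<circ> f v) = unit_hom M" "(\<lambda>v. f v \<circ> g v) = unit_hom M"
      using g out[OF f(1)] out[OF g(1)] f0[OF f(1)] f0[OF g(1)] by (force simp: unit_hom_def fun_eq_iff)+
    then show "f \<in> Units ?R" using f g unfolding Units_def R by auto
  qed
  then show ?thesis using ring one unfolding division_ring_def R by simp
qed

end


section \<open>The maximal root\<close>

definition polar_form :: "('v, 'a) pre_digraph \<Rightarrow> ('v \<Rightarrow> 'c::comm_ring_1) \<Rightarrow> ('v \<Rightarrow> 'c) \<Rightarrow> 'c" where
  "polar_form Q d e = euler_form Q d e + euler_form Q e d"

definition unit_vector :: "'v \<Rightarrow> 'v \<Rightarrow> int" where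
  "unit_vector x v = (if v = x then 1 else 0)"

lemma euler_form_add_left: "euler_form Q (\<lambda>v. d v + e v) f = euler_form Q d f + euler_form Q e f"
  by (simp add: euler_form_def algebra_simps sum.distrib)

lemma euler_form_add_right: "euler_form Q f (\<lambda>v. d v + e v) = euler_form Q f d + euler_form Q f e"
  by (simp add: euler_form_def algebra_simps sum.distrib)

lemma euler_form_scale_left: "euler_form Q (\<lambda>v. c * d v) f = c * euler_form Q d f"
  by (simp add: euler_form_def sum_distrib_left right_diff_distrib mult.assoc)

lemma euler_form_scale_right: "euler_form Q f (\<lambda>v. c * d v) = c * euler_form Q f d"
  by (simp add: euler_form_def sum_distrib_left right_diff_distrib mult.left_commute)

lemma euler_form_diff_left: "euler_form Q (\<lambda>v. d v - e v) f = euler_form Q d f - euler_form Q e f"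
  by (simp add: euler_form_def algebra_simps sum_subtractf)

lemma euler_form_diff_right: "euler_form Q f (\<lambda>v. d v - e v) = euler_form Q f d - euler_form Q f e"
  by (simp add: euler_form_def algebra_simps sum_subtractf)

lemma euler_form_sum_left: "euler_form Q (\<lambda>v. \<Sum>i\<in>I. d i v) f = (\<Sum>i\<in>I. euler_form Q (d i) f)"
  unfolding euler_form_def sum_distrib_right sum_subtractf
  by (rule arg_cong2[where f = "(-)"]) (rule sum.swap)+

lemma euler_form_sum_right: "euler_form Q f (\<lambda>v. \<Sum>i\<in>I. d i v) = (\<Sum>i\<in>I. euler_form Q f (d i))"
  unfolding euler_form_def sum_distrib_left sum_subtractf
  by (rule arg_cong2[where f = "(-)"]) (rule sum.swap)+

lemmas polar_form_simps =
  polar_form_def euler_form_add_left euler_form_add_right euler_form_diff_left euler_form_diff_right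
  euler_form_scale_left euler_form_scale_right

lemma polar_form_sym: "polar_form Q d e = polar_form Q e d"
  by (simp add: polar_form_def)

lemma polar_form_sum_left: "polar_form Q (\<lambda>v. \<Sum>i\<in>I. d i v) f = (\<Sum>i\<in>I. polar_form Q (d i) f)"
  by (simp add: polar_form_def euler_form_sum_left euler_form_sum_right sum.distrib)

lemma polar_form_self: "polar_form Q d d = 2 * tits_form Q d"
  by (simp add: polar_form_def tits_form_eq_euler_form)

lemma tits_form_diff: "tits_form Q (\<lambda>v. d v - e v) = tits_form Q d - polar_form Q d e + tits_form Q e"
  by (simp add: tits_form_eq_euler_form polar_form_simps)

lemma tits_form_add: "tits_form Q (\<lambda>v. d v + e v) = tits_form Q d + polar_form Q d e + tits_form Q e"
  by (simp add: tits_form_eq_euler_form polar_form_simps)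

lemma tits_form_scale: "tits_form Q (\<lambda>v. c * d v) = c\<^sup>2 * tits_form Q d"
  by (simp add: tits_form_eq_euler_form polar_form_simps power2_eq_square mult.assoc)

lemma polar_form_scale_right: "polar_form Q d (\<lambda>v. c * e v) = c * polar_form Q d e"
  by (simp add: polar_form_simps distrib_left)

lemma polar_form_alt:
  "polar_form Q d e = (\<Sum>v\<in>verts Q. 2 * (d v * e v)) -
    (\<Sum>a\<in>arcs Q. d (tail Q a) * e (head Q a) + e (tail Q a) * d (head Q a))"
proof -
  have "(\<Sum>v\<in>verts Q. e v * d v) = (\<Sum>v\<in>verts Q. d v * e v)" by (intro sum.cong) auto
  moreover have "(\<Sum>v\<in>verts Q. 2 * (d v * e v)) = (\<Sum>v\<in>verts Q. d v * e v) + (\<Sum>v\<in>verts Q. d v * e v)"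
    by (simp only: mult_2 sum.distrib)
  ultimately show ?thesis by (simp add: polar_form_def euler_form_def sum.distrib)
qed

lemma euler_form_cong:
  assumes "wf_digraph Q" "\<And>v. v \<in> verts Q \<Longrightarrow> d v = d' v" "\<And>v. v \<in> verts Q \<Longrightarrow> e v = e' v"
  shows "euler_form Q d e = euler_form Q d' e'"
proof -
  interpret wf_digraph Q by fact
  show ?thesis unfolding euler_form_def using assms(2,3) by (auto intro!: arg_cong2[where f = "(-)"] sum.cong)
qed

lemma tits_form_cong:
  assumes "wf_digraph Q" "\<And>v. v \<in> verts Q \<Longrightarrow> d v = e v"
  shows "tits_form Q d = tits_form Q e"
  using euler_form_cong[OF assms assms(2)] by (simp add: tits_form_eq_euler_form)

lemma positive_definite_nonneg:
  assumes "wf_digraph Q" "positive_definite Q" shows "tits_form Q d \<ge> 0"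
proof (cases "\<exists>v\<in>verts Q. d v \<noteq> 0")
  case False
  then have "tits_form Q d = tits_form Q (\<lambda>_. 0)" by (intro tits_form_cong[OF assms(1)]) auto
  then show ?thesis by (simp add: tits_form_def)
qed (use assms(2) in \<open>auto simp: positive_definite_def less_imp_le\<close>)

lemma tits_form_unit_le:
  assumes "fin_digraph Q" "x \<in> verts Q" shows "tits_form Q (unit_vector x) \<le> 1"
proof -
  interpret fin_digraph Q by fact
  have "(\<Sum>v\<in>verts Q. (unit_vector x v)\<^sup>2) = 1"
    using assms(2) by (simp add: unit_vector_def if_distrib[of "\<lambda>x. x\<^sup>2"] sum.delta cong: if_cong)
  moreover have "0 \<le> (\<Sum>a\<in>arcs Q. unit_vector x (tail Q a) * unit_vector x (head Q a))"
    by (intro sum_nonneg) (simp add: unit_vector_def)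
  ultimately show ?thesis by (simp add: tits_form_def)
qed

lemma tits_form_unit:
  assumes "fin_digraph Q" "positive_definite Q" "x \<in> verts Q" shows "tits_form Q (unit_vector x) = 1"
proof -
  have "tits_form Q (unit_vector x) > 0"
    using assms(2,3) unfolding positive_definite_def by (auto simp: unit_vector_def)
  then show ?thesis using tits_form_unit_le[OF assms(1,3)] by simp
qed

lemma polar_form_disjoint_le:
  fixes d e :: "'v \<Rightarrow> int"
  assumes "\<And>v. d v \<ge> 0" "\<And>v. e v \<ge> 0" "\<And>v. d v * e v = 0"
  shows "polar_form Q d e \<le> 0"
proof -
  have "0 \<le> (\<Sum>a\<in>arcs Q. d (tail Q a) * e (head Q a) + e (tail Q a) * d (head Q a))"
    using assms(1,2) by (intro sum_nonneg) simp
  moreover have "(\<Sum>v\<in>verts Q. 2 * (d v * e v)) = 0" by (simp only: assms(3)) simp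
  ultimately show ?thesis unfolding polar_form_alt by linarith
qed

lemma polar_form_unit_off_diagonal: "x \<noteq> z \<Longrightarrow> polar_form Q (unit_vector x) (unit_vector z) \<le> 0"
  by (intro polar_form_disjoint_le) (auto simp: unit_vector_def)

lemma polar_form_unit_neighbor:
  assumes "finite (arcs Q)" "x \<noteq> z" "x \<in> neighbors Q z"
  shows "polar_form Q (unit_vector x) (unit_vector z) \<le> -1"
proof -
  let ?t = "\<lambda>a. unit_vector x (tail Q a) * unit_vector z (head Q a) + unit_vector z (tail Q a) * unit_vector x (head Q a)"
  obtain a where a: "a \<in> arcs Q" "tail Q a = x \<and> head Q a = z \<or> tail Q a = z \<and> head Q a = x"
    using assms(3) by (auto simp: neighbors_def arcs_ends_def arc_to_ends_def)
  have "1 \<le> ?t a" using a by (auto simp: unit_vector_def)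
  also have "?t a \<le> (\<Sum>a\<in>arcs Q. ?t a)"
    by (rule member_le_sum[OF a(1)]) (auto simp: unit_vector_def assms(1))
  moreover have "(\<Sum>v\<in>verts Q. 2 * (unit_vector x v * unit_vector z v)) = 0"
    using assms(2) by (intro sum.neutral) (auto simp: unit_vector_def)
  ultimately show ?thesis unfolding polar_form_alt by linarith
qed

lemma polar_form_unit_far:
  assumes "d y = 0" "\<And>x. x \<in> neighbors Q y \<Longrightarrow> d x = 0"
  shows "polar_form Q (unit_vector y) d = 0"
proof -
  have nb: "d x = 0" if "a \<in> arcs Q" "tail Q a = x \<and> head Q a = y \<or> tail Q a = y \<and> head Q a = x" for a x
    using that assms(2)[of x] by (auto simp: neighbors_def arcs_ends_def arc_to_ends_def)
  have "(\<Sum>v\<in>verts Q. 2 * (unit_vector y v * d v)) = 0"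
    using assms(1) by (intro sum.neutral) (auto simp: unit_vector_def)
  moreover have "(\<Sum>a\<in>arcs Q. unit_vector y (tail Q a) * d (head Q a) + d (tail Q a) * unit_vector y (head Q a)) = 0"
    by (intro sum.neutral) (auto simp: unit_vector_def nb)
  ultimately show ?thesis unfolding polar_form_alt by simp
qed

lemma polar_form_unit_expand:
  assumes "fin_digraph Q"
  shows "polar_form Q d e = (\<Sum>x\<in>verts Q. d x * polar_form Q (unit_vector x) e)"
proof -
  interpret fin_digraph Q by fact
  have wf: "wf_digraph Q" by unfold_locales
  have d: "d v = (\<Sum>x\<in>verts Q. d x * unit_vector x v)" if "v \<in> verts Q" for v
    using that by (simp add: unit_vector_def if_distrib sum.delta cong: if_cong)
  have "polar_form Q d e = polar_form Q (\<lambda>v. \<Sum>x\<in>verts Q. d x * unit_vector x v) e"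
    unfolding polar_form_def
    by (rule arg_cong2[where f = "(+)"]; rule euler_form_cong[OF wf]) (use d in auto)
  then show ?thesis
    by (simp add: polar_form_sum_left polar_form_sym[of Q _ e] polar_form_scale_right)
qed

text \<open>The condition on \<open>polar_form\<close> says that \<open>q\<close> is orthogonal to the unit vectors of all vertices except
  \<open>y\<close>, where the product is 1. It is stated for real vectors because positive definiteness is derived by inserting
  fractions. The last condition is connectedness.\<close>

definition root_certificate :: "('v, 'a) pre_digraph \<Rightarrow> 'v \<Rightarrow> ('v \<Rightarrow> int) \<Rightarrow> bool" where
  "root_certificate Q y q \<longleftrightarrow> fin_digraph Q \<and> y \<in> verts Q \<and>
     (\<forall>v\<in>verts Q. q v \<ge> 1) \<and> (\<forall>v. v \<notin> verts Q \<longrightarrow> q v = 0) \<and> q y = 2 \<and>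
     (\<forall>u::'v \<Rightarrow> real. polar_form Q (\<lambda>v. of_int (q v)) u = u y) \<and>
     (\<forall>S. y \<in> S \<and> (\<forall>a\<in>arcs Q. tail Q a \<in> S \<longleftrightarrow> head Q a \<in> S) \<longrightarrow> verts Q \<subseteq> S)"

lemma root_certificate_polar:
  assumes "root_certificate Q y q" shows "polar_form Q q u = (u y :: int)"
proof -
  have "real_of_int (polar_form Q q u) = polar_form Q (\<lambda>v. of_int (q v)) (\<lambda>v. of_int (u v))"
    by (simp add: polar_form_alt)
  then show ?thesis using assms by (simp add: root_certificate_def)
qed

text \<open>Inserting \<open>u\<^sub>v = d\<^sub>v\<^sup>2 / q\<^sub>v\<close> in the certificate writes twice the Tits form at \<open>d\<close> as
  \<open>d\<^sub>y\<^sup>2 / 2\<close> plus the sum over the arrows \<open>v \<rightarrow> w\<close> of \<open>q\<^sub>v q\<^sub>w (d\<^sub>w / q\<^sub>w - d\<^sub>v / q\<^sub>v)\<^sup>2\<close>. If it is zero, then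
  \<open>d\<close> vanishes at \<open>y\<close> and, by connectedness, everywhere.\<close>

lemma root_certificate_positive_definite:
  assumes q: "root_certificate Q y q" shows "positive_definite Q"
proof -
  interpret fin_digraph Q using q by (simp add: root_certificate_def)
  let ?r = "\<lambda>v. real_of_int (q v)"
  have rpos: "?r v > 0" if "v \<in> verts Q" for v using q that by (force simp: root_certificate_def)
  show ?thesis unfolding positive_definite_def
  proof (intro allI impI)
    fix d assume "\<exists>v\<in>verts Q. d v \<noteq> (0::int)"
    then obtain w where w: "w \<in> verts Q" "d w \<noteq> 0" by blast
    let ?D = "\<lambda>v. real_of_int (d v)"
    let ?u = "\<lambda>v. (?D v)\<^sup>2 / ?r v"
    let ?sq = "\<lambda>a. ?r (tail Q a) * ?r (head Q a) * (?D (head Q a) / ?r (head Q a) - ?D (tail Q a) / ?r (tail Q a))\<^sup>2"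
    have P: "polar_form Q ?r ?u = (?D y)\<^sup>2 / 2" using q by (simp add: root_certificate_def)
    have V: "(\<Sum>v\<in>verts Q. 2 * (?r v * ?u v)) = 2 * (\<Sum>v\<in>verts Q. (?D v)\<^sup>2)"
      unfolding sum_distrib_left by (rule sum.cong) (use rpos in force)+
    have A: "?r (tail Q a) * ?u (head Q a) + ?u (tail Q a) * ?r (head Q a) =
        ?sq a + 2 * (?D (tail Q a) * ?D (head Q a))" if "a \<in> arcs Q" for a
    proof -
      have alg: "r * (D\<^sup>2 / t) + E\<^sup>2 / r * t = r * t * (D / t - E / r)\<^sup>2 + 2 * (E * D)"
        if "r \<noteq> 0" "t \<noteq> 0" for r t D E :: real
        using that by (simp add: field_simps power2_eq_square)
      show ?thesis
        by (rule alg) (use rpos[OF tail_in_verts[OF that]] rpos[OF head_in_verts[OF that]] in auto)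
    qed
    have "(\<Sum>a\<in>arcs Q. ?r (tail Q a) * ?u (head Q a) + ?u (tail Q a) * ?r (head Q a)) =
       (\<Sum>a\<in>arcs Q. ?sq a) + 2 * (\<Sum>a\<in>arcs Q. ?D (tail Q a) * ?D (head Q a))"
      unfolding sum_distrib_left sum.distrib[symmetric] by (rule sum.cong[OF refl A])
    then have T: "2 * real_of_int (tits_form Q d) = (?D y)\<^sup>2 / 2 + (\<Sum>a\<in>arcs Q. ?sq a)"
      using P V unfolding polar_form_alt[of Q ?r ?u] by (simp add: tits_form_def)
    have sq0: "?sq a \<ge> 0" if "a \<in> arcs Q" for a
      using rpos[OF tail_in_verts[OF that]] rpos[OF head_in_verts[OF that]] by simp
    have S0: "(\<Sum>a\<in>arcs Q. ?sq a) \<ge> 0" by (rule sum_nonneg[OF sq0])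
    show "tits_form Q d > 0"
    proof (rule ccontr)
      assume "\<not> tits_form Q d > 0"
      then have le: "2 * real_of_int (tits_form Q d) \<le> 0" by simp
      have y0: "(?D y)\<^sup>2 / 2 \<ge> 0" by simp
      have "(\<Sum>a\<in>arcs Q. ?sq a) = 0" "(?D y)\<^sup>2 / 2 = 0" using T S0 le y0 by linarith+
      then have z: "?sq a = 0" if "a \<in> arcs Q" for a
        using sum_nonneg_eq_0_iff[of "arcs Q" ?sq, OF finite_arcs sq0] that by blast
      have "d (tail Q a) = 0 \<longleftrightarrow> d (head Q a) = 0" if "a \<in> arcs Q" for a
      proof -
        have "?D (head Q a) / ?r (head Q a) = ?D (tail Q a) / ?r (tail Q a)"
          using z[OF that] rpos[OF tail_in_verts[OF that]] rpos[OF head_in_verts[OF that]] by simp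
        then show ?thesis
          using rpos[OF tail_in_verts[OF that]] rpos[OF head_in_verts[OF that]] by (auto simp: field_simps)
      qed
      moreover have "d y = 0" using \<open>(?D y)\<^sup>2 / 2 = 0\<close> by simp
      ultimately have "verts Q \<subseteq> {v. d v = 0}" using q by (simp add: root_certificate_def)
      then show False using w by blast
    qed
  qed
qed

lemma root_certificate_tits: "root_certificate Q y q \<Longrightarrow> tits_form Q q = 1"
  using root_certificate_polar[of Q y q q] polar_form_self[of Q q] by (simp add: root_certificate_def)

text \<open>Maximality makes \<open>d\<close> dominant: a negative product with \<open>e\<^sub>x\<close> would make \<open>d + e\<^sub>x\<close> a positive root. Hence
  \<open>d\<^sub>y = (q, d)\<close> is at least 1. The Tits form at \<open>d - q\<close> is \<open>2 - d\<^sub>y\<close>. If \<open>d\<^sub>y \<ge> 2\<close>, then \<open>d = q\<close>. If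
  \<open>d\<^sub>y = 1\<close>, then \<open>d - q\<close> is a root with a negative entry, so it has no positive entries, and
  maximality of \<open>d\<close> gives \<open>d = q\<close>.\<close>

lemma maximal_positive_root_eq:
  assumes q: "root_certificate Q y q" and d: "maximal_positive_root Q d"
  shows "d = q"
proof -
  interpret fin_digraph Q using q by (simp add: root_certificate_def)
  have fd: "fin_digraph Q" by unfold_locales
  have wf: "wf_digraph Q" by unfold_locales
  note pos = root_certificate_positive_definite[OF q]
  have pd: "tits_form Q e > 0" if "v \<in> verts Q" "e v \<noteq> 0" for e v
    using pos that by (auto simp: positive_definite_def)
  have d1: "\<And>v. v \<notin> verts Q \<Longrightarrow> d v = 0" "\<And>v. d v \<ge> 0" "tits_form Q d = 1"
    and dmax: "\<And>e. positive_root Q e \<Longrightarrow> d \<le> e \<Longrightarrow> e = d"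
    using d by (auto simp: maximal_positive_root_def positive_root_def)
  have q1: "\<And>v. v \<in> verts Q \<Longrightarrow> q v \<ge> 1" "\<And>v. v \<notin> verts Q \<Longrightarrow> q v = 0" "q y = 2" "y \<in> verts Q"
    using q by (auto simp: root_certificate_def)
  have qpos: "positive_root Q q"
    unfolding positive_root_def using q1 root_certificate_tits[OF q] by (metis order.refl order_trans zero_le_one)
  have dom: "polar_form Q (unit_vector x) d \<ge> 0" if x: "x \<in> verts Q" for x
  proof (rule ccontr)
    assume neg: "\<not> polar_form Q (unit_vector x) d \<ge> 0"
    let ?e = "\<lambda>v. d v + unit_vector x v"
    have "?e x \<noteq> 0" using d1(2)[of x] by (simp add: unit_vector_def)
    then have "tits_form Q ?e > 0" by (rule pd[OF x])
    moreover have "tits_form Q ?e \<le> 1"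
      using neg tits_form_unit_le[OF fd x] d1(3) polar_form_sym[of Q d]
      by (simp add: tits_form_add)
    ultimately have "positive_root Q ?e" using d1 x by (auto simp: positive_root_def unit_vector_def)
    then have "?e = d" by (rule dmax) (auto simp: le_fun_def unit_vector_def)
    then show False by (auto dest!: fun_cong[of _ _ x] simp: unit_vector_def)
  qed
  have dy: "d y \<noteq> 0"
  proof
    assume "d y = 0"
    then have "(\<Sum>x\<in>verts Q. q x * polar_form Q (unit_vector x) d) = 0"
      using root_certificate_polar[OF q, of d] polar_form_unit_expand[OF fd, of q d] by simp
    moreover have "0 \<le> q x * polar_form Q (unit_vector x) d" if "x \<in> verts Q" for x
      using dom[OF that] q1(1)[OF that] by simp
    ultimately have "q x * polar_form Q (unit_vector x) d = 0" if "x \<in> verts Q" for x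
      using sum_nonneg_eq_0_iff[OF finite_verts, of "\<lambda>x. q x * polar_form Q (unit_vector x) d"] that by auto
    then have "polar_form Q (unit_vector x) d = 0" if "x \<in> verts Q" for x
      using that q1(1)[OF that] by force
    then have "polar_form Q d d = 0" using polar_form_unit_expand[OF fd, of d d] by simp
    then show False using polar_form_self[of Q d] d1(3) by simp
  qed
  let ?z = "\<lambda>v. d v - q v"
  have tz: "tits_form Q ?z = 2 - d y"
    using root_certificate_polar[OF q, of d] root_certificate_tits[OF q] d1(3) polar_form_sym[of Q d q]
    by (simp add: tits_form_diff)
  have dpos: "d y \<ge> 1" using dy d1(2)[of y] by linarith
  show ?thesis
  proof (cases "d y \<ge> 2")
    case True
    then have "?z v = 0" if "v \<in> verts Q" for v using pd[OF that, of ?z] tz by auto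
    then show ?thesis using d1(1) q1(2) by (metis ext eq_iff_diff_eq_0)
  next
    case False
    then have "tits_form Q ?z = 1" using tz dpos by simp
    \<comment> \<open>The positive and the negative part have disjoint supports, so the Tits form of the difference is
      at least the sum of the two values, each of which is positive unless the part is zero.\<close>
    let ?p = "\<lambda>v. max (?z v) 0" and ?m = "\<lambda>v. max (- ?z v) 0"
    have "?z = (\<lambda>v. ?p v - ?m v)" by (auto simp: max_def)
    then have "tits_form Q ?p - polar_form Q ?p ?m + tits_form Q ?m = 1"
      using tits_form_diff[of Q ?p ?m] \<open>tits_form Q ?z = 1\<close> by simp
    moreover have "polar_form Q ?p ?m \<le> 0" by (rule polar_form_disjoint_le) (auto simp: max_def)
    ultimately have le: "tits_form Q ?p + tits_form Q ?m \<le> 1" by simp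
    have "tits_form Q ?m > 0"
    proof (rule pd[OF q1(4)])
      show "?m y \<noteq> 0" using False dpos q1(3) by simp
    qed
    then have "tits_form Q ?p \<le> 0" using le by simp
    then have "?p v = 0" if "v \<in> verts Q" for v using pd[OF that, of ?p] by auto
    then have "d v \<le> q v" if "v \<in> verts Q" for v using that by (metis diff_le_0_iff_le max.absorb_iff2 max.commute)
    then have "d \<le> q" using d1(1) q1(2) by (metis le_funI order.refl)
    then show ?thesis using dmax[OF qpos] by simp
  qed
qed


section \<open>Summands of a rigid representation\<close>

context finite_quiver
begin

text \<open>The summands of a rigid representation have no extensions by each other, so the Euler form computes the
  dimensions of the homomorphism spaces between them.\<close>

lemma rigid_decomposition:
  assumes pos: "positive_definite Q" and M: "is_rep s Q M" and van: "ext_vanishes s Q M M"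
  obtains Ns where "is_direct_sum s Q M Ns" "\<And>i. i < length Ns \<Longrightarrow> indecomposable s Q (Ns ! i)"
    "\<And>i j. i < length Ns \<Longrightarrow> j < length Ns \<Longrightarrow> int (hom_dim s Q (Ns ! i) (Ns ! j)) =
       euler_form Q (dim_vector s Q (Ns ! i)) (dim_vector s Q (Ns ! j))"
proof -
  obtain Ns where Ns: "is_direct_sum s Q M Ns" "\<forall>N\<in>set Ns. indecomposable s Q N"
    using exists_indecomposable_decomposition[OF M] by blast
  have "int (hom_dim s Q N N') = euler_form Q (dim_vector s Q N) (dim_vector s Q N')"
    if N: "N \<in> set Ns" "N' \<in> set Ns" for N N'
  proof -
    obtain p p' where p: "retraction s Q M N p" "retraction s Q M N' p'"
      using direct_sum_retraction[OF M Ns(1)] N by metis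
    have "is_rep s Q N" "is_rep s Q N'" using Ns(2) N by (auto simp: indecomposable_def)
    then show ?thesis using euler_form_le_hom_dim(3) ext_vanishes_retract[OF M M p van] by blast
  qed
  then show thesis using that[OF Ns(1)] Ns(2) by auto
qed

text \<open>Each summand has dimension vector \<open>b\<close> with \<open>H b = 1\<close>: the number \<open>c * H b\<close> is a sum of
  dimensions that includes 2 for the summand itself, so \<open>H b\<close> is positive, and the Tits form at the difference
  of the dimension vector of \<open>M\<close> and \<open>2 b\<close> is nonnegative, so \<open>H b\<close> is less than 2. Thus \<open>H\<close> counts the
  summands.\<close>

lemma rigid_summands_count:
  fixes H :: "('v \<Rightarrow> int) \<Rightarrow> int"
  assumes pos: "positive_definite Q" and M: "is_rep s Q M" and van: "ext_vanishes s Q M M"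
    and polar: "\<And>d. (\<And>v. v \<notin> verts Q \<Longrightarrow> d v = 0) \<Longrightarrow> polar_form Q (dim_vector s Q M) d = c * H d"
    and H: "\<And>(I :: nat set) d. H (\<lambda>v. \<Sum>i\<in>I. d i v) = (\<Sum>i\<in>I. H (d i))"
    and c: "c > 0" "tits_form Q (dim_vector s Q M) + 4 < 4 * c"
    and HM: "H (dim_vector s Q M) = int r"
  obtains Ns where "is_direct_sum s Q M Ns" "length Ns = r" "\<And>i. i < r \<Longrightarrow> indecomposable s Q (Ns ! i)"
    "\<And>i. i < r \<Longrightarrow> (\<Sum>j\<in>{..<r} - {i}. int (hom_dim s Q (Ns ! i) (Ns ! j)) + int (hom_dim s Q (Ns ! j) (Ns ! i))) = c - 2"
proof -
  obtain Ns where Ns: "is_direct_sum s Q M Ns" "\<And>i. i < length Ns \<Longrightarrow> indecomposable s Q (Ns ! i)"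
    "\<And>i j. i < length Ns \<Longrightarrow> j < length Ns \<Longrightarrow> int (hom_dim s Q (Ns ! i) (Ns ! j)) =
       euler_form Q (dim_vector s Q (Ns ! i)) (dim_vector s Q (Ns ! j))"
    using rigid_decomposition[OF pos M van] by metis
  let ?n = "length Ns" let ?b = "\<lambda>i. dim_vector s Q (Ns ! i)" let ?d = "dim_vector s Q M"
  let ?h = "\<lambda>i j. int (hom_dim s Q (Ns ! i) (Ns ! j)) + int (hom_dim s Q (Ns ! j) (Ns ! i))"
  have dsum: "?d = (\<lambda>v. \<Sum>i<?n. ?b i v)" using dim_vector_direct_sum[OF Ns(1)] by blast
  have b0: "?b i v = 0" if "v \<notin> verts Q" for i v using that by (simp add: dim_vector_def)
  have tb: "tits_form Q (?b i) = 1" if "i < ?n" for i by (rule indecomposable_exceptional(4)[OF pos Ns(2)[OF that]])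
  have pb: "polar_form Q (?b i) (?b j) = ?h i j" if "i < ?n" "j < ?n" for i j
    using Ns(3) that by (simp add: polar_form_def)
  have pd: "c * H (?b i) = 2 + (\<Sum>j\<in>{..<?n} - {i}. ?h i j)" if i: "i < ?n" for i
  proof -
    have "c * H (?b i) = (\<Sum>j<?n. polar_form Q (?b j) (?b i))"
      using polar[of "?b i"] b0 dsum polar_form_sum_left[of Q ?b "{..<?n}" "?b i"] by simp
    also have "\<dots> = polar_form Q (?b i) (?b i) + (\<Sum>j\<in>{..<?n} - {i}. polar_form Q (?b j) (?b i))"
      using i by (intro sum.remove) auto
    also have "\<dots> = 2 + (\<Sum>j\<in>{..<?n} - {i}. ?h i j)"
      using tb[OF i] pb i by (auto simp: polar_form_self polar_form_sym[of Q _ "?b i"] intro!: sum.cong)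
    finally show ?thesis .
  qed
  have Hb: "H (?b i) = 1" if i: "i < ?n" for i
  proof -
    have "(\<Sum>j\<in>{..<?n} - {i}. ?h i j) \<ge> 0" by (intro sum_nonneg) simp
    then have "c * H (?b i) > 0" using pd[OF i] by linarith
    then have low: "H (?b i) \<ge> 1" using c(1) by (simp add: zero_less_mult_iff)
    have "tits_form Q (\<lambda>v. ?d v - 2 * ?b i v) \<ge> 0"
      by (rule positive_definite_nonneg[OF _ pos]) unfold_locales
    moreover have "tits_form Q (\<lambda>v. ?d v - 2 * ?b i v) = tits_form Q ?d - 2 * (c * H (?b i)) + 4"
      using tits_form_diff[of Q ?d "\<lambda>v. 2 * ?b i v"] tb[OF i] polar[of "?b i"] b0
      by (simp add: polar_form_scale_right tits_form_scale)
    ultimately have "2 * (c * H (?b i)) < 4 * c" using c(2) by linarith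
    then have "c * H (?b i) < c * 2" by simp
    then have "H (?b i) < 2" using c(1) by (simp add: mult_less_cancel_left)
    then show ?thesis using low by simp
  qed
  have "int r = (\<Sum>i<?n. H (?b i))" using HM dsum H[of ?b "{..<?n}"] by simp
  then have "int r = int ?n" using Hb by simp
  then have n: "?n = r" by simp
  show thesis
    by (rule that[OF Ns(1) n]) (use Ns(2) pd Hb n in \<open>auto simp: algebra_simps\<close>)
qed

end

definition extend_by_0 :: "'v set \<Rightarrow> ('v \<Rightarrow> int) \<Rightarrow> 'v \<Rightarrow> int" where
  "extend_by_0 S d v = (if v \<in> S then d v else 0)"

lemma euler_form_induced:
  assumes "fin_digraph Q" "S \<subseteq> verts Q"
  shows "euler_form (Q \<restriction> S) d e = euler_form Q (extend_by_0 S d) (extend_by_0 S e)"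
proof -
  interpret fin_digraph Q by fact
  have "(\<Sum>v\<in>S. d v * e v) = (\<Sum>v\<in>verts Q. extend_by_0 S d v * extend_by_0 S e v)"
    using assms(2) by (intro sum.mono_neutral_cong_left) (auto simp: extend_by_0_def)
  moreover have "(\<Sum>a\<in>arcs (Q \<restriction> S). d (tail Q a) * e (head Q a)) =
    (\<Sum>a\<in>arcs Q. extend_by_0 S d (tail Q a) * extend_by_0 S e (head Q a))"
    by (intro sum.mono_neutral_cong_left) (auto simp: extend_by_0_def)
  ultimately show ?thesis by (simp add: euler_form_def)
qed

lemma positive_definite_induced:
  assumes "fin_digraph Q" "S \<subseteq> verts Q" "positive_definite Q"
  shows "positive_definite (Q \<restriction> S)"
  unfolding positive_definite_def
proof (intro allI impI)
  fix d :: "'a \<Rightarrow> int" assume "\<exists>v\<in>verts (Q \<restriction> S). d v \<noteq> 0"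
  then have "\<exists>v\<in>verts Q. extend_by_0 S d v \<noteq> 0" using assms(2) by (auto simp: extend_by_0_def)
  then show "tits_form (Q \<restriction> S) d > 0"
    using assms(3) euler_form_induced[OF assms(1,2), of d d]
    by (simp add: positive_definite_def tits_form_eq_euler_form)
qed

lemma (in finite_quiver) finite_quiver_induced:
  assumes "S \<subseteq> verts Q" shows "finite_quiver s (Q \<restriction> S)"
proof -
  have "finite S" using assms finite_verts finite_subset by blast
  then show ?thesis by unfold_locales auto
qed

lemma (in finite_quiver) is_rep_induced:
  assumes "is_rep s Q M" "S \<subseteq> verts Q" shows "is_rep s (Q \<restriction> S) M"
proof -
  interpret R: finite_quiver s "Q \<restriction> S" by (rule finite_quiver_induced[OF assms(2)])
  have "wf_digraph (Q \<restriction> S)" by unfold_locales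
  then show ?thesis using assms by (auto simp: is_rep_def)
qed

text \<open>Let \<open>d\<close> be the restriction of \<open>q\<close>, so that \<open>d = q - 2 e\<^sub>y - 3 e\<^sub>z\<close>. Vectors supported on the
  subquiver are orthogonal to \<open>q\<close> and to \<open>e\<^sub>y\<close>. The product of \<open>e\<^sub>z\<close> and \<open>e\<^sub>y\<close> need not be read off the
  graph: \<open>1 = (q, e\<^sub>y) = 4 + 3 (e\<^sub>z, e\<^sub>y)\<close>.\<close>

lemma one_neighbor_forms:
  assumes q: "root_certificate Q y q" and nb: "neighbors Q y = {z}" and z: "z \<in> verts Q" "z \<noteq> y" "q z = 3"
  defines "S \<equiv> verts Q - ({y} \<union> neighbors Q y)"
  defines "H \<equiv> \<lambda>d. - polar_form Q (unit_vector z) (extend_by_0 S d)"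
  shows "\<And>d. (\<And>v. v \<notin> S \<Longrightarrow> d v = 0) \<Longrightarrow> polar_form (Q \<restriction> S) q d = 3 * H d"
    and "H q = 4" and "tits_form (Q \<restriction> S) q = 6"
proof -
  interpret fin_digraph Q using q by (simp add: root_certificate_def)
  have fd: "fin_digraph Q" by unfold_locales
  have S: "S \<subseteq> verts Q" by (auto simp: S_def)
  have y: "y \<in> verts Q" "q y = 2" "\<And>v. v \<notin> verts Q \<Longrightarrow> q v = 0" using q by (auto simp: root_certificate_def)
  note pd = root_certificate_positive_definite[OF q]
  let ?p = "polar_form Q" let ?q = "extend_by_0 S q"
  have qeq: "?q = (\<lambda>v. q v - (2 * unit_vector y v + 3 * unit_vector z v))"
    using y z nb by (auto simp: extend_by_0_def S_def unit_vector_def fun_eq_iff)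
  have far: "?p (unit_vector y) (extend_by_0 S d) = 0" for d
    by (rule polar_form_unit_far) (auto simp: extend_by_0_def S_def)
  have sub: "polar_form (Q \<restriction> S) d e = ?p (extend_by_0 S d) (extend_by_0 S e)" for d e
    by (simp add: polar_form_def euler_form_induced[OF fd S])
  have exp: "?p ?q e = e y - 2 * ?p (unit_vector y) e - 3 * ?p (unit_vector z) e" for e
    using root_certificate_polar[OF q, of e] unfolding qeq polar_form_simps by (simp add: algebra_simps)
  have uy: "?p (unit_vector y) (unit_vector y) = 2" "?p (unit_vector z) (unit_vector z) = 2"
    using tits_form_unit[OF fd pd] y(1) z(1) by (auto simp: polar_form_self)
  have "?p ?q (unit_vector y) = 0" using far[of q] polar_form_sym by metis
  then have zy: "?p (unit_vector z) (unit_vector y) = -1"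
    using exp[of "unit_vector y"] uy by (simp add: unit_vector_def)
  show P: "polar_form (Q \<restriction> S) q d = 3 * H d" for d
  proof -
    have "extend_by_0 S d y = 0" by (simp add: extend_by_0_def S_def)
    then show ?thesis using exp[of "extend_by_0 S d"] far[of d] unfolding sub H_def by linarith
  qed
  have "?p ?q (unit_vector z) = -4"
    using exp[of "unit_vector z"] uy zy z(2) polar_form_sym[of Q "unit_vector y" "unit_vector z"]
    by (simp add: unit_vector_def)
  then show H4: "H q = 4" using polar_form_sym[of Q "unit_vector z" ?q] by (simp add: H_def)
  show "tits_form (Q \<restriction> S) q = 6" using P[of q] H4 polar_form_self[of "Q \<restriction> S" q] by simp
qed

text \<open>Here \<open>d = q - 2 e\<^sub>y - 2 e\<^sub>z - e\<^sub>w\<close>. The equation \<open>1 = (q, e\<^sub>y) = 4 + 2 (e\<^sub>z, e\<^sub>y) + (e\<^sub>w, e\<^sub>y)\<close> with both products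
  negative makes them \<open>-1\<close>. Then \<open>0 = (q, e\<^sub>w)\<close> becomes \<open>(d, e\<^sub>w) + 2 (e\<^sub>z, e\<^sub>w) = 0\<close> with both terms
  nonpositive, so \<open>e\<^sub>w\<close> is orthogonal to \<open>e\<^sub>z\<close> and to every vector supported on the subquiver.\<close>

lemma two_neighbors_forms:
  assumes q: "root_certificate Q y q" and nb: "neighbors Q y = {z, w}"
    and z: "z \<in> verts Q" "z \<noteq> y" "q z = 2" and w: "w \<in> verts Q" "w \<noteq> y" "q w = 1"
  defines "S \<equiv> verts Q - ({y} \<union> neighbors Q y)"
  defines "H \<equiv> \<lambda>d. - polar_form Q (unit_vector z) (extend_by_0 S d)"
  shows "\<And>d. (\<And>v. v \<notin> S \<Longrightarrow> d v = 0) \<Longrightarrow> polar_form (Q \<restriction> S) q d = 2 * H d"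
    and "H q = 2" and "tits_form (Q \<restriction> S) q = 2"
proof -
  interpret fin_digraph Q using q by (simp add: root_certificate_def)
  have fd: "fin_digraph Q" by unfold_locales
  have S: "S \<subseteq> verts Q" by (auto simp: S_def)
  have y: "y \<in> verts Q" "q y = 2" "\<And>v. v \<notin> verts Q \<Longrightarrow> q v = 0" "\<And>v. v \<in> verts Q \<Longrightarrow> q v \<ge> 1"
    using q by (auto simp: root_certificate_def)
  have zw: "z \<noteq> w" using z w by auto
  note pd = root_certificate_positive_definite[OF q]
  let ?p = "polar_form Q" let ?q = "extend_by_0 S q" let ?e = unit_vector
  have qeq: "?q = (\<lambda>v. q v - (2 * ?e y v + (2 * ?e z v + ?e w v)))"
    using y z w zw nb by (auto simp: extend_by_0_def S_def unit_vector_def fun_eq_iff)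
  have far: "?p (?e y) (extend_by_0 S d) = 0" for d
    by (rule polar_form_unit_far) (auto simp: extend_by_0_def S_def)
  have sub: "polar_form (Q \<restriction> S) d e = ?p (extend_by_0 S d) (extend_by_0 S e)" for d e
    by (simp add: polar_form_def euler_form_induced[OF fd S])
  have exp: "?p ?q e = e y - 2 * ?p (?e y) e - 2 * ?p (?e z) e - ?p (?e w) e" for e
    using root_certificate_polar[OF q, of e] unfolding qeq polar_form_simps by (simp add: algebra_simps)
  have uu: "?p (?e y) (?e y) = 2" "?p (?e z) (?e z) = 2" "?p (?e w) (?e w) = 2"
    using tits_form_unit[OF fd pd] y(1) z(1) w(1) by (auto simp: polar_form_self)
  have "?p ?q (?e y) = 0" using far[of q] polar_form_sym by metis
  moreover have "?p (?e z) (?e y) \<le> -1" "?p (?e w) (?e y) \<le> -1"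
    using polar_form_unit_neighbor[OF finite_arcs] z(2) w(2) nb by auto
  ultimately have zy: "?p (?e z) (?e y) = -1" "?p (?e w) (?e y) = -1"
    using exp[of "?e y"] uu by (auto simp: unit_vector_def)
  have off: "?p (?e x) (?e w) \<le> 0" if "x \<noteq> w" for x by (rule polar_form_unit_off_diagonal[OF that])
  have le: "?q x * ?p (?e x) (?e w) \<le> 0" for x
    using off[of x] y(4)[of x] nb by (cases "x \<in> S") (auto simp: extend_by_0_def S_def mult_le_0_iff)
  have qs: "?p ?q (?e w) = (\<Sum>x\<in>verts Q. ?q x * ?p (?e x) (?e w))" by (rule polar_form_unit_expand[OF fd])
  then have "?p ?q (?e w) \<le> 0" using le by (simp add: sum_nonpos)
  moreover have "?p ?q (?e w) = - 2 * ?p (?e z) (?e w)"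
    using exp[of "?e w"] uu zy w(2) polar_form_sym[of Q "?e y" "?e w"] by (simp add: unit_vector_def)
  ultimately have zw0: "?p (?e z) (?e w) = 0" "?p ?q (?e w) = 0" using off[OF zw] by auto
  have "(\<Sum>x\<in>verts Q. - (?q x * ?p (?e x) (?e w))) = 0" using zw0(2) qs by (simp add: sum_negf)
  then have "?q x * ?p (?e x) (?e w) = 0" if "x \<in> verts Q" for x
    using sum_nonneg_eq_0_iff[of "verts Q" "\<lambda>x. - (?q x * ?p (?e x) (?e w))"] le that by auto
  then have xw: "?p (?e x) (?e w) = 0" if "x \<in> S" for x
    using that S y(4)[of x] by (force simp: extend_by_0_def)
  have wS: "?p (?e w) (extend_by_0 S d) = 0" for d
    unfolding polar_form_sym[of Q "?e w"] polar_form_unit_expand[OF fd, of "extend_by_0 S d"]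
    using xw by (intro sum.neutral) (auto simp: extend_by_0_def)
  show P: "polar_form (Q \<restriction> S) q d = 2 * H d" for d
  proof -
    have "extend_by_0 S d y = 0" by (simp add: extend_by_0_def S_def)
    then show ?thesis using exp[of "extend_by_0 S d"] far[of d] wS[of d] unfolding sub H_def by linarith
  qed
  have "?p ?q (?e z) = -2"
    using exp[of "?e z"] uu zy zw0 z(2) polar_form_sym[of Q "?e y" "?e z"] polar_form_sym[of Q "?e w" "?e z"]
    by (simp add: unit_vector_def)
  then show H4: "H q = 2" using polar_form_sym[of Q "?e z" ?q] by (simp add: H_def)
  show "tits_form (Q \<restriction> S) q = 2" using P[of q] H4 polar_form_self[of "Q \<restriction> S" q] by simp
qed


section \<open>The Dynkin graphs\<close>

text \<open>The value of a symmetric function on the two ends of an edge, which turns sums over the arrows into sums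
  over the edges of the underlying graph, whatever the orientation.\<close>

definition edge_value :: "('v \<Rightarrow> 'v \<Rightarrow> 'c) \<Rightarrow> 'v set \<Rightarrow> 'c" where
  "edge_value g e = (THE r. \<exists>x z. e = {x, z} \<and> r = g x z)"

lemma edge_value_doubleton:
  assumes "\<And>x z. g x z = g z x" shows "edge_value g {x, z} = g x z"
  unfolding edge_value_def
proof (rule the_equality)
  fix r assume "\<exists>x' z'. {x, z} = {x', z'} \<and> r = g x' z'"
  then obtain x' z' where "{x, z} = {x', z'}" "r = g x' z'" by blast
  then show "r = g x z" using assms by (auto simp: doubleton_eq_iff)
qed blast

lemma sum_arcs_underlying:
  assumes Q: "has_underlying_graph Q W E" and g: "\<And>x z. g x z = g z x"
  shows "(\<Sum>a\<in>arcs Q. g (tail Q a) (head Q a)) = (\<Sum>e\<in>E. edge_value g e)"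
proof -
  have "bij_betw (\<lambda>a. {tail Q a, head Q a}) (arcs Q) E" using Q by (simp add: has_underlying_graph_def)
  from sum.reindex_bij_betw[OF this, of "edge_value g"] show ?thesis
    by (simp add: edge_value_doubleton[of g, OF g])
qed

lemma polar_form_underlying:
  assumes "has_underlying_graph Q W E"
  shows "polar_form Q d e = (\<Sum>v\<in>W. 2 * (d v * e v)) - (\<Sum>x\<in>E. edge_value (\<lambda>x z. d x * e z + e x * d z) x)"
proof -
  have "verts Q = W" using assms by (simp add: has_underlying_graph_def)
  then show ?thesis unfolding polar_form_alt
    by (subst sum_arcs_underlying[OF assms, symmetric]) (auto simp: mult.commute add.commute)
qed

lemma neighbors_underlying:
  assumes "has_underlying_graph Q W E"
  shows "neighbors Q y = {x. {x, y} \<in> E}"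
proof -
  have E: "E = (\<lambda>a. {tail Q a, head Q a}) ` arcs Q"
    using assms by (simp add: has_underlying_graph_def bij_betw_def)
  have "x \<in> neighbors Q y \<longleftrightarrow> {x, y} \<in> E" for x
    unfolding E neighbors_def arcs_ends_def arc_to_ends_def by (auto simp: doubleton_eq_iff image_iff)
  then show ?thesis by blast
qed

lemma root_certificate_underlying:
  assumes Q: "has_underlying_graph Q W E" and fin: "finite W" "finite E"
    and q: "y \<in> W" "\<And>v. v \<in> W \<Longrightarrow> q v \<ge> 1" "\<And>v. v \<notin> W \<Longrightarrow> q v = 0" "q y = 2"
    and pol: "\<And>u :: 'v \<Rightarrow> real. (\<Sum>v\<in>W. 2 * (of_int (q v) * u v)) -
       (\<Sum>e\<in>E. edge_value (\<lambda>x z. of_int (q x) * u z + u x * of_int (q z)) e) = u y"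
    and conn: "\<And>S. y \<in> S \<Longrightarrow> (\<And>x z. {x, z} \<in> E \<Longrightarrow> x \<in> S \<Longrightarrow> z \<in> S) \<Longrightarrow> W \<subseteq> S"
  shows "root_certificate Q y q"
proof -
  have Q': "wf_digraph Q" "verts Q = W" "bij_betw (\<lambda>a. {tail Q a, head Q a}) (arcs Q) E"
    using Q by (auto simp: has_underlying_graph_def)
  have "fin_digraph Q"
    using Q' fin bij_betw_finite[OF Q'(3)] by (simp add: fin_digraph_def fin_digraph_axioms_def)
  moreover have "W \<subseteq> S" if S: "y \<in> S" "\<forall>a\<in>arcs Q. tail Q a \<in> S \<longleftrightarrow> head Q a \<in> S" for S
  proof (rule conn[OF S(1)])
    fix x z assume "{x, z} \<in> E" "x \<in> S"
    moreover from this obtain a where "a \<in> arcs Q" "{x, z} = {tail Q a, head Q a}"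
      using bij_betw_imp_surj_on[OF Q'(3)] by blast
    ultimately show "z \<in> S" using S(2) by (auto simp: doubleton_eq_iff)
  qed
  ultimately show ?thesis
    using q pol Q'(2) unfolding root_certificate_def polar_form_underlying[OF Q] by auto
qed

lemma path_edges_Nil: "path_edges [x] = {}" by (simp add: path_edges_def)

lemma path_edges_Cons: "path_edges (x # z # xs) = insert {x, z} (path_edges (z # xs))"
proof -
  have "{f i | i. Suc i < Suc (Suc n)} = insert (f 0) {f (Suc i) | i. Suc i < Suc n}" for f :: "nat \<Rightarrow> 'a set" and n
    by (auto simp: less_Suc_eq_0_disj)
  from this[of "\<lambda>i. {(x # z # xs) ! i, (x # z # xs) ! Suc i}" "length xs"] show ?thesis
    by (simp add: path_edges_def)
qed

text \<open>The vectors are the highest roots: 3 at the center of \<open>E\<^sub>6\<close>, 4 for \<open>E\<^sub>7\<close> and 6 for \<open>E\<^sub>8\<close>.\<close>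

lemma dynkin_E_certificate:
  assumes "dynkin_E m Q y"
  obtains q z where "root_certificate Q y q" "neighbors Q y = {z}" "z \<in> verts Q" "z \<noteq> y" "q z = 3"
proof -
  have m: "m \<in> {6, 7, 8}" using assms by (simp add: dynkin_E_def)
  obtain c b1 b2 b3 where b: "distinct (c # b1 @ b2 @ b3)" "length b1 = 1" "length b2 = 2" "length b3 = m - 4"
    and Q: "has_underlying_graph Q (set (c # b1 @ b2 @ b3))
          (path_edges (c # b1) \<union> path_edges (c # b2) \<union> path_edges (c # b3))"
    and y: "y = (if m = 6 then last b1 else if m = 7 then last b2 else last b3)"
    using assms unfolding dynkin_E_def by blast
  obtain x1 where x1: "b1 = [x1]" using b(2) by (cases b1) auto
  obtain x2 x3 where x2: "b2 = [x2, x3]" using b(3) by (auto simp: length_Suc_conv numeral_2_eq_2)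
  have V: "verts Q = set (c # b1 @ b2 @ b3)" using Q by (simp add: has_underlying_graph_def)
  note pe = path_edges_Nil path_edges_Cons
  have len: "length xs = 2 \<Longrightarrow> \<exists>a b. xs = [a, b]" "length xs = 3 \<Longrightarrow> \<exists>a b c. xs = [a, b, c]"
    "length xs = 4 \<Longrightarrow> \<exists>a b c d. xs = [a, b, c, d]" for xs :: "'a list"
    by (auto simp: length_Suc_conv eval_nat_numeral)
  consider "m = 6" | "m = 7" | "m = 8" using m by blast
  then show thesis
  proof cases
    case 1
    obtain x4 x5 where x4: "b3 = [x4, x5]" using b(4) 1 len[of b3] by auto
    have d: "distinct [c, x1, x2, x3, x4, x5]" using b(1) by (simp add: x1 x2 x4)
    have d': "distinct (rev [c, x1, x2, x3, x4, x5])" using d by (simp only: distinct_rev)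
    have y1: "y = x1" using y 1 by (simp add: x1 x2 x4)
    let ?W = "{c, x1, x2, x3, x4, x5}"
    let ?E = "{{c, x1}, {c, x2}, {x2, x3}, {c, x4}, {x4, x5}}"
    have W: "set (c # b1 @ b2 @ b3) = ?W" by (auto simp: x1 x2 x4)
    have E: "path_edges (c # b1) \<union> path_edges (c # b2) \<union> path_edges (c # b3) = ?E"
      unfolding x1 x2 x4 pe by (simp only: Un_insert_left Un_empty_left)
    note Q1 = Q[unfolded W E]
    let ?q = "\<lambda>v. if v = c then 3 else if v = x1 then 2 else if v = x2 then 2 else if v = x3 then 1 else if v = x4 then 2 else if v = x5 then 1 else (0::int)"
    show thesis
    proof (rule that[of ?q c])
      show "root_certificate Q y ?q"
      proof (rule root_certificate_underlying[OF Q1])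
        fix S assume y: "y \<in> S" and step: "\<And>x z. {x, z} \<in> ?E \<Longrightarrow> x \<in> S \<Longrightarrow> z \<in> S"
        have edge: "z \<in> S" if "{x, z} \<in> ?E" "x \<in> S" for x z using step[OF that] .
        have 0: "x1 \<in> S" using y y1 by simp
        have s_c: "c \<in> S" by (rule edge[of x1]) (simp_all add: doubleton_eq_iff 0)
        have s_x2: "x2 \<in> S" by (rule edge[of c]) (simp_all add: doubleton_eq_iff s_c)
        have s_x3: "x3 \<in> S" by (rule edge[of x2]) (simp_all add: doubleton_eq_iff s_x2)
        have s_x4: "x4 \<in> S" by (rule edge[of c]) (simp_all add: doubleton_eq_iff s_c)
        have s_x5: "x5 \<in> S" by (rule edge[of x4]) (simp_all add: doubleton_eq_iff s_x4)
        show "?W \<subseteq> S" using 0 s_c s_x2 s_x3 s_x4 s_x5 by simp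
      next
        fix u :: "'a \<Rightarrow> real"
        show "(\<Sum>v\<in>?W. 2 * (of_int (?q v) * u v)) -
          (\<Sum>e\<in>?E. edge_value (\<lambda>x z. of_int (?q x) * u z + u x * of_int (?q z)) e) = u y"
          using d d' by (simp add: y1 edge_value_doubleton add.commute mult.commute doubleton_eq_iff)
      qed (use d in \<open>auto simp: y1\<close>)
      show "neighbors Q y = {c}"
        unfolding neighbors_underlying[OF Q1] using d d' by (auto simp: y1 doubleton_eq_iff)
    qed (use d V y1 in \<open>auto simp: x1 x2 x4\<close>)
  next
    case 2
    obtain x4 x5 x6 where x4: "b3 = [x4, x5, x6]" using b(4) 2 len[of b3] by auto
    have d: "distinct [c, x1, x2, x3, x4, x5, x6]" using b(1) by (simp add: x1 x2 x4)
    have d': "distinct (rev [c, x1, x2, x3, x4, x5, x6])" using d by (simp only: distinct_rev)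
    have y1: "y = x3" using y 2 by (simp add: x1 x2 x4)
    let ?W = "{c, x1, x2, x3, x4, x5, x6}"
    let ?E = "{{c, x1}, {c, x2}, {x2, x3}, {c, x4}, {x4, x5}, {x5, x6}}"
    have W: "set (c # b1 @ b2 @ b3) = ?W" by (auto simp: x1 x2 x4)
    have E: "path_edges (c # b1) \<union> path_edges (c # b2) \<union> path_edges (c # b3) = ?E"
      unfolding x1 x2 x4 pe by (simp only: Un_insert_left Un_empty_left)
    note Q1 = Q[unfolded W E]
    let ?q = "\<lambda>v. if v = c then 4 else if v = x1 then 2 else if v = x2 then 3 else if v = x3 then 2 else if v = x4 then 3 else if v = x5 then 2 else if v = x6 then 1 else (0::int)"
    show thesis
    proof (rule that[of ?q x2])
      show "root_certificate Q y ?q"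
      proof (rule root_certificate_underlying[OF Q1])
        fix S assume y: "y \<in> S" and step: "\<And>x z. {x, z} \<in> ?E \<Longrightarrow> x \<in> S \<Longrightarrow> z \<in> S"
        have edge: "z \<in> S" if "{x, z} \<in> ?E" "x \<in> S" for x z using step[OF that] .
        have 0: "x3 \<in> S" using y y1 by simp
        have s_x2: "x2 \<in> S" by (rule edge[of x3]) (simp_all add: doubleton_eq_iff 0)
        have s_c: "c \<in> S" by (rule edge[of x2]) (simp_all add: doubleton_eq_iff s_x2)
        have s_x4: "x4 \<in> S" by (rule edge[of c]) (simp_all add: doubleton_eq_iff s_c)
        have s_x5: "x5 \<in> S" by (rule edge[of x4]) (simp_all add: doubleton_eq_iff s_x4)
        have s_x6: "x6 \<in> S" by (rule edge[of x5]) (simp_all add: doubleton_eq_iff s_x5)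
        have s_x1: "x1 \<in> S" by (rule edge[of c]) (simp_all add: doubleton_eq_iff s_c)
        show "?W \<subseteq> S" using 0 s_x2 s_c s_x4 s_x5 s_x6 s_x1 by simp
      next
        fix u :: "'a \<Rightarrow> real"
        show "(\<Sum>v\<in>?W. 2 * (of_int (?q v) * u v)) -
          (\<Sum>e\<in>?E. edge_value (\<lambda>x z. of_int (?q x) * u z + u x * of_int (?q z)) e) = u y"
          using d d' by (simp add: y1 edge_value_doubleton add.commute mult.commute doubleton_eq_iff)
      qed (use d in \<open>auto simp: y1\<close>)
      show "neighbors Q y = {x2}"
        unfolding neighbors_underlying[OF Q1] using d d' by (auto simp: y1 doubleton_eq_iff)
    qed (use d V y1 in \<open>auto simp: x1 x2 x4\<close>)
  next
    case 3
    obtain x4 x5 x6 x7 where x4: "b3 = [x4, x5, x6, x7]" using b(4) 3 len[of b3] by auto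
    have d: "distinct [c, x1, x2, x3, x4, x5, x6, x7]" using b(1) by (simp add: x1 x2 x4)
    have d': "distinct (rev [c, x1, x2, x3, x4, x5, x6, x7])" using d by (simp only: distinct_rev)
    have y1: "y = x7" using y 3 by (simp add: x1 x2 x4)
    let ?W = "{c, x1, x2, x3, x4, x5, x6, x7}"
    let ?E = "{{c, x1}, {c, x2}, {x2, x3}, {c, x4}, {x4, x5}, {x5, x6}, {x6, x7}}"
    have W: "set (c # b1 @ b2 @ b3) = ?W" by (auto simp: x1 x2 x4)
    have E: "path_edges (c # b1) \<union> path_edges (c # b2) \<union> path_edges (c # b3) = ?E"
      unfolding x1 x2 x4 pe by (simp only: Un_insert_left Un_empty_left)
    note Q1 = Q[unfolded W E]
    let ?q = "\<lambda>v. if v = c then 6 else if v = x1 then 3 else if v = x2 then 4 else if v = x3 then 2 else if v = x4 then 5 else if v = x5 then 4 else if v = x6 then 3 else if v = x7 then 2 else (0::int)"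
    show thesis
    proof (rule that[of ?q x6])
      show "root_certificate Q y ?q"
      proof (rule root_certificate_underlying[OF Q1])
        fix S assume y: "y \<in> S" and step: "\<And>x z. {x, z} \<in> ?E \<Longrightarrow> x \<in> S \<Longrightarrow> z \<in> S"
        have edge: "z \<in> S" if "{x, z} \<in> ?E" "x \<in> S" for x z using step[OF that] .
        have 0: "x7 \<in> S" using y y1 by simp
        have s_x6: "x6 \<in> S" by (rule edge[of x7]) (simp_all add: doubleton_eq_iff 0)
        have s_x5: "x5 \<in> S" by (rule edge[of x6]) (simp_all add: doubleton_eq_iff s_x6)
        have s_x4: "x4 \<in> S" by (rule edge[of x5]) (simp_all add: doubleton_eq_iff s_x5)
        have s_c: "c \<in> S" by (rule edge[of x4]) (simp_all add: doubleton_eq_iff s_x4)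
        have s_x1: "x1 \<in> S" by (rule edge[of c]) (simp_all add: doubleton_eq_iff s_c)
        have s_x2: "x2 \<in> S" by (rule edge[of c]) (simp_all add: doubleton_eq_iff s_c)
        have s_x3: "x3 \<in> S" by (rule edge[of x2]) (simp_all add: doubleton_eq_iff s_x2)
        show "?W \<subseteq> S" using 0 s_x6 s_x5 s_x4 s_c s_x1 s_x2 s_x3 by simp
      next
        fix u :: "'a \<Rightarrow> real"
        show "(\<Sum>v\<in>?W. 2 * (of_int (?q v) * u v)) -
          (\<Sum>e\<in>?E. edge_value (\<lambda>x z. of_int (?q x) * u z + u x * of_int (?q z)) e) = u y"
          using d d' by (simp add: y1 edge_value_doubleton add.commute mult.commute doubleton_eq_iff)
      qed (use d in \<open>auto simp: y1\<close>)
      show "neighbors Q y = {x6}"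
        unfolding neighbors_underlying[OF Q1] using d d' by (auto simp: y1 doubleton_eq_iff)
    qed (use d V y1 in \<open>auto simp: x1 x2 x4\<close>)
  qed
qed

lemma D_edges_eq: "D_edges n = insert {1, 3} (insert {2, 3} ((\<lambda>i. {i, Suc i}) ` {3..<n}))"
proof -
  have "{{i, i + 1} | i. 3 \<le> i \<and> i < n} = (\<lambda>i. {i, Suc i}) ` {3..<n}"
    unfolding image_def Suc_eq_plus1 by (rule Collect_cong) (metis atLeastLessThan_iff)
  then show ?thesis by (simp add: D_edges_def)
qed

lemma doubleton_ne_successive: "a < 3 \<Longrightarrow> 3 \<le> i \<Longrightarrow> {a, b} \<noteq> {i, Suc i}" for a :: nat
proof
  assume "a < 3" "3 \<le> i" "{a, b} = {i, Suc i}"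
  then have "a \<in> {i, Suc i}" by blast
  then show False using \<open>a < 3\<close> \<open>3 \<le> i\<close> by simp
qed

lemma sum_D_edges: "(\<Sum>e\<in>D_edges n. F e) = F {1, 3} + F {2, 3} + (\<Sum>i\<in>{3..<n}. F {i, Suc i})"
proof -
  have "inj_on (\<lambda>i. {i, Suc i}) {3..<n}" by (auto simp: inj_on_def doubleton_eq_iff)
  then have "(\<Sum>e\<in>(\<lambda>i. {i, Suc i}) ` {3..<n}. F e) = (\<Sum>i\<in>{3..<n}. F {i, Suc i})"
    by (simp add: sum.reindex)
  moreover have "{1, 3} \<noteq> {2, 3::nat}" by (simp add: doubleton_eq_iff)
  moreover have "{1, 3} \<notin> (\<lambda>i. {i, Suc i}) ` {3..<n}" "{2, 3} \<notin> (\<lambda>i. {i, Suc i}) ` {3..<n}"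
    using doubleton_ne_successive[of 1] doubleton_ne_successive[of 2] by auto
  ultimately show ?thesis unfolding D_edges_eq by (simp add: add.assoc)
qed

lemma finite_D_edges: "finite (D_edges n)"
  by (simp add: D_edges_eq)

lemma D_edges_neighbors:
  assumes "n \<ge> 5" shows "{i, n - 1} \<in> D_edges n \<longleftrightarrow> i = n - 2 \<or> i = n"
proof
  assume "{i, n - 1} \<in> D_edges n"
  then have "{i, n - 1} = {1, 3} \<or> {i, n - 1} = {2, 3} \<or> (\<exists>j. 3 \<le> j \<and> {i, n - 1} = {j, Suc j})"
    unfolding D_edges_eq by auto
  then show "i = n - 2 \<or> i = n" using assms by (auto simp: doubleton_eq_iff)
next
  assume "i = n - 2 \<or> i = n"
  then show "{i, n - 1} \<in> D_edges n"
  proof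
    assume "i = n - 2"
    moreover have "n - 1 = Suc (n - 2)" using assms by simp
    ultimately have e: "{i, n - 1} = {n - 2, Suc (n - 2)}" by simp
    show ?thesis
      unfolding D_edges_eq e by (rule insertI2, rule insertI2, rule imageI) (use assms in simp)
  next
    assume "i = n"
    then have e: "{i, n - 1} = {n - 1, Suc (n - 1)}" using assms by auto
    show ?thesis
      unfolding D_edges_eq e by (rule insertI2, rule insertI2, rule imageI) (use assms in simp)
  qed
qed

lemma D_edges_subset: "n \<ge> 4 \<Longrightarrow> D_edges n \<subseteq> Pow {1..n}"
  by (auto simp: D_edges_def)

text \<open>The pairing with the highest root of \<open>D\<^sub>n\<close>, which is 1 at the three ends and 2 elsewhere. The sum
  telescopes along the long branch and leaves only the term at the vertex \<open>n - 1\<close>, next to the end.\<close>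

lemma D_root_identity:
  fixes U :: "nat \<Rightarrow> real"
  assumes n: "n \<ge> 5" and Q: "\<And>i. Q i = (if i \<in> {1, 2, n} then 1 else 2)"
  shows "(\<Sum>i\<in>{1..n}. 2 * (Q i * U i)) - ((Q 1 * U 3 + U 1 * Q 3) + (Q 2 * U 3 + U 2 * Q 3) +
    (\<Sum>i\<in>{3..<n}. Q i * U (Suc i) + U i * Q (Suc i))) = U (n - 1)"
proof -
  obtain m where m: "n = Suc m" "m \<ge> 4" using n by (cases n) auto
  have tel: "(\<Sum>i\<in>{3..<k}. 2 * U (Suc i) + 2 * U i) = 4 * (\<Sum>i\<in>{3..<Suc k}. U i) - 2 * U 3 - 2 * U k"
    if "k \<ge> 3" for k
    using that
  proof (induction k rule: nat_induct_at_least)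
    case base
    have "{3..<Suc 3} = {3::nat}" by auto
    then show ?case by simp
  next
    case (Suc k)
    then show ?case by (simp add: algebra_simps)
  qed
  have "{1..n} = insert 1 (insert 2 (insert n {3..<n}))" using n by auto
  then have "(\<Sum>i\<in>{1..n}. 2 * (Q i * U i)) = 2 * U 1 + (2 * U 2 + (2 * U n + (\<Sum>i\<in>{3..<n}. 2 * (Q i * U i))))"
    using n by (simp add: Q)
  also have "(\<Sum>i\<in>{3..<n}. 2 * (Q i * U i)) = (\<Sum>i\<in>{3..<n}. 4 * U i)"
    by (intro sum.cong) (auto simp: Q)
  finally have V: "(\<Sum>i\<in>{1..n}. 2 * (Q i * U i)) = 2 * U 1 + (2 * U 2 + (2 * U n + 4 * (\<Sum>i\<in>{3..<n}. U i)))"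
    by (simp add: sum_distrib_left)
  have "(\<Sum>i\<in>{3..<n}. Q i * U (Suc i) + U i * Q (Suc i)) =
    (\<Sum>i\<in>{3..<m}. Q i * U (Suc i) + U i * Q (Suc i)) + (2 * U n + U m)"
    using m by (simp add: Q)
  also have "(\<Sum>i\<in>{3..<m}. Q i * U (Suc i) + U i * Q (Suc i)) = (\<Sum>i\<in>{3..<m}. 2 * U (Suc i) + 2 * U i)"
    by (intro sum.cong) (auto simp: Q m)
  finally have E: "(\<Sum>i\<in>{3..<n}. Q i * U (Suc i) + U i * Q (Suc i)) =
    4 * (\<Sum>i\<in>{3..<n}. U i) - 2 * U 3 - 2 * U m + (2 * U n + U m)" using tel[of m] m by simp
  have "Q 1 = 1" "Q 2 = 1" "Q 3 = 2" using n by (auto simp: Q)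
  then show ?thesis using V E m by simp
qed

lemma dynkin_D_certificate:
  assumes "dynkin_D n Q y" "n \<ge> 5"
  obtains q z w where "root_certificate Q y q" "neighbors Q y = {z, w}"
    "z \<in> verts Q" "z \<noteq> y" "q z = 2" "w \<in> verts Q" "w \<noteq> y" "q w = 1"
proof -
  obtain p where p: "inj_on p {1..n}" "y = p (n - 1)"
    and Q: "has_underlying_graph Q (p ` {1..n}) ((\<lambda>e. p ` e) ` D_edges n)"
    using assms unfolding dynkin_D_def by blast
  have V: "verts Q = p ` {1..n}" using Q by (simp add: has_underlying_graph_def)
  have pe: "p i = p j \<longleftrightarrow> i = j" if "i \<in> {1..n}" "j \<in> {1..n}" for i j
    using inj_on_eq_iff[OF p(1)] that by blast
  define R :: "nat \<Rightarrow> int" where "R i = (if i \<in> {1, 2, n} then 1 else 2)" for i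
  define q where "q v = (if v \<in> p ` {1..n} then R (inv_into {1..n} p v) else 0)" for v
  have qp: "q (p i) = R i" if "i \<in> {1..n}" for i using that p(1) by (simp add: q_def)
  have injE: "inj_on (\<lambda>e. p ` e) (D_edges n)"
    using inj_on_subset[OF inj_on_image_Pow[OF p(1)] D_edges_subset] assms(2) by simp
  have edge: "{p i, p (Suc i)} \<in> (\<lambda>e. p ` e) ` D_edges n" if "3 \<le> i" "i < n" for i
    using that by (intro image_eqI[of _ _ "{i, Suc i}"]) (auto simp: D_edges_def)
  have edge1: "{p 1, p 3} \<in> (\<lambda>e. p ` e) ` D_edges n"
    by (intro image_eqI[of _ _ "{1, 3}"]) (auto simp: D_edges_def)
  have edge2: "{p 2, p 3} \<in> (\<lambda>e. p ` e) ` D_edges n"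
    by (intro image_eqI[of _ _ "{2, 3}"]) (auto simp: D_edges_def)
  have cert: "root_certificate Q y q"
  proof (rule root_certificate_underlying[OF Q])
    fix S assume S: "y \<in> S" and step: "\<And>x z. {x, z} \<in> (\<lambda>e. p ` e) ` D_edges n \<Longrightarrow> x \<in> S \<Longrightarrow> z \<in> S"
    have up: "p (Suc i) \<in> S \<longleftrightarrow> p i \<in> S" if "3 \<le> i" "i < n" for i
      using step edge[OF that] by (metis insert_commute)
    have mid: "p i \<in> S" if "i \<le> n - 1" "3 \<le> i" for i
      using that
    proof (induction i rule: inc_induct)
      case base
      then show ?case using S p(2) by simp
    next
      case (step i)
      then show ?case using up[of i] by simp
    qed
    have "p n \<in> S" using up[of "n - 1"] mid[of "n - 1"] assms(2) by simp
    moreover have "p 3 \<in> S" using mid[of 3] assms(2) by simp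
    then have "p 1 \<in> S" "p 2 \<in> S" using step edge1 edge2 by (metis insert_commute)+
    moreover have "i = 1 \<or> i = 2 \<or> i = n \<or> (i \<le> n - 1 \<and> 3 \<le> i)" if "i \<in> {1..n}" for i
      using that by auto
    ultimately show "p ` {1..n} \<subseteq> S" using mid by blast
  next
    fix u :: "'a \<Rightarrow> real"
    let ?g = "\<lambda>x z. of_int (q x) * u z + u x * of_int (q z)"
    have ev: "edge_value ?g {x, z} = ?g x z" for x z
      by (rule edge_value_doubleton) (simp add: algebra_simps)
    have "(\<Sum>e\<in>(\<lambda>e. p ` e) ` D_edges n. edge_value ?g e) = (\<Sum>e\<in>D_edges n. edge_value ?g (p ` e))"
      using sum.reindex[OF injE] by simp
    also have "\<dots> = ?g (p 1) (p 3) + ?g (p 2) (p 3) + (\<Sum>i\<in>{3..<n}. ?g (p i) (p (Suc i)))"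
      by (subst sum_D_edges) (simp add: ev)
    also have "?g (p 1) (p 3) = real_of_int (R 1) * u (p 3) + u (p 1) * real_of_int (R 3)"
      using assms(2) by (simp add: qp)
    also have "?g (p 2) (p 3) = real_of_int (R 2) * u (p 3) + u (p 2) * real_of_int (R 3)"
      using assms(2) by (simp add: qp)
    also have "(\<Sum>i\<in>{3..<n}. ?g (p i) (p (Suc i))) =
       (\<Sum>i\<in>{3..<n}. real_of_int (R i) * u (p (Suc i)) + u (p i) * real_of_int (R (Suc i)))"
      by (intro sum.cong) (auto simp: qp)
    finally have E: "(\<Sum>e\<in>(\<lambda>e. p ` e) ` D_edges n. edge_value ?g e) =
      (real_of_int (R 1) * u (p 3) + u (p 1) * real_of_int (R 3)) +
      (real_of_int (R 2) * u (p 3) + u (p 2) * real_of_int (R 3)) +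
      (\<Sum>i\<in>{3..<n}. real_of_int (R i) * u (p (Suc i)) + u (p i) * real_of_int (R (Suc i)))" .
    have V2: "(\<Sum>v\<in>p ` {1..n}. 2 * (of_int (q v) * u v)) = (\<Sum>i\<in>{1..n}. 2 * (real_of_int (R i) * u (p i)))"
    proof -
      have "(\<Sum>v\<in>p ` {1..n}. 2 * (of_int (q v) * u v)) = (\<Sum>i\<in>{1..n}. 2 * (of_int (q (p i)) * u (p i)))"
        by (subst sum.reindex[OF p(1)]) simp
      also have "\<dots> = (\<Sum>i\<in>{1..n}. 2 * (real_of_int (R i) * u (p i)))"
        by (intro sum.cong) (auto simp: qp)
      finally show ?thesis .
    qed
    show "(\<Sum>v\<in>p ` {1..n}. 2 * (of_int (q v) * u v)) - (\<Sum>e\<in>(\<lambda>e. p ` e) ` D_edges n. edge_value ?g e) = u y"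
      unfolding V2 E p(2) by (rule D_root_identity[OF assms(2)]) (simp add: R_def)
  next
    show "y \<in> p ` {1..n}" "q y = 2" using assms(2) p(2) qp[of "n - 1"] by (auto simp: R_def)
  qed (use finite_D_edges in \<open>auto simp: q_def R_def\<close>)
  have mem: "{p i, p j} \<in> (\<lambda>e. p ` e) ` D_edges n \<longleftrightarrow> {i, j} \<in> D_edges n" if "i \<in> {1..n}" "j \<in> {1..n}" for i j
  proof -
    have "{i, j} \<in> Pow {1..n}" using that by simp
    moreover have "{p i, p j} = p ` {i, j}" by simp
    ultimately show ?thesis
      using inj_on_image_mem_iff[OF inj_on_image_Pow[OF p(1)], of "{i, j}" "D_edges n"] D_edges_subset[of n] assms(2)
      by simp
  qed
  have "x \<in> neighbors Q y \<longleftrightarrow> x \<in> {p (n - 2), p n}" for x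
  proof -
    have "x \<in> neighbors Q y \<longleftrightarrow> {x, p (n - 1)} \<in> (\<lambda>e. p ` e) ` D_edges n"
      unfolding neighbors_underlying[OF Q] p(2) by simp
    also have "\<dots> \<longleftrightarrow> (\<exists>i\<in>{1..n}. x = p i \<and> {i, n - 1} \<in> D_edges n)"
    proof
      assume x: "{x, p (n - 1)} \<in> (\<lambda>e. p ` e) ` D_edges n"
      then obtain e where "{x, p (n - 1)} = p ` e" "e \<in> D_edges n" by blast
      then have "x \<in> p ` e" "e \<subseteq> {1..n}" using D_edges_subset[of n] assms(2) by auto
      then obtain i where i: "i \<in> {1..n}" "x = p i" by blast
      then have "{i, n - 1} \<in> D_edges n" using x mem[of i "n - 1"] assms(2) by simp
      then show "\<exists>i\<in>{1..n}. x = p i \<and> {i, n - 1} \<in> D_edges n" using i by blast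
    next
      assume "\<exists>i\<in>{1..n}. x = p i \<and> {i, n - 1} \<in> D_edges n"
      then obtain i where "i \<in> {1..n}" "x = p i" "{i, n - 1} \<in> D_edges n" by blast
      then show "{x, p (n - 1)} \<in> (\<lambda>e. p ` e) ` D_edges n" using mem[of i "n - 1"] assms(2) by simp
    qed
    also have "\<dots> \<longleftrightarrow> x \<in> {p (n - 2), p n}"
      unfolding D_edges_neighbors[OF assms(2)] using assms(2) by auto
    finally show ?thesis .
  qed
  then have "neighbors Q y = {p (n - 2), p n}" by blast
  then show thesis
    by (rule that[OF cert]) (use assms(2) in \<open>auto simp: V p(2) qp R_def pe\<close>)
qed

text \<open>For \<open>D\<^sub>4\<close> the vertex \<open>n - 1 = 3\<close> is the center, which is joined to the three other vertices.\<close>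

lemma dynkin_D4_verts:
  assumes "dynkin_D 4 Q y" shows "verts Q \<subseteq> {y} \<union> neighbors Q y"
proof -
  obtain p where p: "y = p (4 - 1)"
    and Q: "has_underlying_graph Q (p ` {1..4}) ((\<lambda>e. p ` e) ` D_edges 4)"
    using assms unfolding dynkin_D_def by blast
  have V: "verts Q = p ` {1..4}" using Q by (simp add: has_underlying_graph_def)
  have y: "y = p 3" using p by simp
  have "{p 1, p 3} \<in> (\<lambda>e. p ` e) ` D_edges 4"
    by (intro image_eqI[of _ _ "{1, 3}"]) (auto simp: D_edges_def)
  moreover have "{p 2, p 3} \<in> (\<lambda>e. p ` e) ` D_edges 4"
    by (intro image_eqI[of _ _ "{2, 3}"]) (auto simp: D_edges_def)
  moreover have "{p 4, p 3} \<in> (\<lambda>e. p ` e) ` D_edges 4"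
    by (intro image_eqI[of _ _ "{3, 4}"]) (auto simp: D_edges_def)
  moreover have "{1..4} = {1, 2, 3, 4::nat}" by auto
  ultimately show ?thesis unfolding V neighbors_underlying[OF Q] y by auto
qed


section \<open>The restriction of the maximal indecomposable representation\<close>

text \<open>Since the symmetrised entries of each row add up to 1, they are the adjacency matrix of a perfect matching
  of four points. The order within each pair is chosen so that the entry itself is not zero.\<close>

lemma four_elements_pairing:
  fixes h :: "nat \<Rightarrow> nat \<Rightarrow> nat"
  assumes "\<And>i. i < 4 \<Longrightarrow> (\<Sum>j\<in>{..<4} - {i}. int (h i j) + int (h j i)) = 1"
  obtains a b c d where "distinct [a, b, c, d]" "{a, b, c, d} = {..<4}" "h a b \<noteq> 0" "h c d \<noteq> 0"
proof -
  note goal = that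
  have S: "{..<4} - {0} = {1, 2, 3::nat}" "{..<4} - {1} = {0, 2, 3::nat}"
    "{..<4} - {2} = {0, 1, 3::nat}" "{..<4} - {3} = {0, 1, 2::nat}" "{..<4} = {0, 1, 2, 3::nat}" by auto
  define t where "t i j = h i j + h j i" for i j
  have e: "t 0 1 + t 0 2 + t 0 3 = 1" "t 0 1 + t 1 2 + t 1 3 = 1" "t 0 2 + t 1 2 + t 2 3 = 1" "t 0 3 + t 1 3 + t 2 3 = 1"
    using assms[of 0] assms[of 1] assms[of 2] assms[of 3] unfolding S(1-4) by (simp_all add: t_def)
  have pair: thesis if "{a, b, c, d} = {..<4}" "distinct [a, b, c, d]" "t a b \<noteq> 0" "t c d \<noteq> 0" for a b c d
  proof -
    have "\<exists>a' b'. {a', b'} = {a, b} \<and> a' \<noteq> b' \<and> h a' b' \<noteq> 0"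
      using that(2,3) by (cases "h a b = 0") (auto simp: t_def intro: exI[of _ a] exI[of _ b])
    then obtain a' b' where 1: "{a', b'} = {a, b}" "a' \<noteq> b'" "h a' b' \<noteq> 0" by blast
    have "\<exists>c' d'. {c', d'} = {c, d} \<and> c' \<noteq> d' \<and> h c' d' \<noteq> 0"
      using that(2,4) by (cases "h c d = 0") (auto simp: t_def intro: exI[of _ c] exI[of _ d])
    then obtain c' d' where 2: "{c', d'} = {c, d}" "c' \<noteq> d'" "h c' d' \<noteq> 0" by blast
    have "distinct [a', b', c', d']" "{a', b', c', d'} = {..<4}"
      using 1(1,2) 2(1,2) that(1,2) by (auto simp: doubleton_eq_iff)
    then show thesis by (rule goal[OF _ _ 1(3) 2(3)])
  qed
  consider "t 0 1 \<noteq> 0" "t 2 3 \<noteq> 0" | "t 0 2 \<noteq> 0" "t 1 3 \<noteq> 0" | "t 0 3 \<noteq> 0" "t 1 2 \<noteq> 0" using e by linarith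
  then show thesis
  proof cases
    case 1 show ?thesis by (rule pair[of 0 1 2 3]) (use 1 S(5) in auto)
  next
    case 2 show ?thesis by (rule pair[of 0 2 1 3]) (use 2 S(5) in auto)
  next
    case 3 show ?thesis by (rule pair[of 0 3 1 2]) (use 3 S(5) in auto)
  qed
qed

lemma maximal_indecomposable_restriction:
  assumes M: "maximal_indecomposable s Q M" and q: "root_certificate Q y q"
  defines "S \<equiv> verts Q - ({y} \<union> neighbors Q y)"
  shows "finite_quiver s (Q \<restriction> S)" "positive_definite (Q \<restriction> S)" "is_rep s (Q \<restriction> S) M"
    "ext_vanishes s (Q \<restriction> S) M M" "\<And>v. v \<in> S \<Longrightarrow> dim_vector s (Q \<restriction> S) M v = q v"
    "hom_dim s (Q \<restriction> S) M M = nat (tits_form (Q \<restriction> S) q)"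
proof -
  have ind: "indecomposable s Q M" and mx: "maximal_positive_root Q (dim_vector s Q M)"
    using M by (auto simp: maximal_indecomposable_def)
  have rM: "is_rep s Q M" using ind by (simp add: indecomposable_def)
  have fd: "fin_digraph Q" using q by (simp add: root_certificate_def)
  have "vector_space s" using rM by (simp add: is_rep_def)
  with fd have "finite_quiver s Q" by (simp add: finite_quiver_def)
  then interpret finite_quiver s Q .
  have S: "S \<subseteq> verts Q" by (auto simp: S_def)
  note pos = root_certificate_positive_definite[OF q]
  show fq: "finite_quiver s (Q \<restriction> S)" by (rule finite_quiver_induced[OF S])
  then interpret R: finite_quiver s "Q \<restriction> S" .
  show "positive_definite (Q \<restriction> S)" by (rule positive_definite_induced[OF fd S pos])
  show rS: "is_rep s (Q \<restriction> S) M" by (rule is_rep_induced[OF rM S])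
  show ext: "ext_vanishes s (Q \<restriction> S) M M"
    by (rule ext_vanishes_restrict[OF rM rM S indecomposable_exceptional(3)[OF pos ind]])
  have "dim_vector s Q M = q" by (rule maximal_positive_root_eq[OF q mx])
  then show dv: "dim_vector s (Q \<restriction> S) M v = q v" if "v \<in> S" for v
    using that S by (auto simp: dim_vector_def fun_eq_iff split: if_splits)
  have "int (hom_dim s (Q \<restriction> S) M M) = tits_form (Q \<restriction> S) (dim_vector s (Q \<restriction> S) M)"
    using R.euler_form_le_hom_dim(3)[OF rS rS] ext by (simp add: tits_form_eq_euler_form)
  also have "\<dots> = tits_form (Q \<restriction> S) q"
    by (rule tits_form_cong) (use dv in \<open>auto intro: R.wf_digraph_axioms\<close>)
  finally show "hom_dim s (Q \<restriction> S) M M = nat (tits_form (Q \<restriction> S) q)" by simp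
qed

theorem theorem3p8:
  fixes s :: "'k::field \<Rightarrow> 'b::ab_group_add \<Rightarrow> 'b"
    and \<Delta> :: "('v, 'a) pre_digraph"
    and y :: 'v
    and M :: "('v, 'a, 'b) quiver_rep"
  assumes "maximal_indecomposable s \<Delta> M"
  shows
    "let \<Delta>'' = delete_with_neighbors \<Delta> y in
     (dynkin_D 4 \<Delta> y \<longrightarrow> zero_rep \<Delta>'' M) \<and>
     (\<forall>n\<ge>5. dynkin_D n \<Delta> y \<longrightarrow>
        (\<exists>A B. antichain_pair s \<Delta>'' A B \<and>
               is_direct_sum s \<Delta>'' M [A, B])) \<and>
     (\<forall>m\<in>{6, 7, 8}. dynkin_E m \<Delta> y \<longrightarrow>
        (\<exists>U V U' V'.
           indecomposable s \<Delta>'' U \<and>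
           indecomposable s \<Delta>'' V \<and>
           indecomposable s \<Delta>'' U' \<and>
           indecomposable s \<Delta>'' V' \<and>
           is_direct_sum s \<Delta>'' M [U, V, U', V'] \<and>
           rep_hom s \<Delta>'' U V \<noteq> {0} \<and>
           rep_hom s \<Delta>'' U' V' \<noteq> {0} \<and>
           hom_dim s \<Delta>'' M M = 6))"
proof -
  define S where "S = verts \<Delta> - ({y} \<union> neighbors \<Delta> y)"
  define R where "R = \<Delta> \<restriction> S"
  have R: "delete_with_neighbors \<Delta> y = R" by (simp add: R_def S_def delete_with_neighbors_def)
  have vR: "verts R = S" by (simp add: R_def)
  have ext0: "extend_by_0 S (\<lambda>v. \<Sum>i\<in>I. d i v) = (\<lambda>v. \<Sum>i\<in>I. extend_by_0 S (d i) v)"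
    for I :: "nat set" and d by (auto simp: extend_by_0_def fun_eq_iff)
  \<comment> \<open>With no vertices left, every representation is zero.\<close>
  have D4: "zero_rep R M" if "dynkin_D 4 \<Delta> y"
    using dynkin_D4_verts[OF that] by (auto simp: zero_rep_def vR S_def)
  \<comment> \<open>The numerical part for \<open>q\<close> transfers to the dimension vector of the restriction of \<open>M\<close>, which agrees with
    \<open>q\<close> on the subquiver.\<close>
  have summands: "\<exists>Ns. is_direct_sum s R M Ns \<and> length Ns = r \<and> (\<forall>i<r. indecomposable s R (Ns ! i)) \<and>
      (\<forall>i<r. (\<Sum>j\<in>{..<r} - {i}. int (hom_dim s R (Ns ! i) (Ns ! j)) + int (hom_dim s R (Ns ! j) (Ns ! i))) = c - 2)"
    if q: "root_certificate \<Delta> y q"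
      and P: "\<And>d. (\<And>v. v \<notin> S \<Longrightarrow> d v = 0) \<Longrightarrow>
        polar_form R q d = c * - polar_form \<Delta> (unit_vector z) (extend_by_0 S d)"
      and Hq: "- polar_form \<Delta> (unit_vector z) (extend_by_0 S q) = int r"
      and c: "c > 0" "tits_form R q + 4 < 4 * c"
    for q z c r
  proof -
    note rr = maximal_indecomposable_restriction[OF assms q, folded S_def, folded R_def]
    interpret R: finite_quiver s R by (rule rr(1))
    have wf: "wf_digraph R" by (rule R.wf_digraph_axioms)
    let ?d = "dim_vector s R M"
    have pq: "polar_form R ?d e = polar_form R q e" for e
      unfolding polar_form_def
      by (rule arg_cong2[where f = "(+)"]; rule euler_form_cong[OF wf]) (simp_all add: vR rr(5))
    have tq: "tits_form R ?d = tits_form R q" by (rule tits_form_cong[OF wf]) (simp add: vR rr(5))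
    have eq: "extend_by_0 S ?d = extend_by_0 S q" by (auto simp: extend_by_0_def rr(5))
    show ?thesis
      by (rule R.rigid_summands_count[OF rr(2,3,4), where H = "\<lambda>d. - polar_form \<Delta> (unit_vector z) (extend_by_0 S d)"
            and c = c and r = r])
        (use P Hq c in \<open>auto simp: pq tq eq vR ext0 polar_form_sym[of \<Delta> "unit_vector z"] polar_form_sum_left sum_negf\<close>)
  qed
  have Dn: "\<exists>A B. antichain_pair s R A B \<and> is_direct_sum s R M [A, B]" if n: "n \<ge> 5" "dynkin_D n \<Delta> y" for n
  proof -
    obtain q z w where q: "root_certificate \<Delta> y q" "neighbors \<Delta> y = {z, w}"
      "z \<in> verts \<Delta>" "z \<noteq> y" "q z = 2" "w \<in> verts \<Delta>" "w \<noteq> y" "q w = 1"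
      using dynkin_D_certificate[OF n(2,1)] by metis
    note tn = two_neighbors_forms[OF q, folded S_def, folded R_def]
    note rr = maximal_indecomposable_restriction[OF assms q(1), folded S_def, folded R_def]
    interpret R: finite_quiver s R by (rule rr(1))
    obtain Ns where Ns: "is_direct_sum s R M Ns" "length Ns = 2" "\<And>i. i < 2 \<Longrightarrow> indecomposable s R (Ns ! i)"
      "\<And>i. i < 2 \<Longrightarrow> (\<Sum>j\<in>{..<2} - {i}. int (hom_dim s R (Ns ! i) (Ns ! j)) + int (hom_dim s R (Ns ! j) (Ns ! i))) = 0"
      using summands[OF q(1), where c = 2 and r = 2 and z = z] tn by auto
    obtain A B where AB: "Ns = [A, B]" using Ns(2) by (auto simp: length_Suc_conv numeral_2_eq_2)
    have ind: "indecomposable s R A" "indecomposable s R B" using Ns(3)[of 0] Ns(3)[of 1] by (auto simp: AB)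
    then have rep: "is_rep s R A" "is_rep s R B" by (simp_all add: indecomposable_def)
    have "{..<2} - {0} = {1::nat}" by auto
    then have "hom_dim s R A B = 0" "hom_dim s R B A = 0" using Ns(4)[of 0] by (auto simp: AB)
    then have "rep_hom s R A B = {0}" "rep_hom s R B A = {0}" using R.rep_hom_zero_iff rep by auto
    moreover have "division_ring (End_ring s R A)" "division_ring (End_ring s R B)"
      using R.brick_End_division_ring R.indecomposable_exceptional(1)[OF rr(2)] ind by auto
    ultimately have "antichain_pair s R A B" using rep by (simp add: antichain_pair_def)
    then show ?thesis using Ns(1) AB by blast
  qed
  have Em: "\<exists>U V U' V'. indecomposable s R U \<and> indecomposable s R V \<and> indecomposable s R U' \<and>
      indecomposable s R V' \<and> is_direct_sum s R M [U, V, U', V'] \<and>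
      rep_hom s R U V \<noteq> {0} \<and> rep_hom s R U' V' \<noteq> {0} \<and> hom_dim s R M M = 6"
    if m: "dynkin_E m \<Delta> y" for m
  proof -
    obtain q z where q: "root_certificate \<Delta> y q" "neighbors \<Delta> y = {z}"
      "z \<in> verts \<Delta>" "z \<noteq> y" "q z = 3"
      using dynkin_E_certificate[OF m] by metis
    note sn = one_neighbor_forms[OF q, folded S_def, folded R_def]
    note rr = maximal_indecomposable_restriction[OF assms q(1), folded S_def, folded R_def]
    interpret R: finite_quiver s R by (rule rr(1))
    obtain Ns where Ns: "is_direct_sum s R M Ns" "length Ns = 4" "\<And>i. i < 4 \<Longrightarrow> indecomposable s R (Ns ! i)"
      "\<And>i. i < 4 \<Longrightarrow> (\<Sum>j\<in>{..<4} - {i}. int (hom_dim s R (Ns ! i) (Ns ! j)) + int (hom_dim s R (Ns ! j) (Ns ! i))) = 1"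
      using summands[OF q(1), where c = 3 and r = 4 and z = z] sn by auto
    obtain a b c d where p: "distinct [a, b, c, d]" "{a, b, c, d} = {..<4}"
      "hom_dim s R (Ns ! a) (Ns ! b) \<noteq> 0" "hom_dim s R (Ns ! c) (Ns ! d) \<noteq> 0"
      using four_elements_pairing[of "\<lambda>i j. hom_dim s R (Ns ! i) (Ns ! j)"] Ns(4) by blast
    have lt: "a < 4" "b < 4" "c < 4" "d < 4" using p(2) by auto
    have up: "[0..<4] = [0, 1, 2, 3]" by (simp add: upt_rec)
    have "bij_betw (\<lambda>i. [a, b, c, d] ! i) {..<length Ns} {..<length Ns}"
      by (rule bij_betw_nth[OF p(1)]) (simp_all add: p(2) Ns(2))
    from R.is_direct_sum_permute[OF Ns(1) this]
    have ds: "is_direct_sum s R M [Ns ! a, Ns ! b, Ns ! c, Ns ! d]"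
      by (simp add: Ns(2) up numeral_2_eq_2 numeral_3_eq_3)
    have ind: "indecomposable s R (Ns ! i)" "is_rep s R (Ns ! i)" if "i < 4" for i
      using Ns(3)[OF that] by (auto simp: indecomposable_def)
    have "rep_hom s R (Ns ! a) (Ns ! b) \<noteq> {0}" "rep_hom s R (Ns ! c) (Ns ! d) \<noteq> {0}"
      using R.rep_hom_zero_iff ind(2) lt p(3,4) by auto
    moreover have "hom_dim s R M M = 6" using rr(6) sn(3) by simp
    ultimately show ?thesis using ind(1) lt ds by blast
  qed
  show ?thesis unfolding Let_def R using D4 Dn Em by blast
qed

end
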